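(* Let $T\subseteq E$ be a connected backbone, and let $s_t\in[0,1]^m$ be the $t$-th iterate of the Frank–Wolfe procedure, which satisfies $\|s_t\|_1\le q$ and $(s_t)_e=1$ for all $e\in T$. Let $p_{\min}$ be a baseline probability, and define $\bar s_e:=\max\{(s_t)_e,p_{\min}\}$ for all $e\notin T$ and $\bar s_e:=1$ for $e\in T$. Obtain a random $\tilde s\in\{0,1\}^m$ by independent Bernoulli rounding, with $\Pr[\tilde s_e=1]=\bar s_e$ for each $e\in E$. Then there exists an absolute constant $C>0$ such that for any $\delta\in(0,1)$ the following holds with probability at least $1-\delta$: $$(1-\epsilon)\,L_{\bar s}\;\preccurlyeq\;L_{\tilde s}\;\preccurlyeq\;(1+\epsilon)\,L_{\bar s}\qquad\text{on }\operatorname{span}(\mathbf 1)^\perp,$$ where $$\epsilon=C\sqrt{\frac{R\log((n-1)/\delta)}{\lambda_2(L_{\bar s})}},\qquad R=2\max_{e}w_e .$$ Consequently, for any demand vector $\vec d\perp\mathbf 1$, one has $$\frac{1}{1+\epsilon}\,\varphi(\bar s)\;\le\;\varphi(\tilde s)\;\le\;\frac{1}{1-\epsilon}\,\varphi(\bar s)$$ with probability at least $1-\delta$, where $\varphi(s):=\vec d^\top L_s^\dagger\vec d$.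
   Context: $G=(N,E,w)$ is an undirected weighted (multi)graph with $n=|N|$ nodes, $m=|E|$ edges and positive edge weights $w\in\mathbb{R}^m_+$. For edge $e=(i,j)$, $a_e=e_i-e_j\in\mathbb{R}^n$. For $s\in[0,1]^m$, $L_s=\sum_{e\in E}s_ew_ea_ea_e^\top$ is the switched Laplacian, $\dagger$ is the Moore–Penrose pseudoinverse, and $\lambda_2(\cdot)$ is the second-smallest eigenvalue. A connected backbone is a set $T\subseteq E$ of edges forming a connected spanning subgraph of $G$; $q$ is an integer edge budget. The Frank–Wolfe procedure minimizes $\varphi$ over $\{s\in[0,1]^m:\|s\|_1\le q,\ s_e=1\ \forall e\in T\}$: starting from a feasible $s_0$, it sets $s_{t+1}=(1-\eta_t)s_t+\eta_tv_t$ with $\eta_t=2/(t+2)$ and $v_t$ a minimizer of $\langle\nabla\varphi(s_t),v\rangle$ over the feasible set. The paper's typical choice of baseline probability is $p_{\min}=c\log(n/\delta)/n$ with $c$ a universal constant, but other values in $[0,1]$ (including $0$) are allowed. $\preccurlyeq$ is the Loewner order, here for the quadratic forms restricted to $\operatorname{span}(\mathbf 1)^\perp$.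
   Formalization: The upper Loewner bound is claimed only when ε ≤ 1, the φ-sandwich only when ε < 1, and for n = 2 only δ ≤ 1/2 is allowed (n ≥ 2 throughout); without these conditions the statement is false for every absolute constant C or 1/(1−ε) is undefined or negative. *)

theory Defs
  imports
    "HOL-Probability.Probability"
    "HOL-Probability.Product_PMF"
    "Jordan_Normal_Form.Char_Poly"
    "Graph_Theory.Digraph_Component"
begin

unbundle no vec_syntax
unbundle no inner_syntax

text \<open>
  An undirected multigraph on the nodes \<open>0, ..., n - 1\<close> is represented by an
  arbitrarily oriented finite digraph with labelled arcs, one arc per undirected edge.
  Arcs with equal or opposite ends are distinct parallel edges, and the orientation is
  immaterial because only \<open>a\<^sub>e a\<^sub>e\<^sup>T\<close> and the connectivity of the symmetric closure
  are ever used. Nodes and edges have the fixed type \<^typ>\<open>nat\<close> rather than a type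
  variable, so that a constant chosen before the graph cannot depend on its size.
\<close>

definition weighted_multigraph ::
    "nat \<Rightarrow> (nat, nat) pre_digraph \<Rightarrow> (nat \<Rightarrow> real) \<Rightarrow> bool" where
  "weighted_multigraph n G w \<longleftrightarrow>
     fin_digraph G \<and> verts G = {..<n} \<and> (\<forall>e\<in>arcs G. 0 < w e)"

definition connected_backbone :: "(nat, nat) pre_digraph \<Rightarrow> nat set \<Rightarrow> bool" where
  "connected_backbone G T \<longleftrightarrow>
     T \<subseteq> arcs G \<and> spanning (G\<lparr>arcs := T\<rparr>) G \<and> Digraph_Component.connected (G\<lparr>arcs := T\<rparr>)"

definition incidence_vec :: "nat \<Rightarrow> (nat, nat) pre_digraph \<Rightarrow> nat \<Rightarrow> real Matrix.vec" where
  "incidence_vec n G e = unit_vec n (tail G e) - unit_vec n (head G e)"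

text \<open>
  Edge vectors such as \<open>s \<in> \<real>\<^sup>m\<close> are functions on arcs, whose values outside
  \<^term>\<open>arcs G\<close> are irrelevant. The entries below are those of
  \<open>\<Sum>\<^sub>e s\<^sub>e w\<^sub>e a\<^sub>e a\<^sub>e\<^sup>T\<close>.
\<close>

definition switched_laplacian ::
    "nat \<Rightarrow> (nat, nat) pre_digraph \<Rightarrow> (nat \<Rightarrow> real) \<Rightarrow> (nat \<Rightarrow> real) \<Rightarrow> real Matrix.mat" where
  "switched_laplacian n G w s = Matrix.mat n n (\<lambda>(i, j).
     \<Sum>e\<in>arcs G. s e * w e * (incidence_vec n G e $ i * incidence_vec n G e $ j))"

text \<open>The Moore--Penrose pseudoinverse, characterised by the four Penrose equations.\<close>

definition pinv :: "real Matrix.mat \<Rightarrow> real Matrix.mat" where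
  "pinv A = (THE X. X \<in> carrier_mat (dim_col A) (dim_row A) \<and>
     A * X * A = A \<and> X * A * X = X \<and>
     transpose_mat (A * X) = A * X \<and> transpose_mat (X * A) = X * A)"

text \<open>
  The second-smallest eigenvalue, counted with multiplicity. It is used for real symmetric
  matrices of dimension at least 2, whose characteristic polynomial splits over the reals.
\<close>

definition lambda2 :: "real Matrix.mat \<Rightarrow> real" where
  "lambda2 A = sorted_list_of_multiset (proots (char_poly A)) ! 1"

definition ones_perp :: "nat \<Rightarrow> real Matrix.vec set" where
  "ones_perp n = {x \<in> carrier_vec n. x \<bullet> Matrix.vec n (\<lambda>_. 1) = 0}"

definition loewner_le_on ::
    "real Matrix.vec set \<Rightarrow> real Matrix.mat \<Rightarrow> real Matrix.mat \<Rightarrow> bool" where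
  "loewner_le_on V A B \<longleftrightarrow> (\<forall>x\<in>V. x \<bullet> (A *\<^sub>v x) \<le> x \<bullet> (B *\<^sub>v x))"

definition demand_energy ::
    "nat \<Rightarrow> (nat, nat) pre_digraph \<Rightarrow> (nat \<Rightarrow> real) \<Rightarrow> real Matrix.vec \<Rightarrow> (nat \<Rightarrow> real) \<Rightarrow> real"
  where
  "demand_energy n G w d s = d \<bullet> (pinv (switched_laplacian n G w s) *\<^sub>v d)"

definition feasible_set :: "nat set \<Rightarrow> nat set \<Rightarrow> int \<Rightarrow> (nat \<Rightarrow> real) set" where
  "feasible_set E T q = {s. (\<forall>e\<in>E. 0 \<le> s e \<and> s e \<le> 1) \<and>
     (\<Sum>e\<in>E. \<bar>s e\<bar>) \<le> of_int q \<and> (\<forall>e\<in>T. s e = 1)}"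

definition has_gradient ::
    "nat set \<Rightarrow> ((nat \<Rightarrow> real) \<Rightarrow> real) \<Rightarrow> (nat \<Rightarrow> real) \<Rightarrow> (nat \<Rightarrow> real) \<Rightarrow> bool" where
  "has_gradient E f g s \<longleftrightarrow>
     (\<forall>e\<in>E. ((\<lambda>x. f (s(e := x))) has_real_derivative g e) (at (s e)))"

text \<open>
  \<open>fw_iterate E f F t s\<close>: the vector \<open>s\<close> is a possible \<open>t\<close>-th Frank--Wolfe iterate for
  minimising \<open>f\<close> over \<open>F \<subseteq> \<real>\<^sup>E\<close>, for some feasible start and some choice of the
  linear minimisers.
\<close>

inductive fw_iterate ::
    "nat set \<Rightarrow> ((nat \<Rightarrow> real) \<Rightarrow> real) \<Rightarrow> (nat \<Rightarrow> real) set \<Rightarrow> nat \<Rightarrow> (nat \<Rightarrow> real) \<Rightarrow> bool"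
  for E f F where
  init: "s \<in> F \<Longrightarrow> fw_iterate E f F 0 s"
| step: "\<lbrakk>fw_iterate E f F t s; has_gradient E f g s; v \<in> F;
          \<And>u. u \<in> F \<Longrightarrow> (\<Sum>e\<in>E. g e * v e) \<le> (\<Sum>e\<in>E. g e * u e);
          \<eta> = 2 / (real t + 2)\<rbrakk>
         \<Longrightarrow> fw_iterate E f F (Suc t) (\<lambda>e. (1 - \<eta>) * s e + \<eta> * v e)"

definition with_baseline :: "nat set \<Rightarrow> real \<Rightarrow> (nat \<Rightarrow> real) \<Rightarrow> nat \<Rightarrow> real" where
  "with_baseline T p s e = (if e \<in> T then 1 else max (s e) p)"

definition bernoulli_rounding :: "nat set \<Rightarrow> (nat \<Rightarrow> real) \<Rightarrow> (nat \<Rightarrow> real) pmf" where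
  "bernoulli_rounding E s = Pi_pmf E 0 (\<lambda>e. map_pmf of_bool (bernoulli_pmf (s e)))"

end

theory Submission
  imports Defs
begin

text \<open>
  The Laplacian of the rounded edge vector is a sum of independent positive semidefinite matrices
  of rank one, so the statement is a matrix Chernoff bound. The proof whitens the Laplacian of the
  probabilities: in a suitable coordinate system it becomes the identity, and edge \<open>e\<close> contributes
  \<open>v\<^sub>e v\<^sub>e\<^sup>T\<close>, where \<open>|v\<^sub>e|\<^sup>2\<close> is at most \<open>\<rho> = R / \<lambda>\<^sub>2\<close> (\<open>whitened_bernoulli_frame\<close>). The random
  sum \<open>S = \<Sum>\<^sub>e b\<^sub>e v\<^sub>e v\<^sub>e\<^sup>T\<close> has the identity as its expectation, apart from one direction \<open>z\<close>
  that corresponds to the constant vector. It remains to show that, orthogonally to \<open>z\<close>, the form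
  of \<open>S\<close> lies between \<open>1 - \<epsilon>\<close> and \<open>1 + \<epsilon>\<close> times the identity, where each side fails with
  probability at most \<open>n exp (- \<epsilon>\<^sup>2 / (16 \<rho>))\<close>.

  Matrix Chernoff bounds are usually derived from Lieb's concavity theorem. For summands of rank
  one there is an elementary route, with the potential \<open>tr (I + \<eta> S)\<^sup>m\<^sup>+\<^sup>1\<close>, up to a fixed term
  for the direction \<open>z\<close>, in place of the trace of an exponential; a small positive \<open>\<eta>\<close> controls
  the upper tail and a small negative \<open>\<eta>\<close> the lower one. The Bernoulli variables are replaced one
  at a time by the constants \<open>c p\<^sub>e\<close>, and the potential must not decrease in expectation when this
  happens (\<open>mat_trace_pow_bernoulli_step\<close>). Write \<open>Z\<close> for the matrix without edge \<open>e\<close>, and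
  \<open>Z' = Z + \<eta> v v\<^sup>T\<close>. Convexity of the trace of a power (Klein's inequality, \<open>klein_rank_one\<close>)
  bounds the increase caused by the edge from above by \<open>(m + 1) \<eta> v\<^sup>T Z'\<^sup>m v\<close>, and the increase
  caused by the constant \<open>c p\<^sub>e\<close> from below by \<open>(m + 1) \<eta> c p\<^sub>e v\<^sup>T Z\<^sup>m v\<close>. So it suffices to
  compare the two moments \<open>v\<^sup>T Z'\<^sup>m v\<close> and \<open>v\<^sup>T Z\<^sup>m v\<close>, and they differ by a factor of at most
  \<open>(1 + |\<eta>| \<rho> / \<kappa>)\<^sup>m\<close> if \<open>\<kappa>\<close> is a lower bound for the spectrum (\<open>rank_one_update_moment_le\<close>). This
  comparison is where rank one is essential: expanding the power of \<open>Z'\<close> yields products of scalar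
  moments, which Chebyshev's sum inequality bounds.

  After all replacements the matrix is \<open>(1 + \<eta> c) I\<close>, whose potential is \<open>n (1 + \<eta> c)\<^sup>m\<^sup>+\<^sup>1\<close>, and
  Markov's inequality gives both tails (\<open>upper_tail\<close>, \<open>lower_tail\<close>). The bounds for the energies
  are deterministic consequences of the two Loewner inequalities, because the pseudoinverse
  reverses the order (\<open>pinv_energy_antimono\<close>). If \<open>\<epsilon> > 1\<close>, then the lower Loewner inequality holds
  trivially.
\<close>

section \<open>The spectral theorem for real symmetric matrices\<close>

definition eigenbasis ::
    "nat \<Rightarrow> real Matrix.mat \<Rightarrow> (nat \<Rightarrow> real) \<Rightarrow> (nat \<Rightarrow> real Matrix.vec) \<Rightarrow> bool" where
  "eigenbasis n A l u \<longleftrightarrow>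
     (\<forall>i<n. u i \<in> carrier_vec n \<and> A *\<^sub>v u i = l i \<cdot>\<^sub>v u i) \<and>
     (\<forall>i<n. \<forall>j<n. u i \<bullet> u j = (if i = j then 1 else 0))"

lemma symmetric_mat_scalar_prod:
  fixes A :: "real Matrix.mat"
  assumes "A \<in> carrier_mat n n" "transpose_mat A = A" "x \<in> carrier_vec n" "y \<in> carrier_vec n"
  shows "(A *\<^sub>v x) \<bullet> y = x \<bullet> (A *\<^sub>v y)"
  using transpose_vec_mult_scalar[of A n n y x] assms
  by (metis mult_mat_vec_carrier comm_scalar_prod)

lemma scalar_prod_self_nonneg: "0 \<le> x \<bullet> (x :: real Matrix.vec)"
  by (simp add: scalar_prod_def sum_nonneg)

lemma scalar_prod_self_eq_0:
  assumes "x \<in> carrier_vec n" shows "x \<bullet> x = 0 \<longleftrightarrow> x = (0\<^sub>v n :: real Matrix.vec)"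
  using conjugate_square_eq_0_vec[OF assms] by simp

text \<open>
  A complex eigenvector \<open>x + i y\<close> exists by the fundamental theorem of algebra. Symmetry forces
  its eigenvalue to be real, so that \<open>x\<close> and \<open>y\<close> are real eigenvectors unless they vanish. The
  sign condition on the first coordinate is what the reflection below needs.
\<close>
lemma symmetric_mat_unit_eigenvector:
  fixes A :: "real Matrix.mat"
  assumes A: "A \<in> carrier_mat n n" and sym: "transpose_mat A = A" and n: "0 < n"
  obtains a u where "u \<in> carrier_vec n" "u \<bullet> u = 1" "0 \<le> u $ 0" "A *\<^sub>v u = a \<cdot>\<^sub>v u"
proof -
  let ?B = "map_mat complex_of_real A"
  have B: "?B \<in> carrier_mat n n" using A by simp
  obtain as where as: "char_poly ?B = (\<Prod>a\<leftarrow>as. [:- a, 1:])" "length as = n"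
    using char_poly_factorized[OF B] by blast
  then have "poly (char_poly ?B) (as ! 0) = 0"
    using n by (cases as) auto
  then obtain v where v: "v \<in> carrier_vec n" "v \<noteq> 0\<^sub>v n" and ev: "?B *\<^sub>v v = (as ! 0) \<cdot>\<^sub>v v"
    using eigenvalue_root_char_poly[OF B] B unfolding eigenvalue_def eigenvector_def by auto
  define a b where "a = Re (as ! 0)" and "b = Im (as ! 0)"
  define x y where "x = map_vec Re v" and "y = map_vec Im v"
  have xy: "x \<in> carrier_vec n" "y \<in> carrier_vec n" using v by (auto simp: x_def y_def)
  have comp: "(\<Sum>j<n. complex_of_real (A $$ (i, j)) * v $ j) = as ! 0 * v $ i" if "i < n" for i
  proof -
    have "(?B *\<^sub>v v) $ i = (\<Sum>j<n. complex_of_real (A $$ (i, j)) * v $ j)"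
      using that A v(1) by (auto simp: scalar_prod_def lessThan_atLeast0)
    then show ?thesis using ev that v(1) by simp
  qed
  have Ax: "A *\<^sub>v x = a \<cdot>\<^sub>v x - b \<cdot>\<^sub>v y"
  proof (rule eq_vecI)
    fix i assume "i < dim_vec (a \<cdot>\<^sub>v x - b \<cdot>\<^sub>v y)"
    then have i: "i < n" using xy by simp
    have "(A *\<^sub>v x) $ i = Re (\<Sum>j<n. complex_of_real (A $$ (i, j)) * v $ j)"
      using i A v(1) by (auto simp: scalar_prod_def x_def lessThan_atLeast0)
    then show "(A *\<^sub>v x) $ i = (a \<cdot>\<^sub>v x - b \<cdot>\<^sub>v y) $ i"
      unfolding comp[OF i] using i v(1) by (simp add: x_def y_def a_def b_def)
  qed (use A xy in auto)
  have Ay: "A *\<^sub>v y = a \<cdot>\<^sub>v y + b \<cdot>\<^sub>v x"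
  proof (rule eq_vecI)
    fix i assume "i < dim_vec (a \<cdot>\<^sub>v y + b \<cdot>\<^sub>v x)"
    then have i: "i < n" using xy by simp
    have "(A *\<^sub>v y) $ i = Im (\<Sum>j<n. complex_of_real (A $$ (i, j)) * v $ j)"
      using i A v(1) by (auto simp: scalar_prod_def y_def lessThan_atLeast0)
    then show "(A *\<^sub>v y) $ i = (a \<cdot>\<^sub>v y + b \<cdot>\<^sub>v x) $ i"
      unfolding comp[OF i] using i v(1) by (simp add: x_def y_def a_def b_def)
  qed (use A xy in auto)
  have nz: "x \<noteq> 0\<^sub>v n \<or> y \<noteq> 0\<^sub>v n"
  proof (rule ccontr)
    assume *: "\<not> (x \<noteq> 0\<^sub>v n \<or> y \<noteq> 0\<^sub>v n)"
    have "v $ i = 0" if "i < n" for i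
    proof -
      have "x $ i = 0" "y $ i = 0" using * that by auto
      then show ?thesis using that v(1) by (simp add: x_def y_def complex_eq_iff)
    qed
    then show False using v by (metis eq_vecI carrier_vecD index_zero_vec)
  qed
  \<comment> \<open>Evaluating \<open>y \<bullet> A x = A y \<bullet> x\<close> in two ways gives \<open>b (|x|\<^sup>2 + |y|\<^sup>2) = 0\<close>.\<close>
  have "y \<bullet> (A *\<^sub>v x) = a * (x \<bullet> y) - b * (y \<bullet> y)"
    unfolding Ax using xy by (simp add: scalar_prod_minus_distrib[of _ n] comm_scalar_prod[OF xy(2,1)])
  moreover have "(A *\<^sub>v y) \<bullet> x = a * (x \<bullet> y) + b * (x \<bullet> x)"
    unfolding Ay using xy by (simp add: add_scalar_prod_distrib[of _ n] comm_scalar_prod[OF xy(2,1)])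
  ultimately have "b * (x \<bullet> x + y \<bullet> y) = 0"
    unfolding distrib_left using symmetric_mat_scalar_prod[OF A sym xy(2,1)] by linarith
  moreover have "x \<bullet> x + y \<bullet> y \<noteq> 0"
    using nz scalar_prod_self_nonneg[of x] scalar_prod_self_nonneg[of y]
      scalar_prod_self_eq_0[OF xy(1)] scalar_prod_self_eq_0[OF xy(2)]
    by (simp add: add_nonneg_eq_0_iff)
  ultimately have b: "b = 0" by simp
  have "\<exists>t. t \<in> carrier_vec n \<and> t \<noteq> 0\<^sub>v n \<and> A *\<^sub>v t = a \<cdot>\<^sub>v t"
  proof (cases "x = 0\<^sub>v n")
    case True
    then have "y \<noteq> 0\<^sub>v n" "A *\<^sub>v y = a \<cdot>\<^sub>v y" using nz Ay xy b by (auto intro!: eq_vecI)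
    then show ?thesis using xy by blast
  next
    case False
    have "A *\<^sub>v x = a \<cdot>\<^sub>v x" using Ax xy b by (auto intro!: eq_vecI)
    then show ?thesis using xy False by blast
  qed
  then obtain t where t: "t \<in> carrier_vec n" "t \<noteq> 0\<^sub>v n" "A *\<^sub>v t = a \<cdot>\<^sub>v t" by blast
  have tt: "t \<bullet> t > 0"
    using scalar_prod_self_nonneg[of t] scalar_prod_self_eq_0[OF t(1)] t(2) by linarith
  define r where "r = (if 0 \<le> t $ 0 then 1 else -1) / sqrt (t \<bullet> t)"
  have r: "r * r * (t \<bullet> t) = 1" using tt by (simp add: r_def field_simps)
  show thesis
  proof (rule that[of "r \<cdot>\<^sub>v t" a])
    show "(r \<cdot>\<^sub>v t) \<bullet> (r \<cdot>\<^sub>v t) = 1" using r by (simp add: algebra_simps)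
    show "0 \<le> (r \<cdot>\<^sub>v t) $ 0" using n t(1) tt by (auto simp: r_def divide_nonneg_pos mult_nonpos_nonpos)
    show "A *\<^sub>v (r \<cdot>\<^sub>v t) = a \<cdot>\<^sub>v (r \<cdot>\<^sub>v t)"
      using t A by (simp add: mult_mat_vec smult_smult_assoc mult.commute)
  qed (use t in simp)
qed

text \<open>
  The reflection in the hyperplane orthogonal to \<open>w = u + e\<^sub>0\<close> swaps \<open>e\<^sub>0\<close> and \<open>- u\<close>. Aiming at
  \<open>- u\<close> instead of \<open>u\<close> keeps \<open>w\<close> away from zero, because \<open>u\<close> has a nonnegative first coordinate.
\<close>
lemma householder_reflection:
  fixes u :: "real Matrix.vec"
  assumes u: "u \<in> carrier_vec n" "u \<bullet> u = 1" "0 \<le> u $ 0" and n: "0 < n"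
  obtains H where "H \<in> carrier_mat n n" "transpose_mat H = H" "H * H = 1\<^sub>m n"
    "H *\<^sub>v unit_vec n 0 = - u"
proof -
  define c w where "c = 1 + u $ 0" and "w = u + unit_vec n 0"
  have c: "c > 0" and w: "w \<in> carrier_vec n" using u by (auto simp: c_def w_def)
  have ww: "w \<bullet> w = 2 * c"
    unfolding w_def c_def using u n
    by (simp add: add_scalar_prod_distrib[of _ n] scalar_prod_add_distrib[of _ n])
  define H where "H = Matrix.mat n n (\<lambda>(i, j). (if i = j then 1 else 0) - w $ i * w $ j / c)"
  have H: "H \<in> carrier_mat n n" by (simp add: H_def)
  have ww': "(\<Sum>k<n. w $ k * w $ k) = 2 * c"
    using ww w by (simp add: scalar_prod_def lessThan_atLeast0)
  have "(H * H) $$ (i, j) = (if i = j then 1 else 0)" if ij: "i < n" "j < n" for i j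
  proof -
    have "(H * H) $$ (i, j) = (\<Sum>k<n. ((if i = k then 1 else 0) - w $ i * w $ k / c) *
        ((if k = j then 1 else 0) - w $ k * w $ j / c))"
      using ij by (simp add: H_def scalar_prod_def lessThan_atLeast0)
    also have "\<dots> = (\<Sum>k<n. (if k = i then (if k = j then 1 else 0) else 0)
        - (if k = i then w $ k * w $ j / c else 0) - (if k = j then w $ i * w $ k / c else 0)
        + (w $ i * w $ j / c\<^sup>2) * (w $ k * w $ k))"
      by (intro sum.cong) (auto simp: algebra_simps power2_eq_square)
    also have "\<dots> = (if i = j then 1 else 0) - w $ i * w $ j / c - w $ i * w $ j / c
        + (w $ i * w $ j / c\<^sup>2) * (2 * c)"
      using ij unfolding ww'[symmetric] by (simp add: sum.distrib sum_subtractf sum_distrib_left)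
    also have "\<dots> = (if i = j then 1 else 0)" using c by (simp add: power2_eq_square)
    finally show ?thesis .
  qed
  then have HH: "H * H = 1\<^sub>m n" using H by (intro eq_matI) auto
  have He: "H *\<^sub>v unit_vec n 0 = - u"
  proof (rule eq_vecI)
    fix i assume "i < dim_vec (- u)"
    then have i: "i < n" using u by simp
    have "(H *\<^sub>v unit_vec n 0) $ i = H $$ (i, 0)" using H i n by simp
    also have "\<dots> = - u $ i" using i n u c by (auto simp: H_def w_def c_def divide_simps algebra_simps)
    finally show "(H *\<^sub>v unit_vec n 0) $ i = (- u) $ i" using i u by simp
  qed (use H u in auto)
  have "transpose_mat H = H" by (auto simp: H_def)
  then show thesis using that H HH He by blast
qed

text \<open>
  The spectral theorem, by deflation: a reflection that maps \<open>e\<^sub>0\<close> to the line of a unit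
  eigenvector makes the first row and column of the matrix vanish off the diagonal, and the
  induction hypothesis applies to the remaining block.
\<close>
lemma symmetric_mat_eigenbasis:
  fixes A :: "real Matrix.mat"
  assumes "A \<in> carrier_mat n n" "transpose_mat A = A"
  shows "\<exists>l u. eigenbasis n A l u"
  using assms
proof (induction n arbitrary: A)
  case 0
  show ?case by (simp add: eigenbasis_def)
next
  case (Suc n A)
  note A = Suc.prems(1) and sym = Suc.prems(2)
  let ?N = "Suc n"
  obtain a v where v: "v \<in> carrier_vec ?N" "v \<bullet> v = 1" "0 \<le> v $ 0" and Av: "A *\<^sub>v v = a \<cdot>\<^sub>v v"
    using symmetric_mat_unit_eigenvector[OF A sym zero_less_Suc] by blast
  obtain H where H: "H \<in> carrier_mat ?N ?N" "transpose_mat H = H" "H * H = 1\<^sub>m ?N"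
    and He: "H *\<^sub>v unit_vec ?N 0 = - v"
    using householder_reflection[OF v] by auto
  have HHx: "H *\<^sub>v (H *\<^sub>v x) = x" if "x \<in> carrier_vec ?N" for x
    using assoc_mult_mat_vec[OF H(1) H(1) that] H(3) that by simp
  have iso: "(H *\<^sub>v x) \<bullet> (H *\<^sub>v y) = x \<bullet> y" if "x \<in> carrier_vec ?N" "y \<in> carrier_vec ?N" for x y
    using symmetric_mat_scalar_prod[OF H(1,2) that(1), of "H *\<^sub>v y"] HHx[OF that(2)] H that
    by (metis mult_mat_vec_carrier)
  \<comment> \<open>In the reflected coordinates the eigenvector \<open>v\<close> becomes \<open>- e\<^sub>0\<close>.\<close>
  define M where "M = H * A * H"
  have M: "M \<in> carrier_mat ?N ?N" using A H by (simp add: M_def)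
  have "transpose_mat M = M"
    using A H sym unfolding M_def
    by (simp add: transpose_mult[of _ ?N ?N _ ?N] assoc_mult_mat[of _ ?N ?N _ ?N _ ?N])
  then have Msym: "M $$ (i, j) = M $$ (j, i)" if "i < ?N" "j < ?N" for i j
    using that M by (metis index_transpose_mat(1) carrier_matD)
  have Mx: "M *\<^sub>v x = H *\<^sub>v (A *\<^sub>v (H *\<^sub>v x))" if "x \<in> carrier_vec ?N" for x
    using A H that by (simp add: M_def assoc_mult_mat_vec[of _ ?N ?N _ ?N])
  have AH: "A *\<^sub>v (H *\<^sub>v x) = H *\<^sub>v (M *\<^sub>v x)" if "x \<in> carrier_vec ?N" for x
    using HHx[of "A *\<^sub>v (H *\<^sub>v x)"] A H that by (simp add: Mx)
  have Hv: "H *\<^sub>v v = - unit_vec ?N 0"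
  proof -
    have "H *\<^sub>v (- v) = unit_vec ?N 0" using HHx[of "unit_vec ?N 0"] He by simp
    moreover have "H *\<^sub>v (- v) = - (H *\<^sub>v v)"
      using H v by (auto simp: mult_mat_vec_def intro!: eq_vecI scalar_prod_uminus_right)
    ultimately show ?thesis by (metis uminus_uminus_vec)
  qed
  have Me: "M *\<^sub>v unit_vec ?N 0 = a \<cdot>\<^sub>v unit_vec ?N 0"
  proof -
    have "A *\<^sub>v (- v) = (- a) \<cdot>\<^sub>v v"
      using A v Av by (auto simp: mult_mat_vec_def vec_eq_iff)
    then have "M *\<^sub>v unit_vec ?N 0 = (- a) \<cdot>\<^sub>v (H *\<^sub>v v)"
      using H v by (simp add: Mx He mult_mat_vec)
    then show ?thesis by (auto simp: Hv)
  qed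
  have M0: "M $$ (0, Suc j) = 0" if "j < n" for j
  proof -
    have "M $$ (Suc j, 0) = (M *\<^sub>v unit_vec ?N 0) $ Suc j" using M that by simp
    also have "\<dots> = 0" using that by (simp add: Me)
    finally show ?thesis using Msym[of 0 "Suc j"] that by simp
  qed
  define A' where "A' = Matrix.mat n n (\<lambda>(i, j). M $$ (Suc i, Suc j))"
  have A': "A' \<in> carrier_mat n n" "transpose_mat A' = A'"
    using Msym by (auto simp: A'_def)
  have MC: "M *\<^sub>v vCons 0 x = vCons 0 (A' *\<^sub>v x)" if x: "x \<in> carrier_vec n" for x
  proof (rule eq_vecI)
    fix i assume "i < dim_vec (vCons 0 (A' *\<^sub>v x))"
    then have i: "i < ?N" using A' by simp
    have *: "(M *\<^sub>v vCons 0 x) $ i = (\<Sum>j<n. M $$ (i, Suc j) * x $ j)"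
    proof -
      have "(M *\<^sub>v vCons 0 x) $ i = (\<Sum>j<?N. M $$ (i, j) * vCons 0 x $ j)"
        using i M x by (simp add: scalar_prod_def lessThan_atLeast0)
      also have "\<dots> = (\<Sum>j<n. M $$ (i, Suc j) * x $ j)"
        by (simp only: sum.lessThan_Suc_shift) simp
      finally show ?thesis .
    qed
    show "(M *\<^sub>v vCons 0 x) $ i = vCons 0 (A' *\<^sub>v x) $ i"
    proof (cases i)
      case 0
      then show ?thesis using * M0 by simp
    next
      case (Suc k)
      then show ?thesis using * i x A'(1) by (simp add: A'_def scalar_prod_def lessThan_atLeast0)
    qed
  qed (use M A' in auto)
  obtain l u where lu: "eigenbasis n A' l u" using Suc.IH[OF A'] by blast
  define e where "e i = (case i of 0 \<Rightarrow> unit_vec ?N 0 | Suc i \<Rightarrow> vCons 0 (u i))" for i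
  define l' where "l' i = (case i of 0 \<Rightarrow> a | Suc i \<Rightarrow> l i)" for i
  have e: "e i \<in> carrier_vec ?N" "M *\<^sub>v e i = l' i \<cdot>\<^sub>v e i" if "i < ?N" for i
  proof -
    have "e i \<in> carrier_vec ?N \<and> M *\<^sub>v e i = l' i \<cdot>\<^sub>v e i"
    proof (cases i)
      case 0
      then show ?thesis using Me by (simp add: e_def l'_def)
    next
      case (Suc k)
      then have uk: "u k \<in> carrier_vec n" "A' *\<^sub>v u k = l k \<cdot>\<^sub>v u k"
        using lu that by (auto simp: eigenbasis_def)
      have "vCons 0 (l k \<cdot>\<^sub>v u k) = l k \<cdot>\<^sub>v vCons 0 (u k)"
        using uk by (auto simp: vec_eq_iff vec_index_vCons)
      then show ?thesis using MC[OF uk(1)] uk Suc by (simp add: e_def l'_def)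
    qed
    then show "e i \<in> carrier_vec ?N" "M *\<^sub>v e i = l' i \<cdot>\<^sub>v e i" by auto
  qed
  have unit0: "unit_vec ?N 0 = vCons 1 (0\<^sub>v n)"
    by (auto simp: vec_eq_iff vec_index_vCons)
  have orth: "e i \<bullet> e j = (if i = j then 1 else 0)" if "i < ?N" "j < ?N" for i j
    using that lu unfolding unit0 e_def eigenbasis_def by (auto split: nat.split)
  have "eigenbasis ?N A l' (\<lambda>i. H *\<^sub>v e i)"
    unfolding eigenbasis_def
  proof (intro conjI allI impI)
    fix i j assume i: "i < ?N" and j: "j < ?N"
    show "(H *\<^sub>v e i) \<bullet> (H *\<^sub>v e j) = (if i = j then 1 else 0)"
      using iso[OF e(1)[OF i] e(1)[OF j]] orth[OF i j] by simp
  next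
    fix i assume i: "i < ?N"
    show "H *\<^sub>v e i \<in> carrier_vec ?N" using H(1) e(1)[OF i] by simp
    show "A *\<^sub>v (H *\<^sub>v e i) = l' i \<cdot>\<^sub>v (H *\<^sub>v e i)"
      using AH[OF e(1)[OF i]] e(2)[OF i] mult_mat_vec[OF H(1) e(1)[OF i]] by simp
  qed
  then show ?case by blast
qed

section \<open>Powers and traces in an eigenbasis\<close>

lemma pow_mat_mult_vec_carrier [simp]:
  fixes A :: "real Matrix.mat"
  assumes "A \<in> carrier_mat n n" "x \<in> carrier_vec n"
  shows "(A ^\<^sub>m k) *\<^sub>v x \<in> carrier_vec n"
  using mult_mat_vec_carrier[OF pow_carrier_mat[OF assms(1)] assms(2)] .

lemma pow_mat_mult_vec_Suc:
  fixes A :: "real Matrix.mat"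
  assumes "A \<in> carrier_mat n n" "x \<in> carrier_vec n"
  shows "(A ^\<^sub>m Suc k) *\<^sub>v x = A *\<^sub>v ((A ^\<^sub>m k) *\<^sub>v x)"
  using assms
proof (induction k arbitrary: x)
  case (Suc k)
  have "(A ^\<^sub>m Suc (Suc k)) *\<^sub>v x = (A ^\<^sub>m Suc k) *\<^sub>v (A *\<^sub>v x)"
    unfolding pow_mat.simps(2)[of A "Suc k"]
    using Suc.prems by (intro assoc_mult_mat_vec[of _ n n _ n]) auto
  also have "\<dots> = A *\<^sub>v ((A ^\<^sub>m k) *\<^sub>v (A *\<^sub>v x))"
    using Suc by simp
  also have "(A ^\<^sub>m k) *\<^sub>v (A *\<^sub>v x) = (A ^\<^sub>m Suc k) *\<^sub>v x"
    using Suc.prems by (simp add: assoc_mult_mat_vec[of _ n n _ n])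
  finally show ?case .
qed simp

lemma symmetric_pow_mat_scalar_prod:
  fixes A :: "real Matrix.mat"
  assumes A: "A \<in> carrier_mat n n" "transpose_mat A = A" and "x \<in> carrier_vec n" "y \<in> carrier_vec n"
  shows "((A ^\<^sub>m k) *\<^sub>v x) \<bullet> y = x \<bullet> ((A ^\<^sub>m k) *\<^sub>v y)"
  using assms(3,4)
proof (induction k arbitrary: x y)
  case 0
  then show ?case using A by simp
next
  case (Suc k)
  have "((A ^\<^sub>m Suc k) *\<^sub>v x) \<bullet> y = ((A ^\<^sub>m k) *\<^sub>v (A *\<^sub>v x)) \<bullet> y"
    using A Suc.prems by (simp add: assoc_mult_mat_vec[of _ n n _ n])
  also have "\<dots> = (A *\<^sub>v x) \<bullet> ((A ^\<^sub>m k) *\<^sub>v y)" using A Suc by simp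
  also have "\<dots> = x \<bullet> (A *\<^sub>v ((A ^\<^sub>m k) *\<^sub>v y))"
    using A Suc.prems by (intro symmetric_mat_scalar_prod[of _ n]) auto
  finally show ?case using pow_mat_mult_vec_Suc[OF A(1) Suc.prems(2)] by simp
qed

lemma eigenbasis_carrier: "eigenbasis n A l u \<Longrightarrow> i < n \<Longrightarrow> u i \<in> carrier_vec n"
  by (simp add: eigenbasis_def)

lemma eigenbasis_norm: "eigenbasis n A l u \<Longrightarrow> i < n \<Longrightarrow> u i \<bullet> u i = 1"
  by (simp add: eigenbasis_def)

text \<open>
  The matrix with columns \<open>u\<^sub>i\<close> has a left inverse, namely its transpose, which is then also a
  right inverse.
\<close>
lemma eigenbasis_complete:
  assumes "eigenbasis n A l u" "a < n" "b < n"
  shows "(\<Sum>i<n. u i $ a * u i $ b) = (if a = b then 1 else 0)"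
proof -
  define U where "U = Matrix.mat n n (\<lambda>(a, i). u i $ a)"
  have U: "U \<in> carrier_mat n n" by (simp add: U_def)
  have "transpose_mat U * U = 1\<^sub>m n"
  proof (rule eq_matI)
    fix i j assume "i < dim_row (1\<^sub>m n :: real Matrix.mat)" "j < dim_col (1\<^sub>m n :: real Matrix.mat)"
    then have ij: "i < n" "j < n" by auto
    then have "dim_vec (u j) = n" using assms(1) by (auto simp: eigenbasis_def)
    then have "(transpose_mat U * U) $$ (i, j) = u i \<bullet> u j"
      using ij by (simp add: U_def scalar_prod_def)
    then show "(transpose_mat U * U) $$ (i, j) = 1\<^sub>m n $$ (i, j)"
      using ij assms(1) by (simp add: eigenbasis_def)
  qed (use U in auto)
  then have "U * transpose_mat U = 1\<^sub>m n"
    using mat_mult_left_right_inverse[of "transpose_mat U" n U] U by simp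
  then have "(U * transpose_mat U) $$ (a, b) = (if a = b then 1 else 0)"
    using assms by simp
  then show ?thesis using assms U by (simp add: U_def scalar_prod_def lessThan_atLeast0)
qed

lemma scalar_prod_lessThan: "y \<in> carrier_vec n \<Longrightarrow> x \<bullet> y = (\<Sum>i<n. x $ i * y $ i)"
  by (simp add: scalar_prod_def lessThan_atLeast0)

lemma eigenbasis_parseval:
  assumes "eigenbasis n A l u" "x \<in> carrier_vec n" "y \<in> carrier_vec n"
  shows "x \<bullet> y = (\<Sum>i<n. (u i \<bullet> x) * (u i \<bullet> y))"
proof -
  have "(\<Sum>i<n. (u i \<bullet> x) * (u i \<bullet> y)) = (\<Sum>i<n. \<Sum>a<n. \<Sum>b<n. x $ a * y $ b * (u i $ a * u i $ b))"
    using assms by (simp add: scalar_prod_lessThan[of _ n] sum_product algebra_simps)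
  also have "\<dots> = (\<Sum>a<n. \<Sum>i<n. \<Sum>b<n. x $ a * y $ b * (u i $ a * u i $ b))"
    by (rule sum.swap)
  also have "\<dots> = (\<Sum>a<n. \<Sum>b<n. \<Sum>i<n. x $ a * y $ b * (u i $ a * u i $ b))"
    by (intro sum.cong refl sum.swap)
  also have "\<dots> = (\<Sum>a<n. \<Sum>b<n. x $ a * y $ b * (if a = b then 1 else 0))"
    by (intro sum.cong refl, simp only: sum_distrib_left[symmetric],
      subst eigenbasis_complete[OF assms(1)], auto)
  also have "\<dots> = x \<bullet> y"
    using assms by (simp add: scalar_prod_lessThan[of _ n] if_distrib cong: if_cong)
  finally show ?thesis by simp
qed

lemma eigenbasis_pow:
  assumes "eigenbasis n A l u" "A \<in> carrier_mat n n" "i < n"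
  shows "(A ^\<^sub>m k) *\<^sub>v u i = l i ^ k \<cdot>\<^sub>v u i"
proof (induction k)
  case 0
  then show ?case using assms by (simp add: eigenbasis_def)
next
  case (Suc k)
  have ui: "u i \<in> carrier_vec n" "A *\<^sub>v u i = l i \<cdot>\<^sub>v u i" using assms by (auto simp: eigenbasis_def)
  show ?case unfolding pow_mat_mult_vec_Suc[OF assms(2) ui(1)] Suc
    using assms(2) ui by (simp add: mult_mat_vec[of _ n n] smult_smult_assoc mult.commute)
qed

lemma eigenbasis_pow_form:
  assumes eb: "eigenbasis n A l u" and A: "A \<in> carrier_mat n n" "transpose_mat A = A"
    and xy: "x \<in> carrier_vec n" "y \<in> carrier_vec n"
  shows "x \<bullet> ((A ^\<^sub>m k) *\<^sub>v y) = (\<Sum>i<n. l i ^ k * ((u i \<bullet> x) * (u i \<bullet> y)))"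
proof -
  have "u i \<bullet> ((A ^\<^sub>m k) *\<^sub>v y) = l i ^ k * (u i \<bullet> y)" if "i < n" for i
    using symmetric_pow_mat_scalar_prod[OF A eigenbasis_carrier[OF eb that] xy(2), of k]
      eigenbasis_pow[OF eb A(1) that] eigenbasis_carrier[OF eb that] xy by simp
  moreover have "x \<bullet> ((A ^\<^sub>m k) *\<^sub>v y) = (\<Sum>i<n. (u i \<bullet> x) * (u i \<bullet> ((A ^\<^sub>m k) *\<^sub>v y)))"
    using A xy by (intro eigenbasis_parseval[OF eb]) auto
  ultimately show ?thesis by (simp add: algebra_simps)
qed

lemma eigenbasis_form:
  assumes eb: "eigenbasis n A l u" and A: "A \<in> carrier_mat n n" "transpose_mat A = A"
    and xy: "x \<in> carrier_vec n" "y \<in> carrier_vec n"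
  shows "x \<bullet> (A *\<^sub>v y) = (\<Sum>i<n. l i * ((u i \<bullet> x) * (u i \<bullet> y)))"
  using eigenbasis_pow_form[OF assms, of 1] A by simp

definition mat_trace :: "real Matrix.mat \<Rightarrow> real" where
  "mat_trace M = (\<Sum>i<dim_row M. M $$ (i, i))"

lemma mat_trace_eigenbasis:
  assumes "eigenbasis n A l u" "M \<in> carrier_mat n n"
  shows "mat_trace M = (\<Sum>p<n. u p \<bullet> (M *\<^sub>v u p))"
proof -
  have "(\<Sum>p<n. u p \<bullet> (M *\<^sub>v u p)) = (\<Sum>p<n. \<Sum>a<n. \<Sum>b<n. M $$ (a, b) * (u p $ a * u p $ b))"
  proof (intro sum.cong refl)
    fix p assume "p \<in> {..<n}"
    then have "u p \<in> carrier_vec n" using assms(1) by (simp add: eigenbasis_def)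
    moreover from this have "M *\<^sub>v u p \<in> carrier_vec n" using assms(2) by simp
    ultimately show "u p \<bullet> (M *\<^sub>v u p) = (\<Sum>a<n. \<Sum>b<n. M $$ (a, b) * (u p $ a * u p $ b))"
      using assms(2) by (simp add: scalar_prod_lessThan[of _ n] sum_distrib_left algebra_simps)
  qed
  also have "\<dots> = (\<Sum>a<n. \<Sum>p<n. \<Sum>b<n. M $$ (a, b) * (u p $ a * u p $ b))"
    by (rule sum.swap)
  also have "\<dots> = (\<Sum>a<n. \<Sum>b<n. \<Sum>p<n. M $$ (a, b) * (u p $ a * u p $ b))"
    by (intro sum.cong refl sum.swap)
  also have "\<dots> = (\<Sum>a<n. \<Sum>b<n. M $$ (a, b) * (if a = b then 1 else 0))"
    by (intro sum.cong refl, simp only: sum_distrib_left[symmetric],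
      subst eigenbasis_complete[OF assms(1)], auto)
  also have "\<dots> = mat_trace M"
    using assms by (simp add: mat_trace_def if_distrib cong: if_cong)
  finally show ?thesis by simp
qed

text \<open>
  The weights \<open>(w\<^sub>q \<bullet> u\<^sub>p)\<^sup>2\<close> do not depend on the exponents. Inequalities between traces of
  products of powers of two matrices that need not commute thereby reduce to inequalities between
  numbers.
\<close>
lemma mat_trace_pow_mult_pow:
  assumes A: "A \<in> carrier_mat n n" "transpose_mat A = A" and B: "B \<in> carrier_mat n n" "transpose_mat B = B"
    and eA: "eigenbasis n A l u" and eB: "eigenbasis n B m w"
  shows "mat_trace ((A ^\<^sub>m i) * (B ^\<^sub>m j)) = (\<Sum>p<n. \<Sum>q<n. l p ^ i * m q ^ j * (w q \<bullet> u p)\<^sup>2)"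
proof -
  have AB: "(A ^\<^sub>m i) * (B ^\<^sub>m j) \<in> carrier_mat n n"
    using A B by (intro mult_carrier_mat[of _ n n]) simp_all
  have "u p \<bullet> (((A ^\<^sub>m i) * (B ^\<^sub>m j)) *\<^sub>v u p) = (\<Sum>q<n. l p ^ i * m q ^ j * (w q \<bullet> u p)\<^sup>2)"
    if "p < n" for p
  proof -
    have up: "u p \<in> carrier_vec n" using eA that by (rule eigenbasis_carrier)
    have "u p \<bullet> (((A ^\<^sub>m i) * (B ^\<^sub>m j)) *\<^sub>v u p) = ((A ^\<^sub>m i) *\<^sub>v u p) \<bullet> ((B ^\<^sub>m j) *\<^sub>v u p)"
      using symmetric_pow_mat_scalar_prod[OF A up, of "(B ^\<^sub>m j) *\<^sub>v u p" i] A B up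
      by (simp add: assoc_mult_mat_vec[of _ n n _ n])
    also have "\<dots> = l p ^ i * (u p \<bullet> ((B ^\<^sub>m j) *\<^sub>v u p))"
      using up B by (simp add: eigenbasis_pow[OF eA A(1) that])
    also have "\<dots> = l p ^ i * (\<Sum>q<n. m q ^ j * ((w q \<bullet> u p) * (w q \<bullet> u p)))"
      by (simp add: eigenbasis_pow_form[OF eB B up up])
    finally show ?thesis by (simp add: sum_distrib_left power2_eq_square algebra_simps)
  qed
  then show ?thesis unfolding mat_trace_eigenbasis[OF eA AB] by simp
qed

lemma mat_trace_pow:
  assumes A: "A \<in> carrier_mat n n" and eA: "eigenbasis n A l u"
  shows "mat_trace (A ^\<^sub>m k) = (\<Sum>p<n. l p ^ k)"
proof -
  have "u p \<bullet> ((A ^\<^sub>m k) *\<^sub>v u p) = l p ^ k" if "p < n" for p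
    using eigenbasis_pow[OF eA A that] eigenbasis_norm[OF eA that] by simp
  then show ?thesis
    unfolding mat_trace_eigenbasis[OF eA pow_carrier_mat[OF A]] by simp
qed

section \<open>Moments of a vector with respect to a matrix\<close>

definition bounded_below :: "nat \<Rightarrow> real \<Rightarrow> real Matrix.mat \<Rightarrow> bool" where
  "bounded_below n \<kappa> K \<longleftrightarrow> K \<in> carrier_mat n n \<and> transpose_mat K = K \<and>
     (\<forall>x\<in>carrier_vec n. \<kappa> * (x \<bullet> x) \<le> x \<bullet> (K *\<^sub>v x))"

lemma bounded_below_eigenvalue:
  assumes "bounded_below n \<kappa> K" "eigenbasis n K l u" "i < n"
  shows "\<kappa> \<le> l i"
proof -
  have "\<kappa> * (u i \<bullet> u i) \<le> u i \<bullet> (K *\<^sub>v u i)" 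
    using assms(1) eigenbasis_carrier[OF assms(2,3)] unfolding bounded_below_def by blast
  then show ?thesis
    using eigenbasis_norm[OF assms(2,3)] eigenbasis_carrier[OF assms(2,3)] assms(2,3)
    by (simp add: eigenbasis_def)
qed

lemma bounded_below_mono: "bounded_below n \<kappa> K \<Longrightarrow> \<kappa>' \<le> \<kappa> \<Longrightarrow> bounded_below n \<kappa>' K"
  unfolding bounded_below_def by (meson mult_right_mono order_trans scalar_prod_self_nonneg)

text \<open>
  The difference of the two sides is half of the sum of \<open>c\<^sub>i c\<^sub>j (f\<^sub>i - f\<^sub>j) (g\<^sub>i - g\<^sub>j)\<close>.
\<close>
lemma chebyshev_weighted_sum:
  fixes f g c :: "'a \<Rightarrow> real"
  assumes "\<And>i. i \<in> I \<Longrightarrow> 0 \<le> c i"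
    and "\<And>i j. i \<in> I \<Longrightarrow> j \<in> I \<Longrightarrow> 0 \<le> (f i - f j) * (g i - g j)"
  shows "(\<Sum>i\<in>I. f i * c i) * (\<Sum>i\<in>I. g i * c i) \<le> (\<Sum>i\<in>I. c i) * (\<Sum>i\<in>I. f i * g i * c i)"
proof -
  have "0 \<le> (\<Sum>i\<in>I. \<Sum>j\<in>I. c i * c j * ((f i - f j) * (g i - g j)))"
    using assms by (intro sum_nonneg) simp
  also have "\<dots> = (\<Sum>i\<in>I. \<Sum>j\<in>I. (f i * g i * c i) * c j) + (\<Sum>i\<in>I. \<Sum>j\<in>I. c i * (f j * g j * c j))
      - (\<Sum>i\<in>I. \<Sum>j\<in>I. (f i * c i) * (g j * c j)) - (\<Sum>i\<in>I. \<Sum>j\<in>I. (g i * c i) * (f j * c j))"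
    unfolding sum.distrib[symmetric] sum_subtractf[symmetric]
    by (intro sum.cong refl) (simp add: algebra_simps)
  finally show ?thesis
    unfolding sum_product[symmetric] by (simp add: mult.commute)
qed

text \<open>
  The numbers \<open>v \<bullet> K\<^sup>i v\<close> are the moments of a measure on the nonnegative spectrum of \<open>K\<close> with
  total mass \<open>v \<bullet> v\<close>, and the functions \<open>x\<^sup>i\<close> and \<open>x\<^sup>j\<close> increase together there.
\<close>
lemma moment_product_le:
  assumes K: "bounded_below n 0 K" and v: "v \<in> carrier_vec n"
  shows "(v \<bullet> ((K ^\<^sub>m i) *\<^sub>v v)) * (v \<bullet> ((K ^\<^sub>m j) *\<^sub>v v)) \<le> (v \<bullet> v) * (v \<bullet> ((K ^\<^sub>m (i + j)) *\<^sub>v v))"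
proof -
  have Kc: "K \<in> carrier_mat n n" "transpose_mat K = K" using K by (auto simp: bounded_below_def)
  obtain l u where eb: "eigenbasis n K l u" using symmetric_mat_eigenbasis[OF Kc] by blast
  define c where "c i = (u i \<bullet> v) * (u i \<bullet> v)" for i
  have form: "v \<bullet> ((K ^\<^sub>m k) *\<^sub>v v) = (\<Sum>i<n. l i ^ k * c i)" for k
    using eigenbasis_pow_form[OF eb Kc v v, of k] by (simp add: c_def)
  have vv: "v \<bullet> v = (\<Sum>i<n. c i)"
    using eigenbasis_parseval[OF eb v v] by (simp add: c_def)
  have l: "0 \<le> l p" if "p < n" for p using bounded_below_eigenvalue[OF K eb that] .
  have "0 \<le> (l p ^ i - l q ^ i) * (l p ^ j - l q ^ j)" if "p < n" "q < n" for p q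
  proof (cases "l p \<le> l q")
    case True
    then show ?thesis using l that by (intro mult_nonpos_nonpos) (auto intro: power_mono)
  next
    case False
    then show ?thesis using l that by (intro mult_nonneg_nonneg) (auto intro: power_mono)
  qed
  then have "(\<Sum>p<n. l p ^ i * c p) * (\<Sum>p<n. l p ^ j * c p) \<le> (\<Sum>p<n. c p) * (\<Sum>p<n. l p ^ i * l p ^ j * c p)"
    by (intro chebyshev_weighted_sum) (auto simp: c_def)
  then show ?thesis unfolding form vv by (simp add: power_add)
qed

lemma moment_nonneg:
  assumes K: "bounded_below n 0 K" and v: "v \<in> carrier_vec n"
  shows "0 \<le> v \<bullet> ((K ^\<^sub>m k) *\<^sub>v v)"
proof -
  have Kc: "K \<in> carrier_mat n n" "transpose_mat K = K" using K by (auto simp: bounded_below_def)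
  obtain l u where eb: "eigenbasis n K l u" using symmetric_mat_eigenbasis[OF Kc] by blast
  show ?thesis unfolding eigenbasis_pow_form[OF eb Kc v v]
    using bounded_below_eigenvalue[OF K eb] by (intro sum_nonneg) auto
qed

lemma moment_Suc_ge:
  assumes K: "bounded_below n \<kappa> K" and "0 \<le> \<kappa>" and v: "v \<in> carrier_vec n"
  shows "\<kappa> * (v \<bullet> ((K ^\<^sub>m k) *\<^sub>v v)) \<le> v \<bullet> ((K ^\<^sub>m Suc k) *\<^sub>v v)"
proof -
  have Kc: "K \<in> carrier_mat n n" "transpose_mat K = K" using K by (auto simp: bounded_below_def)
  obtain l u where eb: "eigenbasis n K l u" using symmetric_mat_eigenbasis[OF Kc] by blast
  have "\<kappa> * (l i ^ k * ((u i \<bullet> v) * (u i \<bullet> v))) \<le> l i ^ Suc k * ((u i \<bullet> v) * (u i \<bullet> v))" if "i < n" for i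
  proof -
    have "\<kappa> \<le> l i" using bounded_below_eigenvalue[OF K eb that] .
    then have "\<kappa> * (l i ^ k * ((u i \<bullet> v) * (u i \<bullet> v))) \<le> l i * (l i ^ k * ((u i \<bullet> v) * (u i \<bullet> v)))"
      using \<open>0 \<le> \<kappa>\<close> by (intro mult_right_mono) auto
    then show ?thesis by (simp add: mult.assoc)
  qed
  then show ?thesis unfolding eigenbasis_pow_form[OF eb Kc v v] sum_distrib_left
    by (intro sum_mono) auto
qed

section \<open>Rank-one updates\<close>

definition rank_one :: "real Matrix.vec \<Rightarrow> real Matrix.mat" where
  "rank_one v = Matrix.mat (dim_vec v) (dim_vec v) (\<lambda>(i, j). v $ i * v $ j)"

lemma rank_one_carrier [simp]: "v \<in> carrier_vec n \<Longrightarrow> rank_one v \<in> carrier_mat n n"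
  by (simp add: rank_one_def)

lemma rank_one_dim [simp]: "dim_row (rank_one v) = dim_vec v" "dim_col (rank_one v) = dim_vec v"
  by (simp_all add: rank_one_def)

lemma rank_one_mult_vec:
  "v \<in> carrier_vec n \<Longrightarrow> x \<in> carrier_vec n \<Longrightarrow> rank_one v *\<^sub>v x = (v \<bullet> x) \<cdot>\<^sub>v v"
  by (auto simp: rank_one_def scalar_prod_lessThan[of _ n] sum_distrib_left vec_eq_iff algebra_simps
      lessThan_atLeast0 scalar_prod_def)

lemma smult_mat_mult_vec:
  fixes A :: "real Matrix.mat"
  assumes "A \<in> carrier_mat n m" "x \<in> carrier_vec m"
  shows "(a \<cdot>\<^sub>m A) *\<^sub>v x = a \<cdot>\<^sub>v (A *\<^sub>v x)"
  using assms by (auto simp: vec_eq_iff)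

lemma rank_one_update_mult_vec:
  assumes "A \<in> carrier_mat n n" "v \<in> carrier_vec n" "x \<in> carrier_vec n"
  shows "(A + \<eta> \<cdot>\<^sub>m rank_one v) *\<^sub>v x = A *\<^sub>v x + (\<eta> * (v \<bullet> x)) \<cdot>\<^sub>v v"
  using assms by (simp add: add_mult_distrib_mat_vec[of _ n n] smult_mat_mult_vec[of _ n n]
      rank_one_mult_vec smult_smult_assoc)

text \<open>
  Telescoping from \<open>A\<^sup>m\<close> to \<open>B\<^sup>m\<close>: every term in which a factor \<open>A\<close> is exchanged for \<open>B\<close> splits at
  the rank-one matrix \<open>v v\<^sup>T\<close> into a product of two numbers.
\<close>
lemma rank_one_update_pow:
  assumes A: "A \<in> carrier_mat n n" "transpose_mat A = A" and v: "v \<in> carrier_vec n"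
    and B: "B = A + \<eta> \<cdot>\<^sub>m rank_one v" and x: "x \<in> carrier_vec n"
  shows "x \<bullet> ((B ^\<^sub>m m) *\<^sub>v v) = x \<bullet> ((A ^\<^sub>m m) *\<^sub>v v)
    + \<eta> * (\<Sum>j<m. (x \<bullet> ((A ^\<^sub>m (m - 1 - j)) *\<^sub>v v)) * (v \<bullet> ((B ^\<^sub>m j) *\<^sub>v v)))"
  using x
proof (induction m arbitrary: x)
  case 0
  then show ?case using A B v by simp
next
  case (Suc m)
  have Bc: "B \<in> carrier_mat n n" using A B v by simp
  define y where "y = (B ^\<^sub>m m) *\<^sub>v v"
  have y: "y \<in> carrier_vec n" using Bc v by (simp add: y_def)
  have Ax: "A *\<^sub>v x \<in> carrier_vec n" using A Suc.prems by simp
  have shift: "(A *\<^sub>v x) \<bullet> ((A ^\<^sub>m k) *\<^sub>v v) = x \<bullet> ((A ^\<^sub>m Suc k) *\<^sub>v v)" for k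
    using symmetric_mat_scalar_prod[OF A Suc.prems, of "(A ^\<^sub>m k) *\<^sub>v v"] pow_mat_mult_vec_Suc[OF A(1) v]
      A v by simp
  have "x \<bullet> ((B ^\<^sub>m Suc m) *\<^sub>v v) = x \<bullet> (A *\<^sub>v y + (\<eta> * (v \<bullet> y)) \<cdot>\<^sub>v v)"
    unfolding pow_mat_mult_vec_Suc[OF Bc v] y_def[symmetric]
    using rank_one_update_mult_vec[OF A(1) v y, of \<eta>] B by simp
  also have "\<dots> = (A *\<^sub>v x) \<bullet> y + \<eta> * ((x \<bullet> v) * (v \<bullet> y))"
    using A v y Suc.prems symmetric_mat_scalar_prod[OF A Suc.prems y]
    by (simp add: scalar_prod_add_distrib[of _ n])
  also have "(A *\<^sub>v x) \<bullet> y = x \<bullet> ((A ^\<^sub>m Suc m) *\<^sub>v v)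
    + \<eta> * (\<Sum>j<m. (x \<bullet> ((A ^\<^sub>m Suc (m - 1 - j)) *\<^sub>v v)) * (v \<bullet> ((B ^\<^sub>m j) *\<^sub>v v)))"
    unfolding y_def Suc.IH[OF Ax] shift ..
  also have "(\<Sum>j<m. (x \<bullet> ((A ^\<^sub>m Suc (m - 1 - j)) *\<^sub>v v)) * (v \<bullet> ((B ^\<^sub>m j) *\<^sub>v v)))
    = (\<Sum>j<m. (x \<bullet> ((A ^\<^sub>m (Suc m - 1 - j)) *\<^sub>v v)) * (v \<bullet> ((B ^\<^sub>m j) *\<^sub>v v)))"
  proof (intro sum.cong refl)
    fix j assume "j \<in> {..<m}"
    then have "Suc (m - 1 - j) = Suc m - 1 - j" by auto
    then show "(x \<bullet> ((A ^\<^sub>m Suc (m - 1 - j)) *\<^sub>v v)) * (v \<bullet> ((B ^\<^sub>m j) *\<^sub>v v))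
      = (x \<bullet> ((A ^\<^sub>m (Suc m - 1 - j)) *\<^sub>v v)) * (v \<bullet> ((B ^\<^sub>m j) *\<^sub>v v))" by (simp only:)
  qed
  finally have "x \<bullet> ((B ^\<^sub>m Suc m) *\<^sub>v v) = x \<bullet> ((A ^\<^sub>m Suc m) *\<^sub>v v)
    + \<eta> * (\<Sum>j<m. (x \<bullet> ((A ^\<^sub>m (Suc m - 1 - j)) *\<^sub>v v)) * (v \<bullet> ((B ^\<^sub>m j) *\<^sub>v v)))
    + \<eta> * ((x \<bullet> v) * (v \<bullet> y))" .
  moreover have "(x \<bullet> ((A ^\<^sub>m (Suc m - 1 - m)) *\<^sub>v v)) = x \<bullet> v" using A v by simp
  ultimately show ?case unfolding sum.lessThan_Suc distrib_left y_def by (simp only: add.assoc)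
qed

text \<open>
  With \<open>a\<^sub>k = v \<bullet> A\<^sup>k v\<close> and \<open>b\<^sub>k = v \<bullet> B\<^sup>k v\<close>, the expansion above reads
  \<open>b\<^sub>m = a\<^sub>m + \<eta> \<Sum>\<^sub>j\<^sub><\<^sub>m a\<^sub>m\<^sub>-\<^sub>1\<^sub>-\<^sub>j b\<^sub>j\<close>. The induction hypothesis bounds \<open>b\<^sub>j\<close> by \<open>g\<^sup>j a\<^sub>j\<close>, the
  product inequality for moments bounds \<open>a\<^sub>m\<^sub>-\<^sub>1\<^sub>-\<^sub>j a\<^sub>j\<close> by \<open>\<rho> a\<^sub>m\<^sub>-\<^sub>1\<close>, and a geometric sum
  remains. It is tuned so that \<open>\<kappa> a\<^sub>m\<^sub>-\<^sub>1 \<le> a\<^sub>m\<close> closes the induction. This is a discrete form of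
  the bound \<open>v\<^sup>T exp (H + t v v\<^sup>T) v \<le> exp (t |v|\<^sup>2) v\<^sup>T exp H v\<close>.
\<close>
lemma rank_one_update_moment_le:
  assumes A: "bounded_below n \<kappa> A" and v: "v \<in> carrier_vec n" "v \<bullet> v \<le> \<rho>"
    and \<eta>: "0 \<le> \<eta>" and \<kappa>: "0 < \<kappa>" and B: "B = A + \<eta> \<cdot>\<^sub>m rank_one v"
  shows "v \<bullet> ((B ^\<^sub>m m) *\<^sub>v v) \<le> (1 + \<eta> * \<rho> / \<kappa>) ^ m * (v \<bullet> ((A ^\<^sub>m m) *\<^sub>v v))"
proof (induction m rule: less_induct)
  case (less m)
  define a where "a k = v \<bullet> ((A ^\<^sub>m k) *\<^sub>v v)" for k
  define b where "b k = v \<bullet> ((B ^\<^sub>m k) *\<^sub>v v)" for k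
  define g where "g = 1 + \<eta> * \<rho> / \<kappa>"
  have Ac: "A \<in> carrier_mat n n" "transpose_mat A = A" using A by (auto simp: bounded_below_def)
  have A0: "bounded_below n 0 A" using bounded_below_mono[OF A] \<kappa> by simp
  have \<rho>: "0 \<le> \<rho>" using v scalar_prod_self_nonneg[of v] by linarith
  have g: "1 \<le> g" using \<rho> \<eta> \<kappa> by (simp add: g_def)
  have IH: "b j \<le> g ^ j * a j" if "j < m" for j using less that by (simp add: a_def b_def g_def)
  have a0: "0 \<le> a k" for k unfolding a_def using moment_nonneg[OF A0 v(1)] .
  show ?case
  proof (cases m)
    case 0
    then show ?thesis using Ac B v by simp
  next
    case (Suc r)
    have "b m = a m + \<eta> * (\<Sum>j<m. a (m - 1 - j) * b j)"
      unfolding a_def b_def by (rule rank_one_update_pow[OF Ac v(1) B v(1)])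
    also have "\<dots> \<le> a m + \<eta> * (\<Sum>j<m. g ^ j * (\<rho> * a r))"
    proof (intro add_left_mono mult_left_mono[OF _ \<eta>] sum_mono)
      fix j assume "j \<in> {..<m}"
      then have j: "j < m" "m - 1 - j + j = r" using Suc by auto
      have "a (m - 1 - j) * b j \<le> a (m - 1 - j) * (g ^ j * a j)"
        using IH[OF j(1)] a0 by (intro mult_left_mono) auto
      also have "\<dots> = g ^ j * (a (m - 1 - j) * a j)" by simp
      also have "\<dots> \<le> g ^ j * ((v \<bullet> v) * a r)"
        using moment_product_le[OF A0 v(1), of "m - 1 - j" j] g j(2)
        by (intro mult_left_mono) (auto simp: a_def)
      also have "\<dots> \<le> g ^ j * (\<rho> * a r)"
        using v(2) g a0 by (intro mult_left_mono mult_right_mono) auto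
      finally show "a (m - 1 - j) * b j \<le> g ^ j * (\<rho> * a r)" .
    qed
    also have "\<eta> * (\<Sum>j<m. g ^ j * (\<rho> * a r)) = (\<kappa> * a r) * ((g - 1) * (\<Sum>j<m. g ^ j))"
    proof -
      have "\<kappa> * (g - 1) = \<eta> * \<rho>" using \<kappa> by (simp add: g_def)
      then have "(\<kappa> * a r) * ((g - 1) * (\<Sum>j<m. g ^ j)) = \<eta> * \<rho> * a r * (\<Sum>j<m. g ^ j)"
        by (metis mult.assoc mult.commute)
      moreover have "(\<Sum>j<m. g ^ j * (\<rho> * a r)) = (\<Sum>j<m. g ^ j) * (\<rho> * a r)"
        by (rule sum_distrib_right[symmetric])
      ultimately show ?thesis by (simp only: mult_ac)
    qed
    also have "(g - 1) * (\<Sum>j<m. g ^ j) = g ^ m - 1" by (simp add: power_diff_1_eq)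
    also have "(\<kappa> * a r) * (g ^ m - 1) \<le> a m * (g ^ m - 1)"
      using moment_Suc_ge[OF A _ v(1), of r] \<kappa> one_le_power[OF g, of m] unfolding Suc a_def
      by (intro mult_right_mono) auto
    finally have "b m \<le> g ^ m * a m" by (simp add: algebra_simps)
    then show ?thesis by (simp add: a_def b_def g_def)
  qed
qed

section \<open>Convexity of the trace of a power\<close>

text \<open>
  The graph of \<open>y \<mapsto> y\<^sup>m\<^sup>+\<^sup>1\<close> lies above its tangent at \<open>x\<close> over the nonnegative reals; the
  induction avoids derivatives.
\<close>
lemma power_tangent_le:
  fixes x y :: real
  assumes "0 \<le> x" "0 \<le> y"
  shows "x ^ Suc m - y ^ Suc m \<le> real (Suc m) * (x ^ Suc m - y * x ^ m)"
proof (induction m)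
  case (Suc m)
  have "y * (x ^ Suc m - y ^ Suc m) \<le> y * (real (Suc m) * (x ^ Suc m - y * x ^ m))"
    using Suc assms by (intro mult_left_mono) auto
  moreover have "0 \<le> real (Suc m) * x ^ m * (x - y)\<^sup>2" using assms by simp
  ultimately show ?case by (simp add: algebra_simps power2_eq_square)
qed simp

lemma mat_trace_rank_one_mult:
  assumes "v \<in> carrier_vec n" "M \<in> carrier_mat n n"
  shows "mat_trace (rank_one v * M) = v \<bullet> (M *\<^sub>v v)"
proof -
  have Mv: "M *\<^sub>v v \<in> carrier_vec n" using assms by simp
  have "mat_trace (rank_one v * M) = (\<Sum>i<n. \<Sum>j<n. v $ i * v $ j * M $$ (j, i))"
    using assms by (simp add: mat_trace_def rank_one_def scalar_prod_def lessThan_atLeast0)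
  also have "\<dots> = (\<Sum>j<n. \<Sum>i<n. v $ i * v $ j * M $$ (j, i))" by (rule sum.swap)
  also have "\<dots> = v \<bullet> (M *\<^sub>v v)"
    using assms unfolding scalar_prod_lessThan[OF Mv]
    by (simp add: scalar_prod_lessThan[of _ n] sum_distrib_left algebra_simps)
  finally show ?thesis .
qed

lemma mat_trace_add_smult:
  assumes "M \<in> carrier_mat n n" "N \<in> carrier_mat n n"
  shows "mat_trace (M + a \<cdot>\<^sub>m N) = mat_trace M + a * mat_trace N"
  using assms by (simp add: mat_trace_def sum.distrib sum_distrib_left)

text \<open>
  Klein's inequality for the convex function \<open>x\<^sup>m\<^sup>+\<^sup>1\<close>. Expanding the traces in an eigenbasis of
  \<open>A\<close> and one of \<open>B\<close> turns it into a weighted sum of tangent inequalities for pairs of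
  eigenvalues. The sign of \<open>\<eta>\<close> is arbitrary, so exchanging the roles of \<open>A\<close> and \<open>B\<close> yields the
  companion lower bound.
\<close>
lemma klein_rank_one:
  assumes A: "bounded_below n 0 A" and B: "bounded_below n 0 B" and v: "v \<in> carrier_vec n"
    and BA: "B = A + \<eta> \<cdot>\<^sub>m rank_one v"
  shows "mat_trace (B ^\<^sub>m Suc m) - mat_trace (A ^\<^sub>m Suc m) \<le> real (Suc m) * (\<eta> * (v \<bullet> ((B ^\<^sub>m m) *\<^sub>v v)))"
proof -
  have Ac: "A \<in> carrier_mat n n" "transpose_mat A = A" and Bc: "B \<in> carrier_mat n n" "transpose_mat B = B"
    using A B by (auto simp: bounded_below_def)
  obtain l u where eA: "eigenbasis n A l u" using symmetric_mat_eigenbasis[OF Ac] by blast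
  obtain k w where eB: "eigenbasis n B k w" using symmetric_mat_eigenbasis[OF Bc] by blast
  note tr = mat_trace_pow_mult_pow[OF Ac Bc eA eB]
  have l: "0 \<le> l p" "0 \<le> k p" if "p < n" for p
    using bounded_below_eigenvalue[OF A eA that] bounded_below_eigenvalue[OF B eB that] by auto
  have trB: "mat_trace (B ^\<^sub>m Suc m) = (\<Sum>p<n. \<Sum>q<n. k q ^ Suc m * (w q \<bullet> u p)\<^sup>2)"
    using tr[of 0 "Suc m"] Ac Bc by (simp del: pow_mat.simps(2) add: pow_mat.simps(1))
  have trA: "mat_trace (A ^\<^sub>m Suc m) = (\<Sum>p<n. \<Sum>q<n. l p ^ Suc m * (w q \<bullet> u p)\<^sup>2)"
    using tr[of "Suc m" 0] Ac Bc by (simp del: pow_mat.simps(2) add: pow_mat.simps(1))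
  have A1: "A ^\<^sub>m 1 = A" using Ac by simp
  have trAB: "mat_trace (A * (B ^\<^sub>m m)) = (\<Sum>p<n. \<Sum>q<n. l p * k q ^ m * (w q \<bullet> u p)\<^sup>2)"
    using tr[of 1 m] A1 by simp
  have "mat_trace (B ^\<^sub>m Suc m) - mat_trace (A ^\<^sub>m Suc m)
      = (\<Sum>p<n. \<Sum>q<n. (k q ^ Suc m - l p ^ Suc m) * (w q \<bullet> u p)\<^sup>2)"
    unfolding trA trB by (simp only: sum_subtractf left_diff_distrib)
  also have "\<dots> \<le> (\<Sum>p<n. \<Sum>q<n. (real (Suc m) * (k q ^ Suc m - l p * k q ^ m)) * (w q \<bullet> u p)\<^sup>2)"
    by (intro sum_mono mult_right_mono power_tangent_le) (auto intro: l)
  also have "\<dots> = real (Suc m) * (mat_trace (B ^\<^sub>m Suc m) - mat_trace (A * (B ^\<^sub>m m)))"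
    unfolding trB trAB sum_subtractf[symmetric] sum_distrib_left
    by (intro sum.cong refl) (simp only: left_diff_distrib mult.assoc)
  also have "mat_trace (B ^\<^sub>m Suc m) - mat_trace (A * (B ^\<^sub>m m)) = \<eta> * (v \<bullet> ((B ^\<^sub>m m) *\<^sub>v v))"
  proof -
    have Bm: "B ^\<^sub>m m \<in> carrier_mat n n" using Bc by simp
    have BB: "B ^\<^sub>m Suc m = B * (B ^\<^sub>m m)"
    proof (induction m)
      case (Suc m)
      have "B ^\<^sub>m Suc (Suc m) = (B * (B ^\<^sub>m m)) * B" using Suc by simp
      also have "\<dots> = B * (B ^\<^sub>m Suc m)" using Bc by (simp add: assoc_mult_mat[of _ n n _ n _ n])
      finally show ?case .
    qed (use Bc in simp)
    have "B * (B ^\<^sub>m m) = A * (B ^\<^sub>m m) + \<eta> \<cdot>\<^sub>m (rank_one v * (B ^\<^sub>m m))"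
      using Ac v Bm by (subst (1) BA)
        (simp add: add_mult_distrib_mat[of _ n n] mult_smult_assoc_mat[of _ n n _ n])
    then have "mat_trace (B ^\<^sub>m Suc m) = mat_trace (A * (B ^\<^sub>m m)) + \<eta> * mat_trace (rank_one v * (B ^\<^sub>m m))"
      unfolding BB using Ac v Bm
      by (simp only: mat_trace_add_smult[of _ n] mult_carrier_mat[of _ n n _ n] rank_one_carrier)
    then show ?thesis using mat_trace_rank_one_mult[OF v Bm] by simp
  qed
  finally show ?thesis .
qed

section \<open>Replacing independent Bernoulli variables by constants\<close>

lemma finite_set_bernoulli_rounding:
  assumes "finite E" shows "finite (set_pmf (bernoulli_rounding E p))"
  unfolding bernoulli_rounding_def
proof (rule finite_subset[OF set_Pi_pmf_subset'[OF assms]])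
  show "finite (PiE_dflt E 0 (set_pmf \<circ> (\<lambda>e. map_pmf of_bool (bernoulli_pmf (p e)) :: real pmf)))"
    using assms by (intro finite_PiE_dflt) auto
qed

lemma bernoulli_rounding_range:
  assumes "finite E" "b \<in> set_pmf (bernoulli_rounding E p)"
  shows "b e \<in> {0, 1}"
proof (cases "e \<in> E")
  case True
  have "b \<in> PiE_dflt E 0 (set_pmf \<circ> (\<lambda>e. map_pmf of_bool (bernoulli_pmf (p e)) :: real pmf))"
    by (rule subsetD[OF set_Pi_pmf_subset'[OF assms(1)] assms(2)[unfolded bernoulli_rounding_def]])
  then have "b e \<in> (of_bool :: bool \<Rightarrow> real) ` UNIV"
    using True by (auto simp: PiE_dflt_def)
  then show ?thesis by auto
next
  case False
  then show ?thesis
    using subsetD[OF set_Pi_pmf_subset[OF assms(1)] assms(2)[unfolded bernoulli_rounding_def]] by simp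
qed

lemma expectation_bernoulli_rounding_insert:
  fixes F :: "(nat \<Rightarrow> real) \<Rightarrow> real"
  assumes "finite E" "a \<notin> E" "0 \<le> p a" "p a \<le> 1"
  shows "measure_pmf.expectation (bernoulli_rounding (insert a E) p) F =
    p a * measure_pmf.expectation (bernoulli_rounding E p) (\<lambda>b. F (b(a := 1))) +
    (1 - p a) * measure_pmf.expectation (bernoulli_rounding E p) (\<lambda>b. F (b(a := 0)))"
proof -
  let ?P = "bernoulli_rounding E p"
  have "bernoulli_rounding (insert a E) p =
      bernoulli_pmf (p a) \<bind> (\<lambda>y. map_pmf (\<lambda>b. b(a := of_bool y)) ?P)"
    unfolding bernoulli_rounding_def Pi_pmf_insert'[OF assms(1,2)]
    by (simp add: map_pmf_def bind_assoc_pmf bind_return_pmf)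
  then have "measure_pmf.expectation (bernoulli_rounding (insert a E) p) F =
      (\<Sum>y\<in>UNIV. pmf (bernoulli_pmf (p a)) y *\<^sub>R
        measure_pmf.expectation (map_pmf (\<lambda>b. b(a := of_bool y)) ?P) F)"
    using finite_set_bernoulli_rounding[OF assms(1)]
    by (simp only:, intro pmf_expectation_bind) auto
  then show ?thesis using assms by (simp add: UNIV_bool)
qed

text \<open>
  This is where independence is used: the coordinates are exposed one at a time, and each is
  replaced by the constant \<open>c p\<^sub>e\<close> while the others are frozen. The values of the frozen
  coordinates are restricted to those that occur, because the potential is controlled only for
  bounded coordinates.
\<close>
lemma bernoulli_rounding_comparison:
  fixes F :: "(nat \<Rightarrow> real) \<Rightarrow> real"
  assumes "finite E" and p: "\<And>e. e \<in> E \<Longrightarrow> 0 \<le> p e \<and> p e \<le> 1"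
    and step: "\<And>e t. e \<in> E \<Longrightarrow> (\<And>i. t i \<in> {0, 1, c * p i}) \<Longrightarrow>
      p e * F (t(e := 1)) + (1 - p e) * F (t(e := 0)) \<le> F (t(e := c * p e))"
  shows "measure_pmf.expectation (bernoulli_rounding E p) F \<le> F (\<lambda>e. if e \<in> E then c * p e else 0)"
proof -
  have "measure_pmf.expectation (bernoulli_rounding A p) (\<lambda>b. F (\<lambda>e. if e \<in> A then b e else t e))
      \<le> F (\<lambda>e. if e \<in> A then c * p e else t e)"
    if "A \<subseteq> E" "\<And>i. t i \<in> {0, 1, c * p i}" for A t
    using finite_subset[OF that(1) assms(1)] that
  proof (induction A arbitrary: t rule: finite_induct)
    case empty
    then show ?case by (simp add: bernoulli_rounding_def)
  next
    case (insert a A)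
    have a: "a \<in> E" "0 \<le> p a" "p a \<le> 1" using insert.prems p by auto
    have fin: "finite A" by fact
    let ?P = "bernoulli_rounding A p"
    let ?E = "measure_pmf.expectation ?P"
    have upd: "(\<lambda>e. if e \<in> insert a A then (b(a := y)) e else t e)
        = (\<lambda>e. if e \<in> A then b e else (t(a := y)) e)" for b :: "nat \<Rightarrow> real" and y
      using insert.hyps by (auto simp: fun_eq_iff)
    have upd2: "(\<lambda>e. if e \<in> A then c * p e else (t(a := y)) e)
        = (\<lambda>e. if e \<in> A then c * p e else t e)(a := y)" for y
      using insert.hyps by (auto simp: fun_eq_iff)
    have IH: "?E (\<lambda>b. F (\<lambda>e. if e \<in> A then b e else (t(a := y)) e))
        \<le> F ((\<lambda>e. if e \<in> A then c * p e else t e)(a := y))" if "y \<in> {0, 1}" for y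
      unfolding upd2[symmetric] using insert.prems that by (intro insert.IH) auto
    have "measure_pmf.expectation (bernoulli_rounding (insert a A) p)
          (\<lambda>b. F (\<lambda>e. if e \<in> insert a A then b e else t e))
        = p a * ?E (\<lambda>b. F (\<lambda>e. if e \<in> A then b e else (t(a := 1)) e))
        + (1 - p a) * ?E (\<lambda>b. F (\<lambda>e. if e \<in> A then b e else (t(a := 0)) e))"
      unfolding upd[symmetric] by (rule expectation_bernoulli_rounding_insert[where p = p, OF fin insert.hyps(2) a(2,3)])
    also have "\<dots> \<le> p a * F ((\<lambda>e. if e \<in> A then c * p e else t e)(a := 1))
        + (1 - p a) * F ((\<lambda>e. if e \<in> A then c * p e else t e)(a := 0))"
      using IH[of 0] IH[of 1] a by (intro add_mono mult_left_mono) auto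
    also have "\<dots> \<le> F ((\<lambda>e. if e \<in> A then c * p e else t e)(a := c * p a))"
      using insert.prems(2) by (intro step a) auto
    also have "(\<lambda>e. if e \<in> A then c * p e else t e)(a := c * p a)
        = (\<lambda>e. if e \<in> insert a A then c * p e else t e)"
      by (auto simp: fun_eq_iff)
    finally show ?case .
  qed
  from this[of E "\<lambda>_. 0"]
  have "measure_pmf.expectation (bernoulli_rounding E p) (\<lambda>b. F (\<lambda>e. if e \<in> E then b e else 0))
      \<le> F (\<lambda>e. if e \<in> E then c * p e else 0)" by simp
  moreover have "measure_pmf.expectation (bernoulli_rounding E p) (\<lambda>b. F (\<lambda>e. if e \<in> E then b e else 0))
      = measure_pmf.expectation (bernoulli_rounding E p) F"
  proof (intro integral_cong_AE)
    show "AE b in measure_pmf (bernoulli_rounding E p). F (\<lambda>e. if e \<in> E then b e else 0) = F b"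
    proof (rule AE_pmfI)
      fix b assume "b \<in> set_pmf (bernoulli_rounding E p)"
      then have "b \<in> {f. \<forall>x. x \<notin> E \<longrightarrow> f x = 0}"
        unfolding bernoulli_rounding_def by (rule subsetD[OF set_Pi_pmf_subset[OF assms(1)]])
      then have "(\<lambda>e. if e \<in> E then b e else 0) = b"
        by (auto simp: fun_eq_iff)
      then show "F (\<lambda>e. if e \<in> E then b e else 0) = F b" by simp
    qed
  qed auto
  ultimately show ?thesis by simp
qed

lemma pmf_markov_inequality:
  fixes F :: "'a \<Rightarrow> real"
  assumes "finite (set_pmf M)" "0 < a" and "\<And>x. x \<in> set_pmf M \<Longrightarrow> 0 \<le> F x"
    and "\<And>x. x \<in> set_pmf M \<Longrightarrow> x \<in> A \<Longrightarrow> a \<le> F x"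
  shows "measure_pmf.prob M A \<le> measure_pmf.expectation M F / a"
proof -
  have "measure_pmf.expectation M (\<lambda>x. a * indicator A x) \<le> measure_pmf.expectation M F"
    using assms by (intro integral_mono_AE integrable_measure_pmf_finite AE_pmfI)
      (auto simp: indicator_def)
  then have "a * measure_pmf.prob M A \<le> measure_pmf.expectation M F" by simp
  then show ?thesis using assms(2) by (simp add: field_simps)
qed

section \<open>The potential and its replacement step\<close>

lemma mat_trace_pow_ge:
  assumes K: "bounded_below n 0 K" and x: "x \<in> carrier_vec n" "x \<bullet> x \<noteq> 0"
    and a: "0 \<le> a" "a * (x \<bullet> x) \<le> x \<bullet> (K *\<^sub>v x)"
  shows "a ^ k \<le> mat_trace (K ^\<^sub>m k)"
proof -
  have Kc: "K \<in> carrier_mat n n" "transpose_mat K = K" using K by (auto simp: bounded_below_def)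
  obtain l u where eb: "eigenbasis n K l u" using symmetric_mat_eigenbasis[OF Kc] by blast
  have "\<exists>i<n. a \<le> l i"
  proof (rule ccontr)
    assume "\<not> (\<exists>i<n. a \<le> l i)"
    then have less: "l i < a" if "i < n" for i using that by auto
    have "\<exists>i<n. u i \<bullet> x \<noteq> 0"
    proof (rule ccontr)
      assume "\<not> (\<exists>i<n. u i \<bullet> x \<noteq> 0)"
      then have "x \<bullet> x = 0" unfolding eigenbasis_parseval[OF eb x(1) x(1)] by simp
      then show False using x by simp
    qed
    then obtain i where i: "i < n" "u i \<bullet> x \<noteq> 0" by blast
    have "(\<Sum>i<n. l i * ((u i \<bullet> x) * (u i \<bullet> x))) < (\<Sum>i<n. a * ((u i \<bullet> x) * (u i \<bullet> x)))"
    proof (rule sum_strict_mono_ex1)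
      show "\<forall>i\<in>{..<n}. l i * ((u i \<bullet> x) * (u i \<bullet> x)) \<le> a * ((u i \<bullet> x) * (u i \<bullet> x))"
        using less by (intro ballI mult_right_mono) (auto intro: less_imp_le)
      have "l i * ((u i \<bullet> x) * (u i \<bullet> x)) < a * ((u i \<bullet> x) * (u i \<bullet> x))"
        using less[OF i(1)] i(2) by (intro mult_strict_right_mono) (auto simp: zero_less_mult_iff linorder_neq_iff)
      then show "\<exists>i\<in>{..<n}. l i * ((u i \<bullet> x) * (u i \<bullet> x)) < a * ((u i \<bullet> x) * (u i \<bullet> x))"
        using i(1) by blast
    qed simp
    then show False
      using a(2) unfolding eigenbasis_form[OF eb Kc x(1) x(1)] eigenbasis_parseval[OF eb x(1) x(1)]
        sum_distrib_left by simp
  qed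
  then obtain i where i: "i < n" "a \<le> l i" by blast
  have "a ^ k \<le> l i ^ k" using i a by (intro power_mono)
  also have "\<dots> \<le> (\<Sum>i<n. l i ^ k)"
    using i bounded_below_eigenvalue[OF K eb] by (intro member_le_sum) auto
  also have "\<dots> = mat_trace (K ^\<^sub>m k)" using mat_trace_pow[OF Kc(1) eb] by simp
  finally show ?thesis .
qed

lemma mat_trace_pow_nonneg:
  assumes K: "bounded_below n 0 K" shows "0 \<le> mat_trace (K ^\<^sub>m k)"
proof -
  have Kc: "K \<in> carrier_mat n n" "transpose_mat K = K" using K by (auto simp: bounded_below_def)
  obtain l u where eb: "eigenbasis n K l u" using symmetric_mat_eigenbasis[OF Kc] by blast
  show ?thesis unfolding mat_trace_pow[OF Kc(1) eb]
    using bounded_below_eigenvalue[OF K eb] by (intro sum_nonneg) auto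
qed

lemma mat_trace_pow_scalar:
  assumes Kc: "K \<in> carrier_mat n n" "transpose_mat K = K"
    and form: "\<And>x. x \<in> carrier_vec n \<Longrightarrow> x \<bullet> (K *\<^sub>v x) = a * (x \<bullet> x)"
  shows "mat_trace (K ^\<^sub>m k) = real n * a ^ k"
proof -
  obtain l u where eb: "eigenbasis n K l u" using symmetric_mat_eigenbasis[OF Kc] by blast
  have "l i = a" if "i < n" for i
    using form[OF eigenbasis_carrier[OF eb that]] eigenbasis_norm[OF eb that] that eb
      eigenbasis_carrier[OF eb that] by (simp add: eigenbasis_def)
  then show ?thesis unfolding mat_trace_pow[OF Kc(1) eb] by simp
qed

text \<open>
  Klein's inequality is applied twice: to the edge itself at the updated matrix, and to the
  constant \<open>c p\<close> at \<open>Z\<close>. The moment hypothesis links the two slopes. For positive \<open>\<eta>\<close> it needs a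
  factor \<open>c \<ge> 1\<close>, for negative \<open>\<eta>\<close> it allows only some \<open>c \<le> 1\<close>.
\<close>
lemma mat_trace_pow_bernoulli_step:
  assumes Z: "bounded_below n 0 Z" and Z1: "bounded_below n 0 (Z + \<eta> \<cdot>\<^sub>m rank_one v)"
    and Z2: "bounded_below n 0 (Z + (\<eta> * c * p) \<cdot>\<^sub>m rank_one v)" and v: "v \<in> carrier_vec n"
    and p: "0 \<le> p" 
    and moment: "\<eta> * (v \<bullet> (((Z + \<eta> \<cdot>\<^sub>m rank_one v) ^\<^sub>m m) *\<^sub>v v)) \<le> c * (\<eta> * (v \<bullet> ((Z ^\<^sub>m m) *\<^sub>v v)))"
  shows "p * mat_trace ((Z + \<eta> \<cdot>\<^sub>m rank_one v) ^\<^sub>m Suc m) + (1 - p) * mat_trace (Z ^\<^sub>m Suc m)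
    \<le> mat_trace ((Z + (\<eta> * c * p) \<cdot>\<^sub>m rank_one v) ^\<^sub>m Suc m)"
proof -
  define a where "a = v \<bullet> ((Z ^\<^sub>m m) *\<^sub>v v)"
  define T0 T1 T2 where "T0 = mat_trace (Z ^\<^sub>m Suc m)"
    and "T1 = mat_trace ((Z + \<eta> \<cdot>\<^sub>m rank_one v) ^\<^sub>m Suc m)"
    and "T2 = mat_trace ((Z + (\<eta> * c * p) \<cdot>\<^sub>m rank_one v) ^\<^sub>m Suc m)"
  have Zc: "Z \<in> carrier_mat n n" using Z by (simp add: bounded_below_def)
  have "T1 - T0 \<le> real (Suc m) * (\<eta> * (v \<bullet> (((Z + \<eta> \<cdot>\<^sub>m rank_one v) ^\<^sub>m m) *\<^sub>v v)))"
    unfolding T1_def T0_def by (rule klein_rank_one[OF Z Z1 v refl])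
  also have "\<dots> \<le> real (Suc m) * (c * (\<eta> * a))"
    using moment unfolding a_def by (intro mult_left_mono) auto
  finally have "p * (T1 - T0) \<le> p * (real (Suc m) * (c * (\<eta> * a)))"
    using p by (intro mult_left_mono)
  moreover have "Z = (Z + (\<eta> * c * p) \<cdot>\<^sub>m rank_one v) + (- (\<eta> * c * p)) \<cdot>\<^sub>m rank_one v"
    using Zc v by (intro eq_matI) auto
  then have "T0 - T2 \<le> real (Suc m) * (- (\<eta> * c * p) * a)"
    unfolding T0_def T2_def a_def by (rule klein_rank_one[OF Z2 Z v])
  ultimately show ?thesis
    unfolding T0_def[symmetric] T1_def[symmetric] T2_def[symmetric] by (simp add: algebra_simps)
qed

lemma scalar_prod_Cauchy_Schwarz:
  fixes x y :: "real Matrix.vec"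
  assumes "x \<in> carrier_vec n" "y \<in> carrier_vec n"
  shows "(x \<bullet> y)\<^sup>2 \<le> (x \<bullet> x) * (y \<bullet> y)"
  using Cauchy_Schwarz_ineq_sum[of "($) x" "($) y" "{..<n}"] assms
  by (simp add: scalar_prod_lessThan[of _ n] power2_eq_square)

text \<open>
  The step size \<open>\<eta>\<close> of the potential is \<open>\<theta> / (m + 1)\<close> up to sign. A large exponent \<open>m + 1\<close> makes
  it as small as needed while the product \<open>\<theta>\<close> of the two, which determines the quality of the
  bound, stays fixed.
\<close>
lemma exponent_choice:
  assumes "0 \<le> (\<theta>::real)" "0 \<le> D"
  obtains m h where "h = \<theta> / real (Suc m)" "0 \<le> h" "h * D \<le> 1 / 2" "h \<le> 1 / 2"
proof -
  obtain m where m: "2 * \<theta> * (1 + D) < real m" using reals_Archimedean2 by blast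
  define h where "h = \<theta> / real (Suc m)"
  have h: "0 \<le> h" using assms by (simp add: h_def)
  have "2 * \<theta> * (1 + D) \<le> real (Suc m)" using m by simp
  then have "h * (1 + D) \<le> 1 / 2" by (simp add: h_def field_simps)
  moreover have "0 \<le> h * D" using h assms by simp
  ultimately have "h * D \<le> 1 / 2" "h \<le> 1 / 2" using h by (auto simp: distrib_left)
  then show thesis using that h_def h by blast
qed

lemma power_ratio_le_exp:
  assumes "0 \<le> (x::real)" "x \<le> (1 - y) * w" "0 < w"
  shows "x ^ k / w ^ k \<le> exp (- (real k * y))"
proof -
  have "x / w \<le> 1 - y" using assms by (simp add: field_simps)
  also have "\<dots> \<le> exp (- y)" using exp_ge_add_one_self[of "- y"] by simp
  finally have "(x / w) ^ k \<le> exp (- y) ^ k" using assms by (intro power_mono) auto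
  then show ?thesis by (simp add: power_divide exp_of_nat_mult[symmetric])
qed

section \<open>Tail bounds for random rank-one sums\<close>

text \<open>
  A Parseval frame with weights \<open>p\<^sub>e\<close>, whose vectors are kept at random with probability \<open>p\<^sub>e\<close>,
  completed by one vector \<open>z\<close> that is always kept. The vector \<open>z\<close> stands for the direction of the
  constant vector, to which every edge vector is orthogonal.
\<close>
locale bernoulli_frame =
  fixes n :: nat and E :: "nat set" and v :: "nat \<Rightarrow> real Matrix.vec" and z :: "real Matrix.vec"
    and p :: "nat \<Rightarrow> real" and \<rho> :: real
  assumes finite_E: "finite E"
    and v_carrier: "e \<in> E \<Longrightarrow> v e \<in> carrier_vec n"
    and z_carrier: "z \<in> carrier_vec n"
    and p_range: "e \<in> E \<Longrightarrow> 0 \<le> p e \<and> p e \<le> 1"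
    and frame: "x \<in> carrier_vec n \<Longrightarrow> (\<Sum>e\<in>E. p e * (v e \<bullet> x)\<^sup>2) + (z \<bullet> x)\<^sup>2 = x \<bullet> x"
    and v_norm: "e \<in> E \<Longrightarrow> v e \<bullet> v e \<le> \<rho>"
    and \<rho>_pos: "0 < \<rho>"
begin

text \<open>
  The matrix \<open>I + \<eta> (c z z\<^sup>T + \<Sum>\<^sub>e t\<^sub>e v\<^sub>e v\<^sub>e\<^sup>T)\<close>. The factor \<open>c\<close> in front of \<open>z z\<^sup>T\<close> makes it a
  multiple of the identity at \<open>t = c p\<close>.
\<close>
definition perturbed :: "real \<Rightarrow> real \<Rightarrow> (nat \<Rightarrow> real) \<Rightarrow> real Matrix.mat" where
  "perturbed \<eta> c t = Matrix.mat n n (\<lambda>(i, j). (if i = j then 1 else 0) +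
     \<eta> * (c * (z $ i * z $ j) + (\<Sum>e\<in>E. t e * (v e $ i * v e $ j))))"

lemma perturbed_carrier [simp]: "perturbed \<eta> c t \<in> carrier_mat n n"
  by (simp add: perturbed_def)

lemma perturbed_symmetric [simp]: "transpose_mat (perturbed \<eta> c t) = perturbed \<eta> c t"
  by (auto simp: perturbed_def mult.commute)

lemma perturbed_form:
  assumes x: "x \<in> carrier_vec n"
  shows "x \<bullet> (perturbed \<eta> c t *\<^sub>v x) = x \<bullet> x + \<eta> * (c * (z \<bullet> x)\<^sup>2 + (\<Sum>e\<in>E. t e * (v e \<bullet> x)\<^sup>2))"
proof -
  have sq: "(y \<bullet> x)\<^sup>2 = (\<Sum>i<n. \<Sum>j<n. x $ i * x $ j * (y $ i * y $ j))"
    if "y \<in> carrier_vec n" for y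
    using that x by (simp add: scalar_prod_lessThan[of _ n] power2_eq_square sum_product algebra_simps)
  have "x \<bullet> (perturbed \<eta> c t *\<^sub>v x) = (\<Sum>i<n. \<Sum>j<n. x $ i * x $ j *
      ((if i = j then 1 else 0) + \<eta> * (c * (z $ i * z $ j) + (\<Sum>e\<in>E. t e * (v e $ i * v e $ j)))))"
    using x by (simp add: scalar_prod_lessThan[of _ n] perturbed_def sum_distrib_left
        mult_mat_vec_def scalar_prod_def lessThan_atLeast0 mult_ac)
  also have "\<dots> = (\<Sum>i<n. \<Sum>j<n. x $ i * x $ j * (if i = j then 1 else 0))
      + \<eta> * (c * (\<Sum>i<n. \<Sum>j<n. x $ i * x $ j * (z $ i * z $ j))
      + (\<Sum>i<n. \<Sum>j<n. \<Sum>e\<in>E. t e * (x $ i * x $ j * (v e $ i * v e $ j))))"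
    by (simp add: sum.distrib sum_distrib_left distrib_left mult_ac)
  also have "(\<Sum>i<n. \<Sum>j<n. \<Sum>e\<in>E. t e * (x $ i * x $ j * (v e $ i * v e $ j)))
      = (\<Sum>e\<in>E. \<Sum>i<n. \<Sum>j<n. t e * (x $ i * x $ j * (v e $ i * v e $ j)))"
    by (subst sum.swap[of _ E], subst sum.swap[of _ E], rule refl)
  also have "\<dots> = (\<Sum>e\<in>E. t e * (v e \<bullet> x)\<^sup>2)"
    using v_carrier by (intro sum.cong refl) (simp add: sq sum_distrib_left)
  also have "(\<Sum>i<n. \<Sum>j<n. x $ i * x $ j * (if i = j then 1 else 0)) = x \<bullet> x"
    using x by (simp add: scalar_prod_lessThan[of _ n] if_distrib cong: if_cong)
  finally show ?thesis using sq[OF z_carrier] by simp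
qed

lemma perturbed_update:
  assumes "e \<in> E"
  shows "perturbed \<eta> c (t(e := y)) = perturbed \<eta> c (t(e := 0)) + (\<eta> * y) \<cdot>\<^sub>m rank_one (v e)"
proof (rule eq_matI)
  fix i j assume "i < dim_row (perturbed \<eta> c (t(e := 0)) + (\<eta> * y) \<cdot>\<^sub>m rank_one (v e))"
    "j < dim_col (perturbed \<eta> c (t(e := 0)) + (\<eta> * y) \<cdot>\<^sub>m rank_one (v e))"
  then have ij: "i < n" "j < n" using v_carrier[OF assms] by auto
  have "(\<Sum>a\<in>E. (t(e := x)) a * (v a $ i * v a $ j))
      = x * (v e $ i * v e $ j) + (\<Sum>a\<in>E - {e}. t a * (v a $ i * v a $ j))" for x
    using assms finite_E by (subst sum.remove[of _ e]) auto
  then show "perturbed \<eta> c (t(e := y)) $$ (i, j)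
      = (perturbed \<eta> c (t(e := 0)) + (\<eta> * y) \<cdot>\<^sub>m rank_one (v e)) $$ (i, j)"
    using ij v_carrier[OF assms] by (simp add: perturbed_def rank_one_def algebra_simps)
qed (use v_carrier[OF assms] in \<open>auto simp: perturbed_def\<close>)

lemma perturbed_bounded_below_pos:
  assumes "0 \<le> \<eta>" "0 \<le> c" "\<And>e. e \<in> E \<Longrightarrow> 0 \<le> t e"
  shows "bounded_below n 1 (perturbed \<eta> c t)"
  unfolding bounded_below_def
  using assms by (auto simp: perturbed_form intro!: mult_nonneg_nonneg add_nonneg_nonneg sum_nonneg)

text \<open>
  A negative perturbation keeps half of the identity if it is small compared with the crude bound
  \<open>|z|\<^sup>2 + \<Sum>\<^sub>e |v\<^sub>e|\<^sup>2\<close> for its norm. Crudeness costs nothing, because the step size may be as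
  small as one likes.
\<close>
lemma perturbed_bounded_below_neg:
  assumes h: "0 \<le> h" "h * (z \<bullet> z + (\<Sum>e\<in>E. v e \<bullet> v e)) \<le> 1 / 2" and c: "c \<le> 1"
    and t: "\<And>e. e \<in> E \<Longrightarrow> t e \<le> 1"
  shows "bounded_below n (1 / 2) (perturbed (- h) c t)"
  unfolding bounded_below_def
proof (intro conjI ballI perturbed_carrier perturbed_symmetric)
  fix x :: "real Matrix.vec" assume x: "x \<in> carrier_vec n"
  have cs: "a * (y \<bullet> x)\<^sup>2 \<le> (y \<bullet> y) * (x \<bullet> x)" if "a \<le> 1" "y \<in> carrier_vec n" for a y
  proof -
    have "a * (y \<bullet> x)\<^sup>2 \<le> 1 * (y \<bullet> x)\<^sup>2" using that by (intro mult_right_mono) auto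
    then show ?thesis using scalar_prod_Cauchy_Schwarz[OF that(2) x] by linarith
  qed
  have "c * (z \<bullet> x)\<^sup>2 + (\<Sum>e\<in>E. t e * (v e \<bullet> x)\<^sup>2)
      \<le> (z \<bullet> z) * (x \<bullet> x) + (\<Sum>e\<in>E. (v e \<bullet> v e) * (x \<bullet> x))"
    using c t z_carrier v_carrier by (intro add_mono sum_mono cs) auto
  then have "h * (c * (z \<bullet> x)\<^sup>2 + (\<Sum>e\<in>E. t e * (v e \<bullet> x)\<^sup>2))
      \<le> h * (z \<bullet> z + (\<Sum>e\<in>E. v e \<bullet> v e)) * (x \<bullet> x)"
    using h(1) by (auto simp: distrib_right sum_distrib_right[symmetric] mult.assoc intro: mult_left_mono)
  also have "\<dots> \<le> 1 / 2 * (x \<bullet> x)"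
    using h(2) scalar_prod_self_nonneg by (intro mult_right_mono)
  finally show "1 / 2 * (x \<bullet> x) \<le> x \<bullet> (perturbed (- h) c t *\<^sub>v x)"
    unfolding perturbed_form[OF x] by linarith
qed

lemma mat_trace_perturbed_mean:
  "mat_trace ((perturbed \<eta> c (\<lambda>e. if e \<in> E then c * p e else 0)) ^\<^sub>m k) = real n * (1 + \<eta> * c) ^ k"
proof (rule mat_trace_pow_scalar)
  fix x :: "real Matrix.vec" assume x: "x \<in> carrier_vec n"
  have "(\<Sum>e\<in>E. (if e \<in> E then c * p e else 0) * (v e \<bullet> x)\<^sup>2) = c * (\<Sum>e\<in>E. p e * (v e \<bullet> x)\<^sup>2)"
    by (simp add: sum_distrib_left mult.assoc cong: sum.cong)
  then have "x \<bullet> (perturbed \<eta> c (\<lambda>e. if e \<in> E then c * p e else 0) *\<^sub>v x)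
      = x \<bullet> x + \<eta> * (c * ((\<Sum>e\<in>E. p e * (v e \<bullet> x)\<^sup>2) + (z \<bullet> x)\<^sup>2))"
    unfolding perturbed_form[OF x] by (simp add: algebra_simps)
  then show "x \<bullet> (perturbed \<eta> c (\<lambda>e. if e \<in> E then c * p e else 0) *\<^sub>v x) = (1 + \<eta> * c) * (x \<bullet> x)"
    unfolding frame[OF x] by (simp add: algebra_simps)
qed simp_all

text \<open>
  Here every matrix in question is bounded below by the identity, and adding an edge is the
  rank-one update whose moments grow by at most the factor \<open>c\<close>.
\<close>
lemma expectation_trace_pos_le:
  assumes h: "0 \<le> h" and c: "c = (1 + h * \<rho>) ^ m"
  shows "measure_pmf.expectation (bernoulli_rounding E p) (\<lambda>b. mat_trace ((perturbed h c b) ^\<^sub>m Suc m))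
    \<le> real n * (1 + h * c) ^ Suc m"
proof -
  have c0: "0 \<le> c" using h \<rho>_pos by (simp add: c)
  have "measure_pmf.expectation (bernoulli_rounding E p) (\<lambda>b. mat_trace ((perturbed h c b) ^\<^sub>m Suc m))
      \<le> mat_trace ((perturbed h c (\<lambda>e. if e \<in> E then c * p e else 0)) ^\<^sub>m Suc m)"
  proof (rule bernoulli_rounding_comparison[OF finite_E p_range])
    fix e t assume e: "e \<in> E" and t: "\<And>i. t i \<in> {0, 1, c * p i}"
    have t0: "0 \<le> t i" if "i \<in> E" for i using t[of i] c0 p_range[OF that] by auto
    have bb: "bounded_below n 1 (perturbed h c (t(e := y)))" if "0 \<le> y" for y
      using h c0 t0 that by (intro perturbed_bounded_below_pos) auto
    then have bb0: "bounded_below n 0 (perturbed h c (t(e := y)))" if "0 \<le> y" for y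
      using that bounded_below_mono by force
    define Z where "Z = perturbed h c (t(e := 0))"
    have Z1: "perturbed h c (t(e := 1)) = Z + h \<cdot>\<^sub>m rank_one (v e)"
      using perturbed_update[OF e, of h c t 1] by (simp add: Z_def)
    have Z2: "perturbed h c (t(e := c * p e)) = Z + (h * c * p e) \<cdot>\<^sub>m rank_one (v e)"
      using perturbed_update[OF e, of h c t "c * p e"] by (simp add: Z_def mult.assoc)
    have "v e \<bullet> (((Z + h \<cdot>\<^sub>m rank_one (v e)) ^\<^sub>m m) *\<^sub>v v e) \<le> (1 + h * \<rho> / 1) ^ m * (v e \<bullet> ((Z ^\<^sub>m m) *\<^sub>v v e))"
      using bb[of 0] h by (intro rank_one_update_moment_le[of n]) (auto simp: Z_def v_carrier[OF e] v_norm[OF e])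
    then have "h * (v e \<bullet> (((Z + h \<cdot>\<^sub>m rank_one (v e)) ^\<^sub>m m) *\<^sub>v v e)) \<le> h * (c * (v e \<bullet> ((Z ^\<^sub>m m) *\<^sub>v v e)))"
      using h by (intro mult_left_mono) (auto simp: c)
    then show "p e * mat_trace ((perturbed h c (t(e := 1))) ^\<^sub>m Suc m)
        + (1 - p e) * mat_trace ((perturbed h c (t(e := 0))) ^\<^sub>m Suc m)
        \<le> mat_trace ((perturbed h c (t(e := c * p e))) ^\<^sub>m Suc m)"
      unfolding Z1 Z2 Z_def[symmetric]
      using bb0[of 0] bb0[of 1] bb0[of "c * p e"] c0 p_range[OF e] v_carrier[OF e]
      by (intro mat_trace_pow_bernoulli_step[of n]) (simp_all only: Z1 Z2 Z_def[symmetric], simp_all add: mult.left_commute)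
  qed
  then show ?thesis unfolding mat_trace_perturbed_mean .
qed

text \<open>
  Adding an edge now decreases the matrix. The moment comparison is applied in the opposite
  direction, from the matrix with the edge to the one without, and the lower bound \<open>1 / 2\<close> for the
  spectrum accounts for the factor 2 in \<open>c\<close>.
\<close>
lemma expectation_trace_neg_le:
  assumes h: "0 \<le> h" "h * (z \<bullet> z + (\<Sum>e\<in>E. v e \<bullet> v e)) \<le> 1 / 2"
    and c: "c = 1 / (1 + 2 * h * \<rho>) ^ m"
  shows "measure_pmf.expectation (bernoulli_rounding E p) (\<lambda>b. mat_trace ((perturbed (- h) c b) ^\<^sub>m Suc m))
    \<le> real n * (1 - h * c) ^ Suc m"
proof -
  have g: "1 \<le> (1 + 2 * h * \<rho>) ^ m" using h \<rho>_pos by (intro one_le_power) simp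
  then have c0: "0 \<le> c" "c \<le> 1" by (simp_all add: c)
  have "measure_pmf.expectation (bernoulli_rounding E p) (\<lambda>b. mat_trace ((perturbed (- h) c b) ^\<^sub>m Suc m))
      \<le> mat_trace ((perturbed (- h) c (\<lambda>e. if e \<in> E then c * p e else 0)) ^\<^sub>m Suc m)"
  proof (rule bernoulli_rounding_comparison[OF finite_E p_range])
    fix e t assume e: "e \<in> E" and t: "\<And>i. t i \<in> {0, 1, c * p i}"
    have cp: "c * p i \<le> 1" if "i \<in> E" for i
      using c0 p_range[OF that] by (intro mult_le_one) auto
    have t1: "t i \<le> 1" if "i \<in> E" for i using t[of i] cp[OF that] by auto
    have bb: "bounded_below n (1 / 2) (perturbed (- h) c (t(e := y)))" if "y \<le> 1" for y
      using h c0 t1 that by (intro perturbed_bounded_below_neg) auto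
    then have bb0: "bounded_below n 0 (perturbed (- h) c (t(e := y)))" if "y \<le> 1" for y
      using that bounded_below_mono by force
    define Z where "Z = perturbed (- h) c (t(e := 0))"
    have Zc: "Z \<in> carrier_mat n n" by (simp add: Z_def)
    have Z1: "perturbed (- h) c (t(e := 1)) = Z + (- h) \<cdot>\<^sub>m rank_one (v e)"
      using perturbed_update[OF e, of "- h" c t 1] by (simp add: Z_def)
    have Z2: "perturbed (- h) c (t(e := c * p e)) = Z + (- h * c * p e) \<cdot>\<^sub>m rank_one (v e)"
      using perturbed_update[OF e, of "- h" c t "c * p e"] by (simp add: Z_def mult.assoc)
    define Z' where "Z' = Z + (- h) \<cdot>\<^sub>m rank_one (v e)"
    have ZZ': "Z = Z' + h \<cdot>\<^sub>m rank_one (v e)"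
      using Zc v_carrier[OF e] by (intro eq_matI) (auto simp: Z'_def)
    have "v e \<bullet> ((Z ^\<^sub>m m) *\<^sub>v v e) \<le> (1 + h * \<rho> / (1 / 2)) ^ m * (v e \<bullet> ((Z' ^\<^sub>m m) *\<^sub>v v e))"
      using bb[of 1] h unfolding Z1 Z'_def[symmetric]
      by (intro rank_one_update_moment_le[of n]) (auto simp: ZZ'[symmetric] v_carrier[OF e] v_norm[OF e])
    then have "c * (v e \<bullet> ((Z ^\<^sub>m m) *\<^sub>v v e)) \<le> v e \<bullet> ((Z' ^\<^sub>m m) *\<^sub>v v e)"
      using g by (simp add: c field_simps)
    then have "- h * (v e \<bullet> ((Z' ^\<^sub>m m) *\<^sub>v v e)) \<le> - h * (c * (v e \<bullet> ((Z ^\<^sub>m m) *\<^sub>v v e)))"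
      using h by (intro mult_left_mono_neg) auto
    then show "p e * mat_trace ((perturbed (- h) c (t(e := 1))) ^\<^sub>m Suc m)
        + (1 - p e) * mat_trace ((perturbed (- h) c (t(e := 0))) ^\<^sub>m Suc m)
        \<le> mat_trace ((perturbed (- h) c (t(e := c * p e))) ^\<^sub>m Suc m)"
      unfolding Z1 Z2 Z_def[symmetric]
      using bb0[of 0] bb0[of 1] bb0[of "c * p e"] cp[OF e] p_range[OF e] v_carrier[OF e]
      by (intro mat_trace_pow_bernoulli_step[of n])
        (simp_all only: Z1 Z2 Z_def[symmetric] Z'_def[symmetric], simp_all add: mult.left_commute)
  qed
  then show ?thesis unfolding mat_trace_perturbed_mean by simp
qed

text \<open>
  A vector \<open>x\<close> that violates the upper bound forces an eigenvalue of at least \<open>a = 1 + h (1 + \<epsilon>)\<close>,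
  hence a potential of at least \<open>a\<^sup>m\<^sup>+\<^sup>1\<close>, whereas its expectation is at most \<open>n (1 + h c)\<^sup>m\<^sup>+\<^sup>1\<close>.
  With \<open>\<theta> = \<epsilon> / (4 \<rho>)\<close> the inflation factor satisfies \<open>c \<le> 1 + \<epsilon> / 2\<close>, which leaves half of the
  gap.
\<close>
lemma upper_tail:
  assumes \<epsilon>: "0 < \<epsilon>" "\<epsilon> \<le> 1"
  shows "measure_pmf.prob (bernoulli_rounding E p)
    {b. \<exists>x\<in>carrier_vec n. z \<bullet> x = 0 \<and> (1 + \<epsilon>) * (x \<bullet> x) < (\<Sum>e\<in>E. b e * (v e \<bullet> x)\<^sup>2)}
    \<le> real n * exp (- \<epsilon>\<^sup>2 / (16 * \<rho>))" (is "measure_pmf.prob ?P ?A \<le> _")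
proof -
  define \<theta> where "\<theta> = \<epsilon> / (4 * \<rho>)"
  have \<theta>: "0 < \<theta>" using \<epsilon> \<rho>_pos by (simp add: \<theta>_def)
  obtain m h where h_eq: "h = \<theta> / real (Suc m)" and h: "0 \<le> h" "h \<le> 1 / 2"
    by (rule exponent_choice[of \<theta> 0]) (use \<theta> in auto)
  define c where "c = (1 + h * \<rho>) ^ m"
  define a where "a = 1 + h * (1 + \<epsilon>)"
  have a: "0 < a" using h \<epsilon> by (simp add: a_def add_pos_nonneg)
  \<comment> \<open>The choice of \<open>\<theta>\<close> makes \<open>c\<close> at most \<open>exp (\<epsilon> / 4)\<close>.\<close>
  have "c \<le> exp (h * \<rho>) ^ m"
    unfolding c_def using h \<rho>_pos exp_ge_add_one_self[of "h * \<rho>"] by (intro power_mono) auto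
  also have "\<dots> = exp (real m * h * \<rho>)" by (simp add: exp_of_nat_mult[symmetric])
  also have "\<dots> \<le> exp (\<epsilon> / 4)"
  proof -
    have "real m * h \<le> \<theta>" using \<theta> by (simp add: h_eq field_simps)
    then have "real m * h * \<rho> \<le> \<theta> * \<rho>" using \<rho>_pos by (intro mult_right_mono) auto
    then show ?thesis using \<rho>_pos by (simp add: \<theta>_def)
  qed
  also have "\<dots> \<le> 1 + \<epsilon> / 4 + (\<epsilon> / 4)\<^sup>2" using \<epsilon> by (intro exp_bound) auto
  also have "\<dots> \<le> 1 + \<epsilon> / 2"
  proof -
    have "(\<epsilon> / 4) * (\<epsilon> / 4) \<le> (\<epsilon> / 4) * 1" using \<epsilon> by (intro mult_left_mono) auto
    then show ?thesis by (simp add: power2_eq_square)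
  qed
  finally have c: "c \<le> 1 + \<epsilon> / 2" .
  have c0: "0 \<le> c" using h \<rho>_pos by (simp add: c_def)
  have "measure_pmf.prob ?P ?A
      \<le> measure_pmf.expectation ?P (\<lambda>b. mat_trace ((perturbed h c b) ^\<^sub>m Suc m)) / a ^ Suc m"
  proof (rule pmf_markov_inequality[OF finite_set_bernoulli_rounding[OF finite_E]])
    fix b assume "b \<in> set_pmf ?P"
    then have b: "0 \<le> b e" for e using bernoulli_rounding_range[OF finite_E, of b p e] by auto
    have bb: "bounded_below n 0 (perturbed h c b)"
      using perturbed_bounded_below_pos[of h c b] bounded_below_mono[of n 1 _ 0] h c0 b by auto
    show "0 \<le> mat_trace ((perturbed h c b) ^\<^sub>m Suc m)" by (rule mat_trace_pow_nonneg[OF bb])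
    assume "b \<in> ?A"
    then obtain x where x: "x \<in> carrier_vec n" "z \<bullet> x = 0"
      "(1 + \<epsilon>) * (x \<bullet> x) < (\<Sum>e\<in>E. b e * (v e \<bullet> x)\<^sup>2)" by blast
    show "a ^ Suc m \<le> mat_trace ((perturbed h c b) ^\<^sub>m Suc m)"
    proof (rule mat_trace_pow_ge[OF bb x(1)])
      show "x \<bullet> x \<noteq> 0"
      proof
        assume "x \<bullet> x = 0"
        then have "x = 0\<^sub>v n" using scalar_prod_self_eq_0[OF x(1)] by simp
        then have "(\<Sum>e\<in>E. b e * (v e \<bullet> x)\<^sup>2) = 0" using v_carrier by (intro sum.neutral) auto
        then show False using x(3) \<open>x \<bullet> x = 0\<close> by simp
      qed
      have "h * ((1 + \<epsilon>) * (x \<bullet> x)) \<le> h * (\<Sum>e\<in>E. b e * (v e \<bullet> x)\<^sup>2)"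
        using h x(3) by (intro mult_left_mono) auto
      then show "a * (x \<bullet> x) \<le> x \<bullet> (perturbed h c b *\<^sub>v x)"
        unfolding perturbed_form[OF x(1)] x(2) a_def by (simp add: distrib_right mult.assoc)
    qed (use a in simp)
  qed (use a in simp)
  also have "\<dots> \<le> (real n * (1 + h * c) ^ Suc m) / a ^ Suc m"
    using expectation_trace_pos_le[OF h(1) c_def] a by (intro divide_right_mono) auto
  also have "\<dots> = real n * ((1 + h * c) ^ Suc m / a ^ Suc m)" by simp
  also have "\<dots> \<le> real n * exp (- (real (Suc m) * (h * \<epsilon> / 4)))"
  proof (intro mult_left_mono power_ratio_le_exp)
    have "h * (1 + \<epsilon>) \<le> (1 / 2) * 2" using h \<epsilon> by (intro mult_mono) auto
    then have "(h * \<epsilon> / 4) * a \<le> (h * \<epsilon> / 4) * 2"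
      using h \<epsilon> by (intro mult_left_mono) (auto simp: a_def)
    moreover have "h * c \<le> h * (1 + \<epsilon> / 2)" using h c by (intro mult_left_mono)
    moreover have "(1 - h * \<epsilon> / 4) * a = 1 + h * (1 + \<epsilon> / 2) + h * \<epsilon> / 2 - (h * \<epsilon> / 4) * a"
      by (simp add: a_def field_simps)
    ultimately show "1 + h * c \<le> (1 - h * \<epsilon> / 4) * a" by linarith
  qed (use a h c0 in auto)
  also have "real (Suc m) * (h * \<epsilon> / 4) = \<theta> * \<epsilon> / 4"
    using h_eq by (simp del: of_nat_Suc)
  also have "\<dots> = \<epsilon>\<^sup>2 / (16 * \<rho>)"
    using \<rho>_pos by (simp add: \<theta>_def power2_eq_square)
  finally show ?thesis by simp
qed

text \<open>
  The mirror image of the upper tail: a violating vector makes the largest eigenvalue of the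
  matrix perturbed by \<open>- h\<close> at least \<open>1 - h (1 - \<epsilon>)\<close>, and now \<open>c \<ge> 1 - \<epsilon> / 2\<close>.
\<close>
lemma lower_tail:
  assumes \<epsilon>: "0 < \<epsilon>" "\<epsilon> \<le> 1"
  shows "measure_pmf.prob (bernoulli_rounding E p)
    {b. \<exists>x\<in>carrier_vec n. z \<bullet> x = 0 \<and> (\<Sum>e\<in>E. b e * (v e \<bullet> x)\<^sup>2) < (1 - \<epsilon>) * (x \<bullet> x)}
    \<le> real n * exp (- \<epsilon>\<^sup>2 / (16 * \<rho>))" (is "measure_pmf.prob ?P ?A \<le> _")
proof -
  define \<theta> where "\<theta> = \<epsilon> / (4 * \<rho>)"
  define D where "D = z \<bullet> z + (\<Sum>e\<in>E. v e \<bullet> v e)"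
  have D: "0 \<le> D" unfolding D_def by (intro add_nonneg_nonneg sum_nonneg scalar_prod_self_nonneg)
  have \<theta>: "0 < \<theta>" using \<epsilon> \<rho>_pos by (simp add: \<theta>_def)
  obtain m h where h_eq: "h = \<theta> / real (Suc m)" and h: "0 \<le> h" "h * D \<le> 1 / 2" "h \<le> 1 / 2"
    by (rule exponent_choice[of \<theta> D]) (use \<theta> D in auto)
  define c where "c = 1 / (1 + 2 * h * \<rho>) ^ m"
  define a where "a = 1 - h * (1 - \<epsilon>)"
  have h1: "h * (1 - \<epsilon>) \<le> 1 / 2 * 1" using h \<epsilon> by (intro mult_mono) auto
  then have a: "0 < a" by (simp add: a_def)
  have g1: "1 \<le> (1 + 2 * h * \<rho>) ^ m" using h \<rho>_pos by (intro one_le_power) simp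
  have c1: "0 \<le> c" "c \<le> 1" using g1 by (simp_all add: c_def)
  have c: "1 - \<epsilon> / 2 \<le> c"
  proof -
    have "(1 + 2 * h * \<rho>) ^ m \<le> exp (2 * h * \<rho>) ^ m"
      using h \<rho>_pos exp_ge_add_one_self[of "2 * h * \<rho>"] by (intro power_mono) auto
    also have "\<dots> = exp (2 * (real m * h * \<rho>))" by (simp add: exp_of_nat_mult[symmetric] mult_ac)
    also have "\<dots> \<le> exp (\<epsilon> / 2)"
    proof -
      have "real m * h \<le> \<theta>" using \<theta> by (simp add: h_eq field_simps)
      then have "real m * h * \<rho> \<le> \<theta> * \<rho>" using \<rho>_pos by (intro mult_right_mono) auto
      then show ?thesis using \<rho>_pos by (simp add: \<theta>_def)
    qed
    finally have "1 / exp (\<epsilon> / 2) \<le> c"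
      unfolding c_def using g1 by (intro divide_left_mono) auto
    moreover have "1 - \<epsilon> / 2 \<le> exp (- (\<epsilon> / 2))" using exp_ge_add_one_self[of "- (\<epsilon> / 2)"] by simp
    ultimately show ?thesis by (simp add: exp_minus inverse_eq_divide)
  qed
  have "measure_pmf.prob ?P ?A
      \<le> measure_pmf.expectation ?P (\<lambda>b. mat_trace ((perturbed (- h) c b) ^\<^sub>m Suc m)) / a ^ Suc m"
  proof (rule pmf_markov_inequality[OF finite_set_bernoulli_rounding[OF finite_E]])
    fix b assume "b \<in> set_pmf ?P"
    then have b: "b e \<le> 1" for e using bernoulli_rounding_range[OF finite_E, of b p e] by auto
    have bb: "bounded_below n 0 (perturbed (- h) c b)"
      using perturbed_bounded_below_neg[of h c b] bounded_below_mono[of n "1 / 2" _ 0] h c1 b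
      by (auto simp: D_def)
    show "0 \<le> mat_trace ((perturbed (- h) c b) ^\<^sub>m Suc m)" by (rule mat_trace_pow_nonneg[OF bb])
    assume "b \<in> ?A"
    then obtain x where x: "x \<in> carrier_vec n" "z \<bullet> x = 0"
      "(\<Sum>e\<in>E. b e * (v e \<bullet> x)\<^sup>2) < (1 - \<epsilon>) * (x \<bullet> x)" by blast
    show "a ^ Suc m \<le> mat_trace ((perturbed (- h) c b) ^\<^sub>m Suc m)"
    proof (rule mat_trace_pow_ge[OF bb x(1)])
      show "x \<bullet> x \<noteq> 0"
      proof
        assume "x \<bullet> x = 0"
        then have "x = 0\<^sub>v n" using scalar_prod_self_eq_0[OF x(1)] by simp
        then have "(\<Sum>e\<in>E. b e * (v e \<bullet> x)\<^sup>2) = 0" using v_carrier by (intro sum.neutral) auto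
        then show False using x(3) \<open>x \<bullet> x = 0\<close> by simp
      qed
      have "h * (\<Sum>e\<in>E. b e * (v e \<bullet> x)\<^sup>2) \<le> h * ((1 - \<epsilon>) * (x \<bullet> x))"
        using h x(3) by (intro mult_left_mono) auto
      then show "a * (x \<bullet> x) \<le> x \<bullet> (perturbed (- h) c b *\<^sub>v x)"
        unfolding perturbed_form[OF x(1)] x(2) a_def by (simp add: left_diff_distrib mult.assoc)
    qed (use a in simp)
  qed (use a in simp)
  also have "\<dots> \<le> (real n * (1 - h * c) ^ Suc m) / a ^ Suc m"
    using expectation_trace_neg_le[OF h(1) h(2)[unfolded D_def] c_def] a by (intro divide_right_mono) auto
  also have "\<dots> = real n * ((1 - h * c) ^ Suc m / a ^ Suc m)" by simp
  also have "\<dots> \<le> real n * exp (- (real (Suc m) * (h * \<epsilon> / 2)))"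
  proof (intro mult_left_mono power_ratio_le_exp)
    have "h * c \<le> 1 / 2 * 1" using h c1 by (intro mult_mono) auto
    then show "0 \<le> 1 - h * c" by simp
    have "0 \<le> (h * \<epsilon> / 2) * (h * (1 - \<epsilon>))" using h \<epsilon> by simp
    moreover have "h * (1 - \<epsilon> / 2) \<le> h * c" using h c by (intro mult_left_mono)
    moreover have "(1 - h * \<epsilon> / 2) * a = 1 - h * (1 - \<epsilon> / 2) + (h * \<epsilon> / 2) * (h * (1 - \<epsilon>))"
      by (simp add: a_def field_simps)
    ultimately show "1 - h * c \<le> (1 - h * \<epsilon> / 2) * a" by linarith
  qed (use a in auto)
  also have "real (Suc m) * (h * \<epsilon> / 2) = \<theta> * \<epsilon> / 2"
    using h_eq by (simp del: of_nat_Suc)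
  also have "\<dots> = \<epsilon>\<^sup>2 / (8 * \<rho>)"
    using \<rho>_pos by (simp add: \<theta>_def power2_eq_square)
  also have "real n * exp (- (\<epsilon>\<^sup>2 / (8 * \<rho>))) \<le> real n * exp (- \<epsilon>\<^sup>2 / (16 * \<rho>))"
    using \<rho>_pos by (intro mult_left_mono) (auto simp: field_simps)
  finally show ?thesis .
qed

end

section \<open>Pseudoinverse and characteristic polynomial\<close>

text \<open>
  The functional calculus: if \<open>u\<close> is an eigenbasis of \<open>A\<close> with eigenvalues \<open>l\<close>, this is \<open>g(A)\<close> for
  every \<open>g\<close> with \<open>f i = g (l i)\<close>.
\<close>
definition spectral_mat ::
    "nat \<Rightarrow> (nat \<Rightarrow> real Matrix.vec) \<Rightarrow> (nat \<Rightarrow> real) \<Rightarrow> real Matrix.mat" where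
  "spectral_mat n u f = Matrix.mat n n (\<lambda>(a, b). \<Sum>i<n. f i * (u i $ a * u i $ b))"

lemma spectral_mat_carrier [simp]: "spectral_mat n u f \<in> carrier_mat n n"
  by (simp add: spectral_mat_def)

lemma spectral_mat_symmetric [simp]: "transpose_mat (spectral_mat n u f) = spectral_mat n u f"
  by (auto simp: spectral_mat_def mult.commute)

lemma spectral_mat_eigenbasis:
  assumes eb: "eigenbasis n A l u" and A: "A \<in> carrier_mat n n" "transpose_mat A = A"
  shows "spectral_mat n u l = A"
proof (rule eq_matI)
  fix a b assume "a < dim_row A" "b < dim_col A"
  then have ab: "a < n" "b < n" using A by auto
  have "A $$ (a, b) = unit_vec n a \<bullet> (A *\<^sub>v unit_vec n b)"
    using ab A by simp
  also have "\<dots> = (\<Sum>i<n. l i * ((u i \<bullet> unit_vec n a) * (u i \<bullet> unit_vec n b)))"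
    by (rule eigenbasis_form[OF eb A]) auto
  also have "\<dots> = (\<Sum>i<n. l i * (u i $ a * u i $ b))"
    using ab eigenbasis_carrier[OF eb] by (intro sum.cong refl) simp
  finally show "spectral_mat n u l $$ (a, b) = A $$ (a, b)"
    using ab by (simp add: spectral_mat_def)
qed (use A in \<open>auto simp: spectral_mat_def\<close>)

lemma spectral_mat_mult:
  assumes eb: "eigenbasis n A l u"
  shows "spectral_mat n u f * spectral_mat n u g = spectral_mat n u (\<lambda>i. f i * g i)"
proof (rule eq_matI)
  fix a b assume "a < dim_row (spectral_mat n u (\<lambda>i. f i * g i))"
    "b < dim_col (spectral_mat n u (\<lambda>i. f i * g i))"
  then have ab: "a < n" "b < n" by (auto simp: spectral_mat_def)
  have "(spectral_mat n u f * spectral_mat n u g) $$ (a, b)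
      = (\<Sum>c<n. (\<Sum>i<n. f i * (u i $ a * u i $ c)) * (\<Sum>j<n. g j * (u j $ c * u j $ b)))"
    using ab by (simp add: spectral_mat_def scalar_prod_def lessThan_atLeast0)
  also have "\<dots> = (\<Sum>c<n. \<Sum>i<n. \<Sum>j<n. (f i * g j * u i $ a * u j $ b) * (u i $ c * u j $ c))"
    unfolding sum_product by (simp add: mult_ac)
  also have "\<dots> = (\<Sum>i<n. \<Sum>c<n. \<Sum>j<n. (f i * g j * u i $ a * u j $ b) * (u i $ c * u j $ c))"
    by (rule sum.swap)
  also have "\<dots> = (\<Sum>i<n. \<Sum>j<n. \<Sum>c<n. (f i * g j * u i $ a * u j $ b) * (u i $ c * u j $ c))"
    by (intro sum.cong refl sum.swap)
  also have "\<dots> = (\<Sum>i<n. \<Sum>j<n. (f i * g j * u i $ a * u j $ b) * (u i \<bullet> u j))"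
    using eigenbasis_carrier[OF eb]
    by (intro sum.cong refl) (simp add: scalar_prod_lessThan[of _ n] sum_distrib_left)
  also have "\<dots> = (\<Sum>i<n. \<Sum>j<n. (f i * g j * u i $ a * u j $ b) * (if i = j then 1 else 0))"
    using eb by (intro sum.cong refl) (simp add: eigenbasis_def)
  also have "\<dots> = (\<Sum>i<n. f i * g i * u i $ a * u i $ b)"
    by (simp add: if_distrib cong: if_cong)
  finally show "(spectral_mat n u f * spectral_mat n u g) $$ (a, b)
      = spectral_mat n u (\<lambda>i. f i * g i) $$ (a, b)"
    using ab by (simp add: spectral_mat_def mult_ac)
qed (auto simp: spectral_mat_def)

lemma spectral_mat_mult_vec:
  assumes eb: "eigenbasis n A l u" and x: "x \<in> carrier_vec n" and a: "a < n"
  shows "(spectral_mat n u f *\<^sub>v x) $ a = (\<Sum>i<n. f i * u i $ a * (u i \<bullet> x))"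
proof -
  have "(spectral_mat n u f *\<^sub>v x) $ a = (\<Sum>b<n. \<Sum>i<n. f i * u i $ a * (u i $ b * x $ b))"
    using a x by (simp add: spectral_mat_def scalar_prod_def lessThan_atLeast0 sum_distrib_left mult_ac)
  also have "\<dots> = (\<Sum>i<n. \<Sum>b<n. f i * u i $ a * (u i $ b * x $ b))" by (rule sum.swap)
  finally show ?thesis using x by (simp add: scalar_prod_lessThan[of _ n] sum_distrib_left)
qed

text \<open>
  Two solutions \<open>X\<close> and \<open>Y\<close> of the Penrose equations have the same products \<open>A X = A Y\<close> and
  \<open>X A = Y A\<close>, since these are symmetric idempotents with the same range, respectively kernel;
  then \<open>X = X A X = Y A Y = Y\<close>.
\<close>
lemma pinv_eqI:
  assumes A: "A \<in> carrier_mat n n" and X: "X \<in> carrier_mat n n"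
    and 1: "A * X * A = A" and 2: "X * A * X = X"
    and 3: "transpose_mat (A * X) = A * X" and 4: "transpose_mat (X * A) = X * A"
  shows "pinv A = X"
  unfolding pinv_def
proof (rule the_equality)
  show "X \<in> carrier_mat (dim_col A) (dim_row A) \<and> A * X * A = A \<and> X * A * X = X \<and>
     transpose_mat (A * X) = A * X \<and> transpose_mat (X * A) = X * A"
    using assms by auto
  fix Y assume "Y \<in> carrier_mat (dim_col A) (dim_row A) \<and> A * Y * A = A \<and> Y * A * Y = Y \<and>
     transpose_mat (A * Y) = A * Y \<and> transpose_mat (Y * A) = Y * A"
  then have Y: "Y \<in> carrier_mat n n" "A * Y * A = A" "Y * A * Y = Y"
    "transpose_mat (A * Y) = A * Y" "transpose_mat (Y * A) = Y * A" using A by auto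
  note assoc = assoc_mult_mat[of _ n n _ n _ n]
  have AX: "A * X \<in> carrier_mat n n" and AY: "A * Y \<in> carrier_mat n n"
    and XA: "X * A \<in> carrier_mat n n" and YA: "Y * A \<in> carrier_mat n n" using A X Y by auto
  have "A * X = (A * Y * A) * X" using Y by simp
  also have "\<dots> = (A * Y) * (A * X)" using A X Y(1) by (simp add: assoc)
  also have "\<dots> = transpose_mat ((A * X) * (A * Y))"
    using transpose_mult[OF AX AY] 3 Y by simp
  also have "(A * X) * (A * Y) = (A * X * A) * Y" using A X Y(1) by (simp add: assoc)
  also have "transpose_mat \<dots> = A * Y" using 1 Y by simp
  finally have e1: "A * X = A * Y" .
  have "X * A = X * (A * Y * A)" using Y by simp
  also have "\<dots> = (X * A) * (Y * A)" using A X Y(1) by (simp add: assoc)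
  also have "\<dots> = transpose_mat ((Y * A) * (X * A))"
    using transpose_mult[OF YA XA] 4 Y by simp
  also have "(Y * A) * (X * A) = Y * (A * X * A)" using A X Y(1) by (simp add: assoc)
  also have "transpose_mat \<dots> = Y * A" using 1 Y by simp
  finally have e2: "X * A = Y * A" .
  have "X = X * (A * X)" using 2 A X by (simp add: assoc)
  also have "\<dots> = (X * A) * Y" unfolding e1 using A X Y(1) by (simp add: assoc)
  also have "\<dots> = Y" unfolding e2 using Y by simp
  finally show "Y = X" by simp
qed

text \<open>
  The convention \<open>inverse 0 = 0\<close> is exactly what the pseudoinverse does on the kernel.
\<close>
lemma pinv_eigenbasis:
  assumes eb: "eigenbasis n A l u" and A: "A \<in> carrier_mat n n" "transpose_mat A = A"
  shows "pinv A = spectral_mat n u (\<lambda>i. inverse (l i))"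
proof (rule pinv_eqI[OF A(1)])
  note A_eq = spectral_mat_eigenbasis[OF eb A, symmetric]
  note mult = spectral_mat_mult[OF eb]
  have e: "l i * inverse (l i) * l i = l i" "inverse (l i) * l i * inverse (l i) = inverse (l i)" for i
    by (cases "l i = 0"; simp)+
  show "A * spectral_mat n u (\<lambda>i. inverse (l i)) * A = A"
    by (subst (1 2 3) A_eq) (simp only: mult e)
  show "spectral_mat n u (\<lambda>i. inverse (l i)) * A * spectral_mat n u (\<lambda>i. inverse (l i))
      = spectral_mat n u (\<lambda>i. inverse (l i))"
    by (subst A_eq) (simp only: mult e)
  show "transpose_mat (A * spectral_mat n u (\<lambda>i. inverse (l i))) = A * spectral_mat n u (\<lambda>i. inverse (l i))"
    by (subst (1 2) A_eq) (simp only: mult spectral_mat_symmetric)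
  show "transpose_mat (spectral_mat n u (\<lambda>i. inverse (l i)) * A) = spectral_mat n u (\<lambda>i. inverse (l i)) * A"
    by (subst (1 2) A_eq) (simp only: mult spectral_mat_symmetric)
qed simp

lemma proots_char_poly_eigenbasis:
  assumes eb: "eigenbasis n A l u" and A: "A \<in> carrier_mat n n" "transpose_mat A = A"
  shows "proots (char_poly A) = image_mset l (mset_set {..<n})"
proof -
  define U where "U = Matrix.mat n n (\<lambda>(a, i). u i $ a)"
  define D where "D = mat_diag n l"
  have U: "U \<in> carrier_mat n n" and D: "D \<in> carrier_mat n n" by (simp_all add: U_def D_def)
  have UU: "U * transpose_mat U = 1\<^sub>m n"
    using eigenbasis_complete[OF eb] by (intro eq_matI) (auto simp: U_def scalar_prod_def lessThan_atLeast0)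
  then have UU': "transpose_mat U * U = 1\<^sub>m n"
    using mat_mult_left_right_inverse[OF U _ UU] U by simp
  have "A = U * D * transpose_mat U"
  proof -
    have "U * D = Matrix.mat n n (\<lambda>(a, i). l i * u i $ a)"
      unfolding D_def mat_diag_mult_right[OF U] by (auto simp: U_def mult.commute)
    then have "U * D * transpose_mat U = spectral_mat n u l"
      by (auto simp: U_def spectral_mat_def scalar_prod_def lessThan_atLeast0 mult.assoc)
    then show ?thesis using spectral_mat_eigenbasis[OF eb A] by simp
  qed
  then have "similar_mat A D"
    using A U D UU UU' by (intro similar_matI[of A D U "transpose_mat U" n]) auto
  then have "char_poly A = char_poly D" by (rule char_poly_similar)
  also have "\<dots> = (\<Prod>a\<leftarrow>diag_mat D. [:- a, 1:])"
    by (rule char_poly_upper_triangular[OF D]) (auto simp: D_def mat_diag_def upper_triangular_def)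
  also have "diag_mat D = map l [0..<n]"
    by (simp add: D_def mat_diag_def diag_mat_def)
  finally have cp: "char_poly A = (\<Prod>a\<leftarrow>map l [0..<n]. [:- a, 1:])" .
  have pr: "proots (\<Prod>a\<leftarrow>xs. [:- a, 1:]) = mset xs" for xs :: "real list"
  proof (induction xs)
    case (Cons a xs)
    have "(\<Prod>a\<leftarrow>xs. [:- a, 1:]) \<noteq> 0" by (auto simp: prod_list_zero_iff)
    then have "proots ([:- a, 1:] * (\<Prod>a\<leftarrow>xs. [:- a, 1:])) = proots [:- a, 1:] + proots (\<Prod>a\<leftarrow>xs. [:- a, 1:])"
      by (intro proots_mult) auto
    then show ?case using Cons by simp
  qed simp
  show ?thesis unfolding cp pr by (simp add: lessThan_atLeast0)
qed

section \<open>Spectrum and energy of connected Laplacians\<close>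

text \<open>
  The spectral content of connectivity, without reference to a graph: the kernel is the line of
  constant vectors, and the quadratic form is positive on its orthogonal complement.
\<close>
definition connected_laplacian :: "nat \<Rightarrow> real Matrix.mat \<Rightarrow> bool" where
  "connected_laplacian n M \<longleftrightarrow> M \<in> carrier_mat n n \<and> transpose_mat M = M \<and>
     M *\<^sub>v Matrix.vec n (\<lambda>_. 1) = 0\<^sub>v n \<and>
     (\<forall>x\<in>ones_perp n. x \<noteq> 0\<^sub>v n \<longrightarrow> 0 < x \<bullet> (M *\<^sub>v x))"

lemma sorted_list_of_multiset_nth_1:
  fixes R :: "real multiset"
  assumes "R \<noteq> {#}" and "\<And>y. y \<in># R \<Longrightarrow> x \<le> y"
  shows "sorted_list_of_multiset (add_mset x R) ! 1 \<in># R"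
    and "y \<in># R \<Longrightarrow> sorted_list_of_multiset (add_mset x R) ! 1 \<le> y"
proof -
  define zs where "zs = sorted_list_of_multiset R"
  have zs: "set zs = set_mset R" "sorted zs" by (simp_all add: zs_def)
  have ne: "zs \<noteq> []" using assms(1) zs(1) by auto
  have "sorted_list_of_multiset (add_mset x R) = x # zs"
    using assms(2) zs(1) by (simp add: zs_def insort_is_Cons)
  then have eq: "sorted_list_of_multiset (add_mset x R) ! 1 = hd zs"
    using ne by (simp add: hd_conv_nth)
  show "sorted_list_of_multiset (add_mset x R) ! 1 \<in># R"
    unfolding eq using hd_in_set[OF ne] zs(1) by simp
  show "sorted_list_of_multiset (add_mset x R) ! 1 \<le> y" if "y \<in># R"
  proof -
    have "y \<in> set zs" using zs(1) that by simp
    then show ?thesis unfolding eq using zs(2) by (cases zs) auto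
  qed
qed

text \<open>
  Exactly one eigenvector \<open>u\<^sub>k\<close> fails to be orthogonal to the constant vector. Each such
  eigenvector has eigenvalue 0, and two of them would have a nonzero combination in the kernel
  that is orthogonal to the constant vector. The remaining eigenvalues are positive, so the
  second-smallest one is their minimum.
\<close>
lemma connected_laplacian_eigenbasis:
  assumes M: "connected_laplacian n M" and n: "2 \<le> n"
  obtains l u k where "eigenbasis n M l u" "k < n" "l k = 0"
    "\<And>x. x \<in> ones_perp n \<Longrightarrow> u k \<bullet> x = 0"
    "\<And>i. i < n \<Longrightarrow> i \<noteq> k \<Longrightarrow> u i \<in> ones_perp n"
    "\<And>i. i < n \<Longrightarrow> i \<noteq> k \<Longrightarrow> lambda2 M \<le> l i" "0 < lambda2 M"
proof -
  have Mc: "M \<in> carrier_mat n n" "transpose_mat M = M" using M by (auto simp: connected_laplacian_def)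
  define o1 :: "real Matrix.vec" where "o1 = Matrix.vec n (\<lambda>_. 1)"
  have o1: "o1 \<in> carrier_vec n" and Mo: "M *\<^sub>v o1 = 0\<^sub>v n"
    using M by (simp_all add: o1_def connected_laplacian_def)
  have perp: "x \<in> ones_perp n \<longleftrightarrow> x \<in> carrier_vec n \<and> x \<bullet> o1 = 0" for x
    by (simp add: ones_perp_def o1_def)
  have pos: "0 < x \<bullet> (M *\<^sub>v x)" if "x \<in> carrier_vec n" "x \<bullet> o1 = 0" "x \<noteq> 0\<^sub>v n" for x
    using M that by (auto simp: connected_laplacian_def perp)
  obtain l u where eb: "eigenbasis n M l u" using symmetric_mat_eigenbasis[OF Mc] by blast
  note uc = eigenbasis_carrier[OF eb]
  have Mu: "M *\<^sub>v u i = l i \<cdot>\<^sub>v u i" if "i < n" for i using eb that by (simp add: eigenbasis_def)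
  have unz: "u i \<noteq> 0\<^sub>v n" if "i < n" for i
  proof
    assume "u i = 0\<^sub>v n"
    then show False using eigenbasis_norm[OF eb that] by simp
  qed
  have lo: "l i * (u i \<bullet> o1) = 0" if "i < n" for i
  proof -
    have "(M *\<^sub>v u i) \<bullet> o1 = u i \<bullet> (M *\<^sub>v o1)" by (rule symmetric_mat_scalar_prod[OF Mc uc[OF that] o1])
    then show ?thesis using Mu[OF that] uc[OF that] o1 Mo by simp
  qed
  have lpos: "0 < l i" if "i < n" "u i \<bullet> o1 = 0" for i
    using pos[OF uc[OF that(1)] that(2) unz[OF that(1)]] Mu[OF that(1)] eigenbasis_norm[OF eb that(1)]
      uc[OF that(1)] by simp
  have "o1 \<bullet> o1 = real n" by (simp add: o1_def scalar_prod_def)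
  then have "(\<Sum>i<n. (u i \<bullet> o1) * (u i \<bullet> o1)) = real n"
    using eigenbasis_parseval[OF eb o1 o1] by simp
  then have "\<exists>k<n. u k \<bullet> o1 \<noteq> 0"
    using n by (metis (no_types, lifting) lessThan_iff mult_zero_left not_numeral_le_zero of_nat_eq_0_iff sum.neutral)
  then obtain k where k: "k < n" "u k \<bullet> o1 \<noteq> 0" by blast
  have lk: "l k = 0" using lo[OF k(1)] k(2) by simp
  have other: "u i \<bullet> o1 = 0" if "i < n" "i \<noteq> k" for i
  proof (rule ccontr)
    assume i: "u i \<bullet> o1 \<noteq> 0"
    then have li: "l i = 0" using lo[OF that(1)] by simp
    define y where "y = (u k \<bullet> o1) \<cdot>\<^sub>v u i - (u i \<bullet> o1) \<cdot>\<^sub>v u k"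
    have yc: "y \<in> carrier_vec n" using uc that k by (simp add: y_def)
    have "y \<bullet> o1 = 0" unfolding y_def
      using uc[OF that(1)] uc[OF k(1)] o1 by (simp add: minus_scalar_prod_distrib[of _ n])
    moreover have "u i \<bullet> y = u k \<bullet> o1"
    proof -
      have "u i \<bullet> u k = 0" using eb that k by (simp add: eigenbasis_def)
      then show ?thesis using uc[OF that(1)] uc[OF k(1)] eigenbasis_norm[OF eb that(1)]
        by (simp add: y_def scalar_prod_minus_distrib[of _ n])
    qed
    then have "y \<noteq> 0\<^sub>v n" using k uc[OF that(1)] by auto
    ultimately have "0 < y \<bullet> (M *\<^sub>v y)" by (intro pos yc)
    moreover have "M *\<^sub>v y = 0\<^sub>v n" 
      using uc[OF that(1)] uc[OF k(1)] Mc Mu[OF that(1)] Mu[OF k(1)]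
      by (simp add: y_def mult_minus_distrib_mat_vec[of _ n n] mult_mat_vec[of _ n n] li lk)
        (auto simp: vec_eq_iff)
    ultimately show False using yc by simp
  qed
  have uk: "u k \<bullet> x = 0" if "x \<in> ones_perp n" for x
  proof -
    have x: "x \<in> carrier_vec n" "x \<bullet> o1 = 0" using that by (auto simp: perp)
    have "(\<Sum>i<n. (u i \<bullet> x) * (u i \<bullet> o1)) = (\<Sum>i\<in>{k}. (u i \<bullet> x) * (u i \<bullet> o1))"
      using k other by (intro sum.mono_neutral_right) auto
    then show ?thesis using eigenbasis_parseval[OF eb x(1) o1] x(2) k by simp
  qed
  define R where "R = image_mset l (mset_set ({..<n} - {k}))"
  have "mset_set {..<n} = add_mset k (mset_set ({..<n} - {k}))"
    using k mset_set.remove[of "{..<n}" k] by simp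
  then have L2: "lambda2 M = sorted_list_of_multiset (add_mset 0 R) ! 1"
    unfolding lambda2_def proots_char_poly_eigenbasis[OF eb Mc] by (simp add: R_def lk)
  have "card ({..<n} - {k}) \<noteq> 0" using n k by simp
  then have R: "R \<noteq> {#}" unfolding R_def
    by (metis card.empty image_mset_is_empty_iff finite_Diff finite_lessThan mset_set_empty_iff)
  have Rpos: "0 < y" if "y \<in># R" for y using that lpos other by (auto simp: R_def)
  note nth1 = sorted_list_of_multiset_nth_1[OF R less_imp_le[OF Rpos], folded L2]
  show thesis
  proof (rule that[OF eb k(1) lk uk])
    show "u i \<in> ones_perp n" if "i < n" "i \<noteq> k" for i using uc other that by (simp add: perp)
    show "lambda2 M \<le> l i" if "i < n" "i \<noteq> k" for i
      by (rule nth1(2)) (use that in \<open>auto simp: R_def\<close>)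
    show "0 < lambda2 M" using nth1(1) Rpos by blast
  qed
qed

lemma pinv_connected_laplacian:
  assumes M: "connected_laplacian n M" and n: "2 \<le> n" and d: "d \<in> ones_perp n"
  shows "pinv M *\<^sub>v d \<in> ones_perp n" "M *\<^sub>v (pinv M *\<^sub>v d) = d"
proof -
  have Mc: "M \<in> carrier_mat n n" "transpose_mat M = M" using M by (auto simp: connected_laplacian_def)
  obtain l u k where eb: "eigenbasis n M l u" and k: "k < n" "l k = 0"
    and uk: "\<And>x. x \<in> ones_perp n \<Longrightarrow> u k \<bullet> x = 0"
    and up: "\<And>i. i < n \<Longrightarrow> i \<noteq> k \<Longrightarrow> u i \<in> ones_perp n"
    and l: "\<And>i. i < n \<Longrightarrow> i \<noteq> k \<Longrightarrow> lambda2 M \<le> l i" "0 < lambda2 M"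
    using connected_laplacian_eigenbasis[OF M n] by metis
  define X where "X = spectral_mat n u (\<lambda>i. inverse (l i))"
  have X: "pinv M = X" unfolding X_def by (rule pinv_eigenbasis[OF eb Mc])
  have dc: "d \<in> carrier_vec n" using d by (simp add: ones_perp_def)
  have Xd: "X *\<^sub>v d \<in> carrier_vec n"
    unfolding X_def using dc by (intro mult_mat_vec_carrier[OF spectral_mat_carrier])
  have MX: "M * X = spectral_mat n u (\<lambda>i. l i * inverse (l i))"
    unfolding X_def spectral_mat_mult[OF eb, symmetric] spectral_mat_eigenbasis[OF eb Mc] ..
  have Xc: "X \<in> carrier_mat n n" by (simp add: X_def)
  have MXd: "M *\<^sub>v (X *\<^sub>v d) = (M * X) *\<^sub>v d"
    using Mc Xc dc by (simp add: assoc_mult_mat_vec[of _ n n _ n])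
  show "M *\<^sub>v (pinv M *\<^sub>v d) = d"
    unfolding X MXd MX
  proof (rule eq_vecI)
    fix a assume "a < dim_vec d"
    then have a: "a < n" using dc by simp
    have "(spectral_mat n u (\<lambda>i. l i * inverse (l i)) *\<^sub>v d) $ a
        = (\<Sum>i<n. l i * inverse (l i) * u i $ a * (u i \<bullet> d))"
      by (rule spectral_mat_mult_vec[OF eb dc a])
    also have "\<dots> = (\<Sum>i<n. (u i \<bullet> unit_vec n a) * (u i \<bullet> d))"
    proof (intro sum.cong refl)
      fix i assume i: "i \<in> {..<n}"
      have "u i \<bullet> unit_vec n a = u i $ a" using a eigenbasis_carrier[OF eb] i by simp
      moreover have "l i * inverse (l i) = 1 \<or> u i \<bullet> d = 0"
        using l(1)[of i] l(2) uk[OF d] i by (cases "i = k") auto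
      ultimately show "l i * inverse (l i) * u i $ a * (u i \<bullet> d) = (u i \<bullet> unit_vec n a) * (u i \<bullet> d)"
        by auto
    qed
    also have "\<dots> = unit_vec n a \<bullet> d" using eigenbasis_parseval[OF eb _ dc, of "unit_vec n a"] by simp
    also have "\<dots> = d $ a" using a dc by simp
    finally show "(spectral_mat n u (\<lambda>i. l i * inverse (l i)) *\<^sub>v d) $ a = d $ a" .
  qed (use dc in \<open>simp add: spectral_mat_def\<close>)
  define o1 :: "real Matrix.vec" where "o1 = Matrix.vec n (\<lambda>_. 1)"
  have o1: "o1 \<in> carrier_vec n" by (simp add: o1_def)
  have perp: "x \<in> ones_perp n \<longleftrightarrow> x \<in> carrier_vec n \<and> x \<bullet> o1 = 0" for x
    by (simp add: ones_perp_def o1_def)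
  have "(X *\<^sub>v d) \<bullet> o1 = o1 \<bullet> (X *\<^sub>v d)" using comm_scalar_prod[OF Xd o1] .
  also have "\<dots> = (\<Sum>a<n. \<Sum>i<n. inverse (l i) * u i $ a * (u i \<bullet> d))"
    using Xd by (simp add: scalar_prod_lessThan[of _ n] o1_def X_def
        spectral_mat_mult_vec[OF eb dc] del: index_mult_mat_vec)
  also have "\<dots> = (\<Sum>i<n. \<Sum>a<n. inverse (l i) * u i $ a * (u i \<bullet> d))" by (rule sum.swap)
  also have "\<dots> = (\<Sum>i<n. inverse (l i) * (u i \<bullet> o1) * (u i \<bullet> d))"
    using o1 by (simp add: scalar_prod_lessThan[of _ n] o1_def sum_distrib_left sum_distrib_right)
  also have "\<dots> = 0"
    using up k(2) by (intro sum.neutral) (auto simp: perp)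
  finally show "pinv M *\<^sub>v d \<in> ones_perp n" unfolding X perp using Xd by simp
qed

text \<open>
  With \<open>x = P\<^sup>\<dagger> d\<close> and \<open>y = Q\<^sup>\<dagger> d\<close>, evaluate the nonnegative form of \<open>P\<close> at \<open>x - y / \<alpha>\<close>. Both
  mixed terms are multiples of \<open>y \<bullet> d\<close> because \<open>P x = d\<close>, and the last term is at most \<open>y \<bullet> d / \<alpha>\<close>
  because \<open>Q y = d\<close>.
\<close>
lemma pinv_energy_antimono:
  assumes P: "connected_laplacian n P" and Q: "connected_laplacian n Q" and n: "2 \<le> n"
    and \<alpha>: "0 < \<alpha>" and le: "\<And>x. x \<in> ones_perp n \<Longrightarrow> x \<bullet> (P *\<^sub>v x) \<le> \<alpha> * (x \<bullet> (Q *\<^sub>v x))"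
    and d: "d \<in> ones_perp n"
  shows "d \<bullet> (pinv Q *\<^sub>v d) \<le> \<alpha> * (d \<bullet> (pinv P *\<^sub>v d))"
proof -
  define x y where "x = pinv P *\<^sub>v d" and "y = pinv Q *\<^sub>v d"
  have x: "x \<in> ones_perp n" "P *\<^sub>v x = d" and y: "y \<in> ones_perp n" "Q *\<^sub>v y = d"
    unfolding x_def y_def using pinv_connected_laplacian[OF P n d] pinv_connected_laplacian[OF Q n d] by auto
  have c: "x \<in> carrier_vec n" "y \<in> carrier_vec n" "d \<in> carrier_vec n"
    using x y d by (auto simp: ones_perp_def)
  have Pc: "P \<in> carrier_mat n n" "transpose_mat P = P" using P by (auto simp: connected_laplacian_def)
  have Py: "P *\<^sub>v y \<in> carrier_vec n" using Pc c by simp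
  \<comment> \<open>The minimiser of the quadratic polynomial that bounds the form at \<open>x - s y\<close>.\<close>
  define s where "s = 1 / \<alpha>"
  define r where "r = x - s \<cdot>\<^sub>v y"
  have r: "r \<in> ones_perp n"
    using x y c by (simp add: r_def ones_perp_def minus_scalar_prod_distrib[of _ n])
  have "0 \<le> r \<bullet> (P *\<^sub>v r)"
  proof (cases "r = 0\<^sub>v n")
    case True
    then show ?thesis using Pc by (simp add: scalar_prod_left_zero mult_mat_vec_carrier)
  next
    case False
    then show ?thesis using P r by (auto simp: connected_laplacian_def intro: less_imp_le)
  qed
  also have "P *\<^sub>v r = d - s \<cdot>\<^sub>v (P *\<^sub>v y)"
    using Pc c x(2) by (simp add: r_def mult_minus_distrib_mat_vec[of _ n n] mult_mat_vec[of _ n n])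
  also have "r \<bullet> (d - s \<cdot>\<^sub>v (P *\<^sub>v y))
      = x \<bullet> d - s * (x \<bullet> (P *\<^sub>v y)) - s * (y \<bullet> d) + s\<^sup>2 * (y \<bullet> (P *\<^sub>v y))"
    using c Py by (simp add: r_def minus_scalar_prod_distrib[of _ n] scalar_prod_minus_distrib[of _ n]
        power2_eq_square algebra_simps)
  also have "x \<bullet> (P *\<^sub>v y) = y \<bullet> d"
    using symmetric_mat_scalar_prod[OF Pc c(1,2)] x(2) comm_scalar_prod[OF c(3,2)] by simp
  also have "s\<^sup>2 * (y \<bullet> (P *\<^sub>v y)) \<le> s\<^sup>2 * (\<alpha> * (y \<bullet> d))"
    using le[OF y(1)] y(2) by (intro mult_left_mono) auto
  also have "s\<^sup>2 * (\<alpha> * (y \<bullet> d)) = s * (y \<bullet> d)" using \<alpha> by (simp add: s_def power2_eq_square)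
  finally have "(1 / \<alpha>) * (y \<bullet> d) \<le> x \<bullet> d" by (simp add: s_def)
  then have "y \<bullet> d \<le> \<alpha> * (x \<bullet> d)" using \<alpha> by (simp add: field_simps)
  then show ?thesis
    using comm_scalar_prod[OF c(3,1)] comm_scalar_prod[OF c(3,2)] by (simp add: x_def y_def)
qed

section \<open>Laplacians of multigraphs\<close>

lemma switched_laplacian_carrier [simp]: "switched_laplacian n G w s \<in> carrier_mat n n"
  by (simp add: switched_laplacian_def)

lemma switched_laplacian_symmetric [simp]:
  "transpose_mat (switched_laplacian n G w s) = switched_laplacian n G w s"
  by (auto simp: switched_laplacian_def mult.commute)

lemma incidence_vec_carrier [simp]: "incidence_vec n G e \<in> carrier_vec n"
  by (simp add: incidence_vec_def)

lemma switched_laplacian_form: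
  assumes x: "x \<in> carrier_vec n"
  shows "x \<bullet> (switched_laplacian n G w s *\<^sub>v x) = (\<Sum>e\<in>arcs G. s e * w e * (incidence_vec n G e \<bullet> x)\<^sup>2)"
proof -
  let ?a = "incidence_vec n G"
  have "x \<bullet> (switched_laplacian n G w s *\<^sub>v x)
      = (\<Sum>i<n. \<Sum>j<n. \<Sum>e\<in>arcs G. s e * w e * (x $ i * x $ j * (?a e $ i * ?a e $ j)))"
    using x by (simp add: scalar_prod_lessThan[of _ n] switched_laplacian_def sum_distrib_left
        sum_distrib_right mult_mat_vec_def scalar_prod_def lessThan_atLeast0 mult_ac)
  also have "\<dots> = (\<Sum>e\<in>arcs G. \<Sum>i<n. \<Sum>j<n. s e * w e * (x $ i * x $ j * (?a e $ i * ?a e $ j)))"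
    by (subst sum.swap[of _ "arcs G"], subst sum.swap[of _ "arcs G"], rule refl)
  also have "\<dots> = (\<Sum>e\<in>arcs G. s e * w e * (?a e \<bullet> x)\<^sup>2)"
    using x by (simp add: scalar_prod_lessThan[of _ n] power2_eq_square sum_product sum_distrib_left mult_ac)
  finally show ?thesis .
qed

lemma incidence_vec_scalar_prod:
  assumes "fin_digraph G" "verts G = {..<n}" "e \<in> arcs G" "x \<in> carrier_vec n"
  shows "incidence_vec n G e \<bullet> x = x $ tail G e - x $ head G e"
proof -
  interpret fin_digraph G by fact
  have "tail G e < n" "head G e < n"
    using tail_in_verts[OF assms(3)] head_in_verts[OF assms(3)] assms(2) by auto
  then show ?thesis
    using assms(4) by (simp add: incidence_vec_def minus_scalar_prod_distrib[of _ n])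
qed

lemma incidence_vec_norm_le:
  assumes "fin_digraph G" "verts G = {..<n}" "e \<in> arcs G"
  shows "incidence_vec n G e \<bullet> incidence_vec n G e \<le> 2"
proof -
  interpret fin_digraph G by fact
  have "tail G e < n" "head G e < n"
    using tail_in_verts[OF assms(3)] head_in_verts[OF assms(3)] assms(2) by auto
  then show ?thesis
    unfolding incidence_vec_scalar_prod[OF assms incidence_vec_carrier]
    by (auto simp: incidence_vec_def)
qed

lemma switched_laplacian_ones:
  assumes "fin_digraph G" "verts G = {..<n}"
  shows "switched_laplacian n G w s *\<^sub>v Matrix.vec n (\<lambda>_. 1) = 0\<^sub>v n"
proof (rule eq_vecI)
  fix i assume "i < dim_vec (0\<^sub>v n :: real Matrix.vec)"
  then have i: "i < n" by simp
  let ?a = "incidence_vec n G"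
  interpret fin_digraph G by fact
  have "(switched_laplacian n G w s *\<^sub>v Matrix.vec n (\<lambda>_. 1)) $ i
      = (\<Sum>j<n. \<Sum>e\<in>arcs G. s e * w e * (?a e $ i * ?a e $ j))"
    using i by (simp add: switched_laplacian_def scalar_prod_def lessThan_atLeast0)
  also have "\<dots> = (\<Sum>e\<in>arcs G. \<Sum>j<n. s e * w e * (?a e $ i * ?a e $ j))" by (rule sum.swap)
  also have "\<dots> = (\<Sum>e\<in>arcs G. s e * w e * ?a e $ i * (?a e \<bullet> Matrix.vec n (\<lambda>_. 1)))"
    by (simp add: scalar_prod_lessThan[of _ n] sum_distrib_left mult_ac)
  also have "\<dots> = 0"
    using tail_in_verts head_in_verts assms(2)
    by (intro sum.neutral ballI) (simp add: incidence_vec_scalar_prod[OF assms])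
  finally show "(switched_laplacian n G w s *\<^sub>v Matrix.vec n (\<lambda>_. 1)) $ i = 0\<^sub>v n $ i"
    using i by simp
qed (simp add: switched_laplacian_def)

lemma connected_backbone_constant:
  assumes "connected_backbone G T" and "\<And>e. e \<in> T \<Longrightarrow> f (tail G e) = f (head G e)"
    and "u \<in> verts G" "v \<in> verts G"
  shows "f u = f v"
proof -
  let ?S = "with_proj (mk_symmetric (G\<lparr>arcs := T\<rparr>))"
  have "(u, v) \<in> (arcs_ends ?S)\<^sup>*"
    using assms(1,3,4)
    by (intro reachable_rtranclI)
      (auto simp: connected_backbone_def connected_def strongly_connected_def mk_symmetric_def with_proj_def)
  then show ?thesis
  proof (induction rule: rtrancl_induct)
    case (step x y)
    have "\<exists>e\<in>T. (x = tail G e \<and> y = head G e) \<or> (x = head G e \<and> y = tail G e)"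
      using step(2) by (auto simp: mk_symmetric_def with_proj_def arcs_ends_def arc_to_ends_def)
    then show ?case using step(3) assms(2) by auto
  qed simp
qed

text \<open>
  If the form vanishes at \<open>x\<close>, then \<open>x\<close> takes the same value at both ends of every backbone edge,
  hence is constant; being orthogonal to the constant vector, it is zero.
\<close>
lemma connected_laplacian_switched:
  assumes G: "fin_digraph G" "verts G = {..<n}" and w: "\<And>e. e \<in> arcs G \<Longrightarrow> 0 < w e"
    and T: "connected_backbone G T" and n: "0 < n"
    and s: "\<And>e. e \<in> arcs G \<Longrightarrow> 0 \<le> s e" "\<And>e. e \<in> T \<Longrightarrow> 0 < s e"
  shows "connected_laplacian n (switched_laplacian n G w s)"
  unfolding connected_laplacian_def
proof (intro conjI switched_laplacian_carrier switched_laplacian_symmetric switched_laplacian_ones[OF G]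
    ballI impI)
  fix x assume x: "x \<in> ones_perp n" "x \<noteq> 0\<^sub>v n"
  interpret fin_digraph G by fact
  have xc: "x \<in> carrier_vec n" using x by (simp add: ones_perp_def)
  have TG: "T \<subseteq> arcs G" using T by (simp add: connected_backbone_def)
  let ?t = "\<lambda>e. s e * w e * (incidence_vec n G e \<bullet> x)\<^sup>2"
  have t: "0 \<le> ?t e" if "e \<in> arcs G" for e using s(1)[OF that] w[OF that] by simp
  have "(\<Sum>e\<in>arcs G. ?t e) \<noteq> 0"
  proof
    assume "(\<Sum>e\<in>arcs G. ?t e) = 0"
    then have z: "?t e = 0" if "e \<in> arcs G" for e
      using sum_nonneg_eq_0_iff[OF finite_arcs t] that by auto
    have "x $ tail G e = x $ head G e" if "e \<in> T" for e
    proof -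
      have e: "e \<in> arcs G" using that TG by auto
      have "incidence_vec n G e \<bullet> x = 0" using z[OF e] s(2)[OF that] w[OF e] by simp
      then show ?thesis unfolding incidence_vec_scalar_prod[OF G e xc] by simp
    qed
    then have const: "x $ i = x $ 0" if "i < n" for i
      using connected_backbone_constant[OF T, of "($) x" i 0] that n G(2) by simp
    have "0 = (\<Sum>i<n. x $ i)"
      using x(1) by (simp add: ones_perp_def scalar_prod_lessThan[of _ n])
    also have "\<dots> = (\<Sum>i<n. x $ 0)" by (intro sum.cong refl) (rule const, simp)
    finally have "x $ 0 = 0" using n by simp
    then have "x $ i = 0" if "i < n" for i using const[OF that] by simp
    then have "x = 0\<^sub>v n" using xc by (intro eq_vecI) auto
    then show False using x(2) by simp
  qed
  moreover have "0 \<le> (\<Sum>e\<in>arcs G. ?t e)" using t by (intro sum_nonneg)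
  ultimately show "0 < x \<bullet> (switched_laplacian n G w s *\<^sub>v x)"
    unfolding switched_laplacian_form[OF xc] by linarith
qed

section \<open>Feasibility of the Frank--Wolfe iterates\<close>

lemma fw_iterate_feasible:
  assumes "fw_iterate E f (feasible_set E T q) t s"
  shows "(\<forall>e\<in>E. 0 \<le> s e \<and> s e \<le> 1) \<and> (\<forall>e\<in>T. s e = 1)"
  using assms
proof (induction rule: fw_iterate.induct)
  case (init s)
  then show ?case by (simp add: feasible_set_def)
next
  case (step t s g v \<eta>)
  have \<eta>: "0 \<le> \<eta>" "\<eta> \<le> 1" using step.hyps by auto
  have v: "\<forall>e\<in>E. 0 \<le> v e \<and> v e \<le> 1" "\<forall>e\<in>T. v e = 1"
    using step.hyps by (auto simp: feasible_set_def)
  have "(1 - \<eta>) * s e + \<eta> * v e \<le> 1" if "e \<in> E" for e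
  proof -
    have "(1 - \<eta>) * s e + \<eta> * v e \<le> (1 - \<eta>) * 1 + \<eta> * 1"
      using step.IH v that \<eta> by (intro add_mono mult_left_mono) auto
    then show ?thesis by simp
  qed
  then show ?case using step.IH v \<eta> by (auto simp: add_nonneg_nonneg)
qed

section \<open>Concentration of the rounded Laplacian\<close>

text \<open>
  In an eigenbasis of the Laplacian of \<open>p\<close>, divide the coordinates of \<open>\<surd>w\<^sub>e a\<^sub>e\<close> by the square
  roots of the eigenvalues, where the eigenvalue 0 of the constant direction is replaced by 1;
  that direction becomes \<open>z\<close>. Edge vectors have no component along it, so their coordinates are
  divided by at least \<open>\<surd>\<lambda>\<^sub>2\<close>, and \<open>|a\<^sub>e|\<^sup>2 \<le> 2\<close> gives the bound for their length. The second
  conclusion transports the vectors orthogonal to the constants to the new coordinates.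
\<close>
lemma whitened_bernoulli_frame:
  assumes M: "connected_laplacian n (switched_laplacian n G w p)" and n: "2 \<le> n"
    and G: "fin_digraph G" "verts G = {..<n}" and w: "\<And>e. e \<in> arcs G \<Longrightarrow> 0 < w e"
    and W: "\<And>e. e \<in> arcs G \<Longrightarrow> w e \<le> W" "0 < W"
    and p: "\<And>e. e \<in> arcs G \<Longrightarrow> 0 \<le> p e \<and> p e \<le> 1"
  obtains v z where "bernoulli_frame n (arcs G) v z p (2 * W / lambda2 (switched_laplacian n G w p))"
    "\<And>x. x \<in> ones_perp n \<Longrightarrow> \<exists>y\<in>carrier_vec n. z \<bullet> y = 0 \<and> y \<bullet> y = x \<bullet> (switched_laplacian n G w p *\<^sub>v x) \<and>
       (\<forall>e\<in>arcs G. (v e \<bullet> y)\<^sup>2 = w e * (incidence_vec n G e \<bullet> x)\<^sup>2)"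
proof -
  let ?M = "switched_laplacian n G w p"
  let ?a = "incidence_vec n G"
  interpret fin_digraph G by fact
  obtain l u k where eb: "eigenbasis n ?M l u" and k: "k < n" "l k = 0"
    and uk: "\<And>x. x \<in> ones_perp n \<Longrightarrow> u k \<bullet> x = 0"
    and l: "\<And>i. i < n \<Longrightarrow> i \<noteq> k \<Longrightarrow> lambda2 ?M \<le> l i" "0 < lambda2 ?M"
    using connected_laplacian_eigenbasis[OF M n] by metis
  note uc = eigenbasis_carrier[OF eb]
  have l0: "0 \<le> l i" if "i < n" for i using l(1)[OF that] l(2) k(2) by (cases "i = k") auto
  \<comment> \<open>The value 1 at the kernel direction keeps the coordinate change \<open>Y\<close> invertible.\<close>
  define r where "r i = (if i = k then 1 else sqrt (l i))" for i
  have r: "0 < r i" if "i < n" for i using l(1)[OF that] l(2) by (auto simp: r_def)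
  have a_perp: "?a e \<in> ones_perp n" if "e \<in> arcs G" for e
    using incidence_vec_scalar_prod[OF G that, of "Matrix.vec n (\<lambda>_. 1)"]
      tail_in_verts[OF that] head_in_verts[OF that] G(2) by (simp add: ones_perp_def)
  define v where "v e = Matrix.vec n (\<lambda>i. sqrt (w e) * (u i \<bullet> ?a e) / r i)" for e
  define z :: "real Matrix.vec" where "z = unit_vec n k"
  have vc: "v e \<in> carrier_vec n" for e by (simp add: v_def)
  define Y where "Y x = Matrix.vec n (\<lambda>i. r i * (u i \<bullet> x))" for x
  have Y: "Y x \<in> carrier_vec n" for x by (simp add: Y_def)
  have vY: "(v e \<bullet> Y x)\<^sup>2 = w e * (?a e \<bullet> x)\<^sup>2" if "x \<in> carrier_vec n" "e \<in> arcs G" for e x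
  proof -
    have "v e \<bullet> Y x = (\<Sum>i<n. sqrt (w e) * ((u i \<bullet> ?a e) * (u i \<bullet> x)))"
      unfolding scalar_prod_lessThan[OF Y] using r by (intro sum.cong refl) (force simp: v_def Y_def)
    also have "\<dots> = sqrt (w e) * (?a e \<bullet> x)"
      using eigenbasis_parseval[OF eb _ that(1), of "?a e"] by (simp add: sum_distrib_left)
    finally show ?thesis using w[OF that(2)] by (simp add: power_mult_distrib)
  qed
  have zY: "z \<bullet> Y x = u k \<bullet> x" for x using k(1) by (simp add: z_def Y_def r_def)
  have YY: "Y x \<bullet> Y x = x \<bullet> (?M *\<^sub>v x) + (u k \<bullet> x)\<^sup>2" if x: "x \<in> carrier_vec n" for x
  proof -
    have "Y x \<bullet> Y x = (\<Sum>i<n. (r i)\<^sup>2 * ((u i \<bullet> x) * (u i \<bullet> x)))"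
      unfolding scalar_prod_lessThan[OF Y] by (intro sum.cong refl) (simp add: Y_def power2_eq_square)
    also have "\<dots> = (\<Sum>i<n. l i * ((u i \<bullet> x) * (u i \<bullet> x)) + (if i = k then (u k \<bullet> x)\<^sup>2 else 0))"
      using l0 k(2) by (intro sum.cong refl) (auto simp: r_def power2_eq_square)
    also have "\<dots> = x \<bullet> (?M *\<^sub>v x) + (u k \<bullet> x)\<^sup>2"
      unfolding eigenbasis_form[OF eb switched_laplacian_carrier switched_laplacian_symmetric x x]
      using k(1) by (simp add: sum.distrib)
    finally show ?thesis .
  qed
  have surj: "\<exists>x\<in>carrier_vec n. Y x = y" if y: "y \<in> carrier_vec n" for y
  proof -
    define x where "x = Matrix.vec n (\<lambda>j. \<Sum>i<n. y $ i / r i * u i $ j)"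
    have "u m \<bullet> x = y $ m / r m" if m: "m < n" for m
    proof -
      have "u m \<bullet> x = (\<Sum>j<n. \<Sum>i<n. y $ i / r i * (u m $ j * u i $ j))"
        by (simp add: x_def scalar_prod_lessThan[of _ n] sum_distrib_left mult_ac)
      also have "\<dots> = (\<Sum>i<n. \<Sum>j<n. y $ i / r i * (u m $ j * u i $ j))" by (rule sum.swap)
      also have "\<dots> = (\<Sum>i<n. y $ i / r i * (u m \<bullet> u i))"
        using uc by (intro sum.cong refl) (simp add: scalar_prod_lessThan[of _ n] sum_distrib_left)
      also have "\<dots> = (\<Sum>i<n. y $ i / r i * (if m = i then 1 else 0))"
        using eb m by (intro sum.cong refl) (simp add: eigenbasis_def)
      also have "\<dots> = y $ m / r m" using m by (simp add: if_distrib cong: if_cong)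
      finally show ?thesis .
    qed
    then have "Y x = y" using y r by (intro eq_vecI) (force simp: Y_def)+
    then show ?thesis by (intro bexI[of _ x]) (simp_all add: x_def)
  qed
  have frame: "bernoulli_frame n (arcs G) v z p (2 * W / lambda2 ?M)"
  proof (unfold_locales)
    show "z \<in> carrier_vec n" by (simp add: z_def)
    show "0 < 2 * W / lambda2 ?M" using W(2) l(2) by simp
    fix y :: "real Matrix.vec" assume "y \<in> carrier_vec n"
    then obtain x where x: "x \<in> carrier_vec n" "Y x = y" using surj by blast
    have "(\<Sum>e\<in>arcs G. p e * (v e \<bullet> Y x)\<^sup>2) = (\<Sum>e\<in>arcs G. p e * w e * (?a e \<bullet> x)\<^sup>2)"
      using vY[OF x(1)] by (intro sum.cong refl) simp
    then show "(\<Sum>e\<in>arcs G. p e * (v e \<bullet> y)\<^sup>2) + (z \<bullet> y)\<^sup>2 = y \<bullet> y"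
      unfolding x(2)[symmetric] zY YY[OF x(1)] switched_laplacian_form[OF x(1)] by simp
  next
    fix e assume e: "e \<in> arcs G"
    have ac: "?a e \<in> carrier_vec n" by simp
    have "v e \<bullet> v e = (\<Sum>i<n. w e * (((u i \<bullet> ?a e) * (u i \<bullet> ?a e)) / (r i)\<^sup>2))"
      unfolding scalar_prod_lessThan[OF vc] using w[OF e]
      by (intro sum.cong refl) (simp add: v_def power2_eq_square)
    also have "\<dots> \<le> (\<Sum>i<n. w e * (((u i \<bullet> ?a e) * (u i \<bullet> ?a e)) / lambda2 ?M))"
    proof (intro sum_mono mult_left_mono)
      fix i assume i: "i \<in> {..<n}"
      show "((u i \<bullet> ?a e) * (u i \<bullet> ?a e)) / (r i)\<^sup>2 \<le> ((u i \<bullet> ?a e) * (u i \<bullet> ?a e)) / lambda2 ?M"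
      proof (cases "i = k")
        case True
        then show ?thesis using uk[OF a_perp[OF e]] by simp
      next
        case False
        then have "lambda2 ?M \<le> l i" using l i by simp
        then show ?thesis using False l(2) by (intro divide_left_mono) (auto simp: r_def)
      qed
    qed (use w[OF e] in simp)
    also have "\<dots> = w e * (?a e \<bullet> ?a e) / lambda2 ?M"
      unfolding eigenbasis_parseval[OF eb ac ac] by (simp add: sum_distrib_left sum_divide_distrib)
    also have "\<dots> \<le> W * 2 / lambda2 ?M"
      using w[OF e] W(1)[OF e] l(2) incidence_vec_norm_le[OF G e] W(2) scalar_prod_self_nonneg
      by (intro divide_right_mono mult_mono) auto
    finally show "v e \<bullet> v e \<le> 2 * W / lambda2 ?M" by (simp add: mult.commute)
  qed (use vc p in auto)
  show thesis
  proof (rule that[OF frame])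
    fix x assume x: "x \<in> ones_perp n"
    then have xc: "x \<in> carrier_vec n" by (simp add: ones_perp_def)
    show "\<exists>y\<in>carrier_vec n. z \<bullet> y = 0 \<and> y \<bullet> y = x \<bullet> (?M *\<^sub>v x) \<and>
        (\<forall>e\<in>arcs G. (v e \<bullet> y)\<^sup>2 = w e * (?a e \<bullet> x)\<^sup>2)"
      using Y zY YY[OF xc] vY[OF xc] uk[OF x] by (intro bexI[of _ "Y x"]) auto
  qed
qed

lemma laplacian_concentration:
  assumes M: "connected_laplacian n (switched_laplacian n G w p)" and n: "2 \<le> n"
    and G: "fin_digraph G" "verts G = {..<n}" and w: "\<And>e. e \<in> arcs G \<Longrightarrow> 0 < w e"
    and W: "\<And>e. e \<in> arcs G \<Longrightarrow> w e \<le> W" "0 < W"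
    and p: "\<And>e. e \<in> arcs G \<Longrightarrow> 0 \<le> p e \<and> p e \<le> 1"
    and \<epsilon>: "0 < \<epsilon>" "\<epsilon> \<le> 1"
  shows "1 - 2 * real n * exp (- \<epsilon>\<^sup>2 * lambda2 (switched_laplacian n G w p) / (32 * W)) \<le>
    measure_pmf.prob (bernoulli_rounding (arcs G) p)
      {b. loewner_le_on (ones_perp n) ((1 - \<epsilon>) \<cdot>\<^sub>m switched_laplacian n G w p) (switched_laplacian n G w b) \<and>
          loewner_le_on (ones_perp n) (switched_laplacian n G w b) ((1 + \<epsilon>) \<cdot>\<^sub>m switched_laplacian n G w p)}"
proof -
  let ?M = "switched_laplacian n G w p"
  let ?a = "incidence_vec n G" and ?P = "bernoulli_rounding (arcs G) p" and ?L = "switched_laplacian n G w"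
  obtain v z where frame: "bernoulli_frame n (arcs G) v z p (2 * W / lambda2 ?M)"
    and lift: "\<And>x. x \<in> ones_perp n \<Longrightarrow> \<exists>y\<in>carrier_vec n. z \<bullet> y = 0 \<and> y \<bullet> y = x \<bullet> (?M *\<^sub>v x) \<and>
       (\<forall>e\<in>arcs G. (v e \<bullet> y)\<^sup>2 = w e * (?a e \<bullet> x)\<^sup>2)"
    using whitened_bernoulli_frame[OF M n G w W p] by metis
  interpret bernoulli_frame n "arcs G" v z p "2 * W / lambda2 ?M" by (rule frame)
  define U where "U = {b. \<exists>y\<in>carrier_vec n. z \<bullet> y = 0 \<and> (1 + \<epsilon>) * (y \<bullet> y) < (\<Sum>e\<in>arcs G. b e * (v e \<bullet> y)\<^sup>2)}"
  define D where "D = {b. \<exists>y\<in>carrier_vec n. z \<bullet> y = 0 \<and> (\<Sum>e\<in>arcs G. b e * (v e \<bullet> y)\<^sup>2) < (1 - \<epsilon>) * (y \<bullet> y)}"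
  define A where "A = {b. loewner_le_on (ones_perp n) ((1 - \<epsilon>) \<cdot>\<^sub>m ?M) (?L b) \<and>
          loewner_le_on (ones_perp n) (?L b) ((1 + \<epsilon>) \<cdot>\<^sub>m ?M)}"
  define \<tau> where "\<tau> = exp (- \<epsilon>\<^sup>2 * lambda2 ?M / (32 * W))"
  have "- \<epsilon>\<^sup>2 / (16 * (2 * W / lambda2 ?M)) = - \<epsilon>\<^sup>2 * lambda2 ?M / (32 * W)" by simp
  then have tails: "measure_pmf.prob ?P U \<le> real n * \<tau>" "measure_pmf.prob ?P D \<le> real n * \<tau>"
    using upper_tail[OF \<epsilon>] lower_tail[OF \<epsilon>] unfolding U_def D_def \<tau>_def by simp_all
  have "- A \<subseteq> U \<union> D"
  proof
    fix b assume "b \<in> - A"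
    then obtain x where x: "x \<in> ones_perp n" and
      bad: "x \<bullet> (?L b *\<^sub>v x) < x \<bullet> (((1 - \<epsilon>) \<cdot>\<^sub>m ?M) *\<^sub>v x) \<or>
        x \<bullet> (((1 + \<epsilon>) \<cdot>\<^sub>m ?M) *\<^sub>v x) < x \<bullet> (?L b *\<^sub>v x)"
      unfolding A_def loewner_le_on_def by (auto simp: not_le)
    have xc: "x \<in> carrier_vec n" using x by (simp add: ones_perp_def)
    obtain y where y: "y \<in> carrier_vec n" "z \<bullet> y = 0" "y \<bullet> y = x \<bullet> (?M *\<^sub>v x)"
      "\<And>e. e \<in> arcs G \<Longrightarrow> (v e \<bullet> y)\<^sup>2 = w e * (?a e \<bullet> x)\<^sup>2" using lift[OF x] by blast
    have Mx: "?M *\<^sub>v x \<in> carrier_vec n" using xc by (intro mult_mat_vec_carrier[OF switched_laplacian_carrier])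
    have sm: "x \<bullet> ((c \<cdot>\<^sub>m ?M) *\<^sub>v x) = c * (y \<bullet> y)" for c
      using xc Mx y(3) by (simp add: smult_mat_mult_vec[OF switched_laplacian_carrier xc])
    have Lb: "x \<bullet> (?L b *\<^sub>v x) = (\<Sum>e\<in>arcs G. b e * (v e \<bullet> y)\<^sup>2)"
      unfolding switched_laplacian_form[OF xc] using y(4) by (intro sum.cong refl) simp
    show "b \<in> U \<union> D" using bad y unfolding sm Lb U_def D_def by blast
  qed
  then have "measure_pmf.prob ?P (- A) \<le> measure_pmf.prob ?P (U \<union> D)"
    by (intro measure_pmf.finite_measure_mono) auto
  also have "\<dots> \<le> measure_pmf.prob ?P U + measure_pmf.prob ?P D"
    by (intro measure_Un_le) auto
  finally have "measure_pmf.prob ?P (- A) \<le> 2 * real n * \<tau>" using tails by linarith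
  moreover have "measure_pmf.prob ?P (- A) = 1 - measure_pmf.prob ?P A"
    using measure_pmf.prob_compl[of A ?P] by (simp add: Compl_eq_Diff_UNIV)
  ultimately show ?thesis unfolding A_def \<tau>_def by linarith
qed

lemma demand_energy_bounds:
  assumes M: "connected_laplacian n (switched_laplacian n G w s)" and n: "2 \<le> n"
    and G: "fin_digraph G" "verts G = {..<n}" and \<epsilon>: "0 \<le> \<epsilon>" "\<epsilon> < 1"
    and lo: "loewner_le_on (ones_perp n) ((1 - \<epsilon>) \<cdot>\<^sub>m switched_laplacian n G w s) (switched_laplacian n G w b)"
    and up: "loewner_le_on (ones_perp n) (switched_laplacian n G w b) ((1 + \<epsilon>) \<cdot>\<^sub>m switched_laplacian n G w s)"
    and d: "d \<in> ones_perp n"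
  shows "1 / (1 + \<epsilon>) * demand_energy n G w d s \<le> demand_energy n G w d b"
    and "demand_energy n G w d b \<le> 1 / (1 - \<epsilon>) * demand_energy n G w d s"
proof -
  let ?M = "switched_laplacian n G w s"
  let ?L = "switched_laplacian n G w b"
  have sm: "x \<bullet> ((c \<cdot>\<^sub>m ?M) *\<^sub>v x) = c * (x \<bullet> (?M *\<^sub>v x))" if "x \<in> ones_perp n" for c x
  proof -
    have xc: "x \<in> carrier_vec n" using that by (simp add: ones_perp_def)
    moreover have "?M *\<^sub>v x \<in> carrier_vec n" using xc by (intro mult_mat_vec_carrier[OF switched_laplacian_carrier])
    ultimately show ?thesis by (simp add: smult_mat_mult_vec[OF switched_laplacian_carrier xc])
  qed
  have lo': "(1 - \<epsilon>) * (x \<bullet> (?M *\<^sub>v x)) \<le> x \<bullet> (?L *\<^sub>v x)"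
    and up': "x \<bullet> (?L *\<^sub>v x) \<le> (1 + \<epsilon>) * (x \<bullet> (?M *\<^sub>v x))" if "x \<in> ones_perp n" for x
    using lo up that sm[OF that] by (auto simp: loewner_le_on_def)
  have L: "connected_laplacian n ?L"
    unfolding connected_laplacian_def
  proof (intro conjI switched_laplacian_carrier switched_laplacian_symmetric switched_laplacian_ones[OF G]
      ballI impI)
    fix x assume x: "x \<in> ones_perp n" "x \<noteq> 0\<^sub>v n"
    then have "0 < x \<bullet> (?M *\<^sub>v x)" using M by (simp add: connected_laplacian_def)
    then have "0 < (1 - \<epsilon>) * (x \<bullet> (?M *\<^sub>v x))" using \<epsilon> by simp
    then show "0 < x \<bullet> (?L *\<^sub>v x)" using lo'[OF x(1)] by linarith
  qed
  have "d \<bullet> (pinv ?M *\<^sub>v d) \<le> (1 + \<epsilon>) * (d \<bullet> (pinv ?L *\<^sub>v d))"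
    using \<epsilon> by (intro pinv_energy_antimono[OF L M n _ up' d]) auto
  then show "1 / (1 + \<epsilon>) * demand_energy n G w d s \<le> demand_energy n G w d b"
    using \<epsilon> by (simp add: demand_energy_def field_simps)
  have "x \<bullet> (?M *\<^sub>v x) \<le> 1 / (1 - \<epsilon>) * (x \<bullet> (?L *\<^sub>v x))" if "x \<in> ones_perp n" for x
    using lo'[OF that] \<epsilon> by (simp add: field_simps)
  then show "demand_energy n G w d b \<le> 1 / (1 - \<epsilon>) * demand_energy n G w d s"
    unfolding demand_energy_def using \<epsilon> by (intro pinv_energy_antimono[OF M L n _ _ d]) auto
qed

text \<open>
  With \<open>r = (n - 1) / \<delta> \<ge> 2\<close> one has \<open>2 n \<le> 4 (n - 1) = 4 \<delta> r\<close>, and of the four factors \<open>1 / r\<close> in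
  the exponential one cancels \<open>r\<close> and the other three absorb the constant. For two nodes, \<open>r \<ge> 2\<close>
  is where the restriction on \<open>\<delta>\<close> enters.
\<close>
lemma failure_probability_le:
  assumes n: "2 \<le> (n::nat)" and \<delta>: "0 < \<delta>" "\<delta> < 1" "n = 2 \<longrightarrow> \<delta> \<le> 1 / 2"
  shows "2 * real n * exp (- 4 * ln ((real n - 1) / \<delta>)) \<le> \<delta>" and "2 \<le> (real n - 1) / \<delta>"
proof -
  define r where "r = (real n - 1) / \<delta>"
  show r: "2 \<le> (real n - 1) / \<delta>"
  proof (cases "n = 2")
    case True
    then show ?thesis using \<delta> by (simp add: field_simps)
  next
    case False
    then have "2 * \<delta> \<le> real n - 1" using n \<delta> by linarith
    then show ?thesis using \<delta> by (simp add: field_simps)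
  qed
  have r0: "0 < r" using r by (simp add: r_def)
  have "exp (- 4 * ln r) = 1 / exp (real 4 * ln r)" by (simp add: exp_minus inverse_eq_divide)
  also have "exp (real 4 * ln r) = r ^ 4" using r0 by (subst exp_of_nat_mult) simp
  finally have e: "exp (- 4 * ln r) = 1 / r ^ 4" .
  have "2 * real n \<le> 4 * (\<delta> * r)" using n \<delta> by (simp add: r_def)
  then have "2 * real n * (1 / r ^ 4) \<le> 4 * (\<delta> * r) * (1 / r ^ 4)"
    using r0 by (intro mult_right_mono) auto
  also have "\<dots> = \<delta> * (4 / r ^ 3)" using r0 by (simp add: power_numeral_reduce)
  also have "\<dots> \<le> \<delta> * 1"
  proof (intro mult_left_mono)
    have "(2::real) ^ 3 \<le> r ^ 3" using r by (intro power_mono) (auto simp: r_def)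
    then show "4 / r ^ 3 \<le> 1" using r0 by simp
  qed (use \<delta> in simp)
  finally show "2 * real n * exp (- 4 * ln ((real n - 1) / \<delta>)) \<le> \<delta>"
    using e unfolding r_def by simp
qed

text \<open>
  With \<open>\<rho> = R / \<lambda>\<^sub>2\<close>, the constant 8 gives \<open>\<epsilon>\<^sup>2 / (16 \<rho>) = 4 ln ((n - 1) / \<delta>)\<close> in the tail bounds.
  If \<open>\<epsilon> > 1\<close>, then only the lower inequality is claimed, and its left-hand side is nonpositive.
\<close>
lemma laplacian_rounding:
  assumes G: "weighted_multigraph n G w" and n: "2 \<le> n" and T: "connected_backbone G T"
    and s: "\<And>e. e \<in> arcs G \<Longrightarrow> 0 \<le> s e \<and> s e \<le> 1" "\<And>e. e \<in> T \<Longrightarrow> s e = 1"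
    and \<delta>: "0 < \<delta>" "\<delta> < 1" "n = 2 \<longrightarrow> \<delta> \<le> 1 / 2"
    and \<epsilon>_eq: "\<epsilon> = 8 * sqrt (2 * Max (w ` arcs G) * ln ((real n - 1) / \<delta>) /
      lambda2 (switched_laplacian n G w s))"
  shows "1 - \<delta> \<le> measure_pmf.prob (bernoulli_rounding (arcs G) s)
      {b. loewner_le_on (ones_perp n) ((1 - \<epsilon>) \<cdot>\<^sub>m switched_laplacian n G w s) (switched_laplacian n G w b) \<and>
          (\<epsilon> \<le> 1 \<longrightarrow> loewner_le_on (ones_perp n) (switched_laplacian n G w b)
            ((1 + \<epsilon>) \<cdot>\<^sub>m switched_laplacian n G w s))}" (is "_ \<le> measure_pmf.prob ?P ?A")
    and "\<epsilon> < 1 \<Longrightarrow> d \<in> ones_perp n \<Longrightarrow> 1 - \<delta> \<le> measure_pmf.prob (bernoulli_rounding (arcs G) s)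
      {b. 1 / (1 + \<epsilon>) * demand_energy n G w d s \<le> demand_energy n G w d b \<and>
          demand_energy n G w d b \<le> 1 / (1 - \<epsilon>) * demand_energy n G w d s}"
proof -
  have fin: "fin_digraph G" and V: "verts G = {..<n}" and w: "\<And>e. e \<in> arcs G \<Longrightarrow> 0 < w e"
    using G by (auto simp: weighted_multigraph_def)
  interpret fin_digraph G by fact
  let ?M = "switched_laplacian n G w s" and ?L = "switched_laplacian n G w"
  define W where "W = Max (w ` arcs G)"
  have TG: "T \<subseteq> arcs G" using T by (simp add: connected_backbone_def)
  have M: "connected_laplacian n ?M"
    using n s by (intro connected_laplacian_switched[OF fin V w T]) auto
  have l2: "0 < lambda2 ?M" using connected_laplacian_eigenbasis[OF M n] by metis
  have "arcs G \<noteq> {}"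
  proof
    assume "arcs G = {}"
    then have "real 0 = real 1"
      using TG n V by (intro connected_backbone_constant[OF T, of real 0 1]) auto
    then show False by simp
  qed
  then obtain e0 where e0: "e0 \<in> arcs G" by blast
  have W: "w e \<le> W" if "e \<in> arcs G" for e using that by (simp add: W_def)
  have W0: "0 < W" using w[OF e0] W[OF e0] by linarith
  define r where "r = (real n - 1) / \<delta>"
  have r: "2 \<le> r" and fail: "2 * real n * exp (- 4 * ln r) \<le> \<delta>"
    using failure_probability_le[OF n \<delta>] by (auto simp: r_def)
  have lr: "0 < ln r" using r by simp
  have sq: "0 < 2 * W * ln r / lambda2 ?M" using W0 l2 lr by simp
  have \<epsilon>: "\<epsilon> = 8 * sqrt (2 * W * ln r / lambda2 ?M)" by (simp add: \<epsilon>_eq W_def r_def)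
  have \<epsilon>0: "0 < \<epsilon>" using sq by (simp add: \<epsilon>)
  have "\<epsilon>\<^sup>2 = 64 * (2 * W * ln r / lambda2 ?M)"
    using sq unfolding \<epsilon> power_mult_distrib by (subst real_sqrt_pow2) auto
  then have exponent: "- \<epsilon>\<^sup>2 * lambda2 ?M / (32 * W) = - 4 * ln r"
    using W0 l2 by (simp add: field_simps)
  have conc: "1 - \<delta> \<le> measure_pmf.prob ?P
      {b. loewner_le_on (ones_perp n) ((1 - \<epsilon>) \<cdot>\<^sub>m ?M) (?L b) \<and>
          loewner_le_on (ones_perp n) (?L b) ((1 + \<epsilon>) \<cdot>\<^sub>m ?M)}" (is "_ \<le> measure_pmf.prob ?P ?B")
    if "\<epsilon> \<le> 1"
    using laplacian_concentration[OF M n fin V w W W0 s(1) \<epsilon>0 that] fail unfolding exponent by linarith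
  show "1 - \<delta> \<le> measure_pmf.prob ?P ?A"
  proof (cases "\<epsilon> \<le> 1")
    case True
    then have "?A = ?B" by auto
    then show ?thesis using conc[OF True] by simp
  next
    case False
    have "set_pmf ?P \<subseteq> ?A"
    proof
      fix b assume "b \<in> set_pmf ?P"
      then have b: "0 \<le> b e" for e using bernoulli_rounding_range[OF finite_arcs, of b s e] by auto
      have "x \<bullet> (((1 - \<epsilon>) \<cdot>\<^sub>m ?M) *\<^sub>v x) \<le> x \<bullet> (?L b *\<^sub>v x)" if "x \<in> ones_perp n" for x
      proof -
        have xc: "x \<in> carrier_vec n" using that by (simp add: ones_perp_def)
        have Mx: "?M *\<^sub>v x \<in> carrier_vec n" using xc by (intro mult_mat_vec_carrier[OF switched_laplacian_carrier])
        have nonneg: "0 \<le> x \<bullet> (?L t *\<^sub>v x)" if "\<And>e. e \<in> arcs G \<Longrightarrow> 0 \<le> t e" for t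
          unfolding switched_laplacian_form[OF xc] using that w by (intro sum_nonneg) (simp add: less_imp_le)
        have "x \<bullet> (((1 - \<epsilon>) \<cdot>\<^sub>m ?M) *\<^sub>v x) = (1 - \<epsilon>) * (x \<bullet> (?M *\<^sub>v x))"
          using xc Mx by (simp add: smult_mat_mult_vec[OF switched_laplacian_carrier xc])
        also have "\<dots> \<le> 0" using False nonneg[of s] s(1) by (intro mult_nonpos_nonneg) auto
        also have "0 \<le> x \<bullet> (?L b *\<^sub>v x)" using nonneg b by auto
        finally show ?thesis .
      qed
      then show "b \<in> ?A" using False by (simp add: loewner_le_on_def)
    qed
    then have "measure_pmf.prob ?P ?A = 1" by (simp add: measure_pmf.prob_eq_1 AE_measure_pmf_iff subset_iff)
    then show ?thesis using \<delta> by simp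
  qed
  assume less: "\<epsilon> < 1" and d: "d \<in> ones_perp n"
  have "?B \<subseteq> {b. 1 / (1 + \<epsilon>) * demand_energy n G w d s \<le> demand_energy n G w d b \<and>
          demand_energy n G w d b \<le> 1 / (1 - \<epsilon>) * demand_energy n G w d s}" (is "_ \<subseteq> ?D")
    using demand_energy_bounds[OF M n fin V less_imp_le[OF \<epsilon>0] less _ _ d] by blast
  then have "measure_pmf.prob ?P ?B \<le> measure_pmf.prob ?P ?D"
    by (intro measure_pmf.finite_measure_mono) auto
  then show "1 - \<delta> \<le> measure_pmf.prob ?P ?D" using conc less by linarith
qed

theorem theorem2:
  shows "\<exists>C::real. C > 0 \<and>
    (\<forall>n G w T q d0 t s pmin \<delta>.
       weighted_multigraph n G w \<and> n \<ge> 2 \<and> connected_backbone G T \<and>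
       d0 \<in> ones_perp n \<and>
       fw_iterate (arcs G) (demand_energy n G w d0) (feasible_set (arcs G) T q) t s \<and>
       0 \<le> pmin \<and> pmin \<le> 1 \<and> 0 < \<delta> \<and> \<delta> < 1 \<and> (n = 2 \<longrightarrow> \<delta> \<le> 1 / 2) \<longrightarrow>
       (let sbar = with_baseline T pmin s;
            P = bernoulli_rounding (arcs G) sbar;
            L = switched_laplacian n G w;
            R = 2 * Max (w ` arcs G);
            \<epsilon> = C * sqrt (R * ln ((real n - 1) / \<delta>) / lambda2 (L sbar))
        in
          measure_pmf.prob P
            {stilde. loewner_le_on (ones_perp n) ((1 - \<epsilon>) \<cdot>\<^sub>m L sbar) (L stilde) \<and>
                     (\<epsilon> \<le> 1 \<longrightarrow>
                        loewner_le_on (ones_perp n) (L stilde) ((1 + \<epsilon>) \<cdot>\<^sub>m L sbar))}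
          \<ge> 1 - \<delta> \<and>
          (\<epsilon> < 1 \<longrightarrow>
             (\<forall>d\<in>ones_perp n.
                measure_pmf.prob P
                  {stilde. 1 / (1 + \<epsilon>) * demand_energy n G w d sbar \<le> demand_energy n G w d stilde \<and>
                           demand_energy n G w d stilde \<le> 1 / (1 - \<epsilon>) * demand_energy n G w d sbar}
                \<ge> 1 - \<delta>))))"
proof (intro exI[of _ 8] conjI allI impI)
  show "(0::real) < 8" by simp
  fix n :: nat and G :: "(nat, nat) pre_digraph" and w :: "nat \<Rightarrow> real" and T :: "nat set"
    and q :: int and d0 :: "real Matrix.vec" and t :: nat and s :: "nat \<Rightarrow> real" and pmin \<delta> :: real
  assume H: "weighted_multigraph n G w \<and> n \<ge> 2 \<and> connected_backbone G T \<and>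
       d0 \<in> ones_perp n \<and>
       fw_iterate (arcs G) (demand_energy n G w d0) (feasible_set (arcs G) T q) t s \<and>
       0 \<le> pmin \<and> pmin \<le> 1 \<and> 0 < \<delta> \<and> \<delta> < 1 \<and> (n = 2 \<longrightarrow> \<delta> \<le> 1 / 2)"
  define sbar where "sbar = with_baseline T pmin s"
  define \<epsilon> where "\<epsilon> = 8 * sqrt (2 * Max (w ` arcs G) * ln ((real n - 1) / \<delta>) /
      lambda2 (switched_laplacian n G w sbar))"
  have "\<forall>e\<in>arcs G. 0 \<le> s e \<and> s e \<le> 1" using H fw_iterate_feasible by blast
  then have sbar: "0 \<le> sbar e \<and> sbar e \<le> 1" if "e \<in> arcs G" for e
    using that H by (auto simp: sbar_def with_baseline_def)
  have sbarT: "sbar e = 1" if "e \<in> T" for e using that by (simp add: sbar_def with_baseline_def)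
  note result = laplacian_rounding[of n G w T sbar \<delta> \<epsilon>, OF _ _ _ sbar sbarT _ _ _ \<epsilon>_def]
  show "let sbar = with_baseline T pmin s;
            P = bernoulli_rounding (arcs G) sbar;
            L = switched_laplacian n G w;
            R = 2 * Max (w ` arcs G);
            \<epsilon> = 8 * sqrt (R * ln ((real n - 1) / \<delta>) / lambda2 (L sbar))
        in
          measure_pmf.prob P
            {stilde. loewner_le_on (ones_perp n) ((1 - \<epsilon>) \<cdot>\<^sub>m L sbar) (L stilde) \<and>
                     (\<epsilon> \<le> 1 \<longrightarrow>
                        loewner_le_on (ones_perp n) (L stilde) ((1 + \<epsilon>) \<cdot>\<^sub>m L sbar))}
          \<ge> 1 - \<delta> \<and>
          (\<epsilon> < 1 \<longrightarrow>
             (\<forall>d\<in>ones_perp n.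
                measure_pmf.prob P
                  {stilde. 1 / (1 + \<epsilon>) * demand_energy n G w d sbar \<le> demand_energy n G w d stilde \<and>
                           demand_energy n G w d stilde \<le> 1 / (1 - \<epsilon>) * demand_energy n G w d sbar}
                \<ge> 1 - \<delta>))"
    unfolding Let_def sbar_def[symmetric] \<epsilon>_def[symmetric]
    using result H by blast
qed

end
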